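(* Let $(\mathcal U,C)$ be a solid and walled chambered set for $(W,S)$ and let $m\in\mathbb N$. For any $w\in W$ there is a unique $m$-low element $u\in L_m$ such that $u\sim_m w$. Moreover $u\le_R w$. In particular, each closed region of the $m$-Shi arrangement $\operatorname{Shi}_m(W,S)=\{H_\beta\mid\beta\in\Sigma_m\}$ contains a unique element of minimal length, and this element is $m$-low.
   Context: Let $(W,S)$ be a Coxeter system with length function $\ell$, realized via a geometric representation on a real vector space $V$ with symmetric bilinear form $B$, simple roots $\Delta=\{\alpha_s\mid s\in S\}$ ($B(\alpha_s,\alpha_s)=1$), $\Phi=W(\Delta)$, $\Phi^+=\Phi\cap\operatorname{cone}(\Delta)$, $\Phi^-=-\Phi^+$; $s_\beta$ is the reflection in $\beta\in\Phi$. $\Phi(w)=\Phi^+\cap w(\Phi^-)$; $\Phi^1(w)=\{\beta\in\Phi^+\mid\ell(s_\beta w)=\ell(w)-1\}$. Right weak order: $u\le_R w$ iff $\ell(w)=\ell(u)+\ell(u^{-1}w)$. Dominance order on $\Phi^+$: $\alpha\preceq_{\operatorname{dom}}\beta$ iff for all $x\in W$, $\beta\in\Phi(x)\Rightarrow\alpha\in\Phi(x)$; $\operatorname{dp}_\infty(\beta)=|\{\alpha\in\Phi^+\setminus\{\beta\}\mid\alpha\preceq_{\operatorname{dom}}\beta\}|$; $\Sigma_m=\{\beta\in\Phi^+\mid\operatorname{dp}_\infty(\beta)\le m\}$; $L_m=\{x\in W\mid\Phi^1(x)\subseteq\Sigma_m\}$. A chambered set for $(W,S)$ is a pair $(\mathcal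 U,C)$ where $\mathcal U$ is a left $W$-set and $C\subseteq\mathcal U$ is a set of representatives of the $W$-orbits such that the stabilizer of each $a\in C$ is a standard parabolic subgroup $W_J$ ($J\subseteq S$). It is solid if some $a\in C$ has trivial stabilizer, and walled if for each $s\in S$ some $a\in C$ has stabilizer $\{e,s\}$. Chambers: $C_w=wC$; for $X\subseteq W$, $XC=\bigcup_{x\in X}C_x$. For $\alpha\in\Phi$ let $X_\alpha=\{x\in W\mid x^{-1}(\alpha)\in\Phi^+\}$, $H_\alpha^+=X_\alpha C$, $H_\alpha^-=H_{-\alpha}^+$, $H_\alpha=H_\alpha^+\cap H_\alpha^-$. For $\Gamma\subseteq\Phi^+$, a closed region of the arrangement $\{H_\beta\mid\beta\in\Gamma\}$ is a set $XC$ with $X=\bigcap_{\beta\in\Gamma}X_{\epsilon_\beta\beta}$ nonempty, for signs $\epsilon_\beta\in\{\pm1\}$; such subsets $X$ partition $W$. Write $x\sim_m y$ if $C_x$ and $C_y$ lie in the same closed region of the arrangement with $\Gamma=\Sigma_m$ (an element $x$ is said to be contained in the region containing $C_x$). *)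

theory Defs
  imports "HOL-Analysis.Analysis" "HOL-Algebra.Generated_Groups" "HOL-Algebra.Multiplicative_Group"
    "HOL-Algebra.Group_Action"
begin

section \<open>Coxeter systems\<close>

definition word_prod :: "('g, 'x) monoid_scheme \<Rightarrow> 'g list \<Rightarrow> 'g" where
  "word_prod W ws = foldr (\<otimes>\<^bsub>W\<^esub>) ws \<one>\<^bsub>W\<^esub>"

text \<open>
  The congruence on the free monoid over \<open>S\<close> generated by \<open>(st)\<^bsup>m(s,t)\<^esup> \<sim> []\<close>, where \<open>m(s,t)\<close>
  is the order of \<open>st\<close>; the library encodes infinite order as \<open>0\<close>, and then there is no relation.
  The case \<open>s = t\<close> gives \<open>[s, s] \<sim> []\<close>, so the quotient monoid is the group with
  generators \<open>S\<close> and relations \<open>(st)\<^bsup>m(s,t)\<^esup> = 1\<close>.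
\<close>

inductive coxeter_cong :: "('g, 'x) monoid_scheme \<Rightarrow> 'g set \<Rightarrow> 'g list \<Rightarrow> 'g list \<Rightarrow> bool"
  for W :: "('g, 'x) monoid_scheme" and S :: "'g set" where
  relation: "s \<in> S \<Longrightarrow> t \<in> S \<Longrightarrow> group.ord W (s \<otimes>\<^bsub>W\<^esub> t) \<noteq> 0 \<Longrightarrow>
     coxeter_cong W S (concat (replicate (group.ord W (s \<otimes>\<^bsub>W\<^esub> t)) [s, t])) []"
| refl: "us \<in> lists S \<Longrightarrow> coxeter_cong W S us us"
| sym: "coxeter_cong W S us vs \<Longrightarrow> coxeter_cong W S vs us"
| trans: "coxeter_cong W S us vs \<Longrightarrow> coxeter_cong W S vs ws \<Longrightarrow> coxeter_cong W S us ws"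
| append: "coxeter_cong W S us vs \<Longrightarrow> xs \<in> lists S \<Longrightarrow> ys \<in> lists S \<Longrightarrow>
     coxeter_cong W S (xs @ us @ ys) (xs @ vs @ ys)"

locale coxeter_system = group W for W :: "('g, 'x) monoid_scheme" (structure) +
  fixes S :: "'g set"
  assumes S_subset: "S \<subseteq> carrier W"
    and S_generates: "generate W S = carrier W"
    and S_order_2: "s \<in> S \<Longrightarrow> ord s = 2"
    and presentation: "us \<in> lists S \<Longrightarrow> vs \<in> lists S \<Longrightarrow> word_prod W us = word_prod W vs \<Longrightarrow>
       coxeter_cong W S us vs"

definition cox_length :: "('g, 'x) monoid_scheme \<Rightarrow> 'g set \<Rightarrow> 'g \<Rightarrow> nat" where
  "cox_length W S w = (LEAST n. \<exists>ws \<in> lists S. length ws = n \<and> word_prod W ws = w)"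

definition right_weak_le :: "('g, 'x) monoid_scheme \<Rightarrow> 'g set \<Rightarrow> 'g \<Rightarrow> 'g \<Rightarrow> bool" where
  "right_weak_le W S u w \<longleftrightarrow>
     cox_length W S w = cox_length W S u + cox_length W S (inv\<^bsub>W\<^esub> u \<otimes>\<^bsub>W\<^esub> w)"


section \<open>Geometric representations and root systems\<close>

definition reflection :: "('v::real_vector \<Rightarrow> 'v \<Rightarrow> real) \<Rightarrow> 'v \<Rightarrow> 'v \<Rightarrow> 'v" where
  "reflection B \<beta> v = v - (2 * B \<beta> v) *\<^sub>R \<beta>"

text \<open>
  Simple roots are only required to be positively independent (not linearly independent), and
  \<open>B(\<alpha>\<^sub>s, \<alpha>\<^sub>t)\<close> may be any number \<open>\<le> -1\<close> when \<open>st\<close> has infinite order, so the classical Tits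
  representation is a special case.
\<close>

locale geometric_representation = coxeter_system W S
  for W :: "('g, 'x) monoid_scheme" (structure) and S :: "'g set" +
  fixes \<rho> :: "'g \<Rightarrow> 'v::real_vector \<Rightarrow> 'v"
    and \<alpha> :: "'g \<Rightarrow> 'v"
    and B :: "'v \<Rightarrow> 'v \<Rightarrow> real"
  assumes action: "group_action W UNIV \<rho>"
    and linear_action: "w \<in> carrier W \<Longrightarrow> linear (\<rho> w)"
    and bilinear_form: "bilinear B"
    and symmetric_form: "B u v = B v u"
    and simple_norm: "s \<in> S \<Longrightarrow> B (\<alpha> s) (\<alpha> s) = 1"
    and simple_finite: "s \<in> S \<Longrightarrow> t \<in> S \<Longrightarrow> s \<noteq> t \<Longrightarrow> ord (s \<otimes> t) \<noteq> 0 \<Longrightarrow>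
       B (\<alpha> s) (\<alpha> t) = - cos (pi / real (ord (s \<otimes> t)))"
    and simple_infinite: "s \<in> S \<Longrightarrow> t \<in> S \<Longrightarrow> s \<noteq> t \<Longrightarrow> ord (s \<otimes> t) = 0 \<Longrightarrow>
       B (\<alpha> s) (\<alpha> t) \<le> - 1"
    and positively_independent: "finite F \<Longrightarrow> F \<subseteq> S \<Longrightarrow> (\<And>s. s \<in> F \<Longrightarrow> 0 \<le> c s) \<Longrightarrow>
       (\<Sum>s\<in>F. c s *\<^sub>R \<alpha> s) = 0 \<Longrightarrow> s \<in> F \<Longrightarrow> c s = (0::real)"
    and simple_reflection: "s \<in> S \<Longrightarrow> \<rho> s = reflection B (\<alpha> s)"

definition roots ::
  "('g, 'x) monoid_scheme \<Rightarrow> 'g set \<Rightarrow> ('g \<Rightarrow> 'v \<Rightarrow> 'v) \<Rightarrow> ('g \<Rightarrow> 'v) \<Rightarrow> 'v::real_vector set" where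
  "roots W S \<rho> \<alpha> = {\<rho> w (\<alpha> s) | w s. w \<in> carrier W \<and> s \<in> S}"

definition pos_roots ::
  "('g, 'x) monoid_scheme \<Rightarrow> 'g set \<Rightarrow> ('g \<Rightarrow> 'v \<Rightarrow> 'v) \<Rightarrow> ('g \<Rightarrow> 'v) \<Rightarrow> 'v::real_vector set" where
  "pos_roots W S \<rho> \<alpha> = roots W S \<rho> \<alpha> \<inter> (convex_cone hull (\<alpha> ` S))"

definition neg_roots ::
  "('g, 'x) monoid_scheme \<Rightarrow> 'g set \<Rightarrow> ('g \<Rightarrow> 'v \<Rightarrow> 'v) \<Rightarrow> ('g \<Rightarrow> 'v) \<Rightarrow> 'v::real_vector set" where
  "neg_roots W S \<rho> \<alpha> = uminus ` pos_roots W S \<rho> \<alpha>"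

text \<open>
  For a root \<open>\<beta> = w(\<alpha>\<^sub>s)\<close> this is the group element \<open>w s w\<^bsup>-1\<^esup>\<close>; a geometric representation is
  faithful, so the description is unique.
\<close>

definition root_reflection ::
  "('g, 'x) monoid_scheme \<Rightarrow> ('g \<Rightarrow> 'v \<Rightarrow> 'v) \<Rightarrow> ('v::real_vector \<Rightarrow> 'v \<Rightarrow> real) \<Rightarrow> 'v \<Rightarrow> 'g" where
  "root_reflection W \<rho> B \<beta> = (THE g. g \<in> carrier W \<and> \<rho> g = reflection B \<beta>)"

definition inversion_set ::
  "('g, 'x) monoid_scheme \<Rightarrow> 'g set \<Rightarrow> ('g \<Rightarrow> 'v \<Rightarrow> 'v) \<Rightarrow> ('g \<Rightarrow> 'v) \<Rightarrow> 'g \<Rightarrow> 'v::real_vector set"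
  where "inversion_set W S \<rho> \<alpha> w = pos_roots W S \<rho> \<alpha> \<inter> \<rho> w ` neg_roots W S \<rho> \<alpha>"

definition short_inversion_set ::
  "('g, 'x) monoid_scheme \<Rightarrow> 'g set \<Rightarrow> ('g \<Rightarrow> 'v \<Rightarrow> 'v) \<Rightarrow> ('g \<Rightarrow> 'v) \<Rightarrow> ('v \<Rightarrow> 'v \<Rightarrow> real) \<Rightarrow>
     'g \<Rightarrow> 'v::real_vector set" where
  "short_inversion_set W S \<rho> \<alpha> B w = {\<beta> \<in> pos_roots W S \<rho> \<alpha>.
     cox_length W S (root_reflection W \<rho> B \<beta> \<otimes>\<^bsub>W\<^esub> w) + 1 = cox_length W S w}"


section \<open>Dominance order and low elements\<close>

definition dominance_le ::
  "('g, 'x) monoid_scheme \<Rightarrow> 'g set \<Rightarrow> ('g \<Rightarrow> 'v \<Rightarrow> 'v) \<Rightarrow> ('g \<Rightarrow> 'v) \<Rightarrow>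
     'v::real_vector \<Rightarrow> 'v \<Rightarrow> bool" where
  "dominance_le W S \<rho> \<alpha> \<gamma> \<beta> \<longleftrightarrow> (\<forall>x \<in> carrier W.
     \<beta> \<in> inversion_set W S \<rho> \<alpha> x \<longrightarrow> \<gamma> \<in> inversion_set W S \<rho> \<alpha> x)"

text \<open>
  The set counted here is always finite, since every root dominated by \<open>\<beta>\<close> lies in the inversion
  set of the reflection in \<open>\<beta>\<close>; so \<open>card\<close> never takes its default value.
\<close>

definition inf_depth ::
  "('g, 'x) monoid_scheme \<Rightarrow> 'g set \<Rightarrow> ('g \<Rightarrow> 'v \<Rightarrow> 'v) \<Rightarrow> ('g \<Rightarrow> 'v) \<Rightarrow> 'v::real_vector \<Rightarrow> nat" where
  "inf_depth W S \<rho> \<alpha> \<beta> = card {\<gamma> \<in> pos_roots W S \<rho> \<alpha> - {\<beta>}. dominance_le W S \<rho> \<alpha> \<gamma> \<beta>}"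

definition small_roots ::
  "('g, 'x) monoid_scheme \<Rightarrow> 'g set \<Rightarrow> ('g \<Rightarrow> 'v \<Rightarrow> 'v) \<Rightarrow> ('g \<Rightarrow> 'v) \<Rightarrow> nat \<Rightarrow>
     'v::real_vector set" where
  "small_roots W S \<rho> \<alpha> m = {\<beta> \<in> pos_roots W S \<rho> \<alpha>. inf_depth W S \<rho> \<alpha> \<beta> \<le> m}"

definition low_elements ::
  "('g, 'x) monoid_scheme \<Rightarrow> 'g set \<Rightarrow> ('g \<Rightarrow> 'v \<Rightarrow> 'v) \<Rightarrow> ('g \<Rightarrow> 'v) \<Rightarrow> ('v::real_vector \<Rightarrow> 'v \<Rightarrow> real) \<Rightarrow>
     nat \<Rightarrow> 'g set" where
  "low_elements W S \<rho> \<alpha> B m =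
     {x \<in> carrier W. short_inversion_set W S \<rho> \<alpha> B x \<subseteq> small_roots W S \<rho> \<alpha> m}"


section \<open>Chambered sets\<close>

locale chambered_set = coxeter_system W S + group_action W U \<phi>
  for W :: "('g, 'x) monoid_scheme" (structure) and S :: "'g set"
    and U :: "'u set" and \<phi> :: "'g \<Rightarrow> 'u \<Rightarrow> 'u" +
  fixes C :: "'u set"
  assumes C_subset: "C \<subseteq> U"
    and orbit_representatives: "Q \<in> orbits W U \<phi> \<Longrightarrow> \<exists>!a. a \<in> C \<and> a \<in> Q"
    and stabilizer_parabolic: "a \<in> C \<Longrightarrow> \<exists>J \<subseteq> S. stabilizer W \<phi> a = generate W J"

definition solid :: "('g, 'x) monoid_scheme \<Rightarrow> ('g \<Rightarrow> 'u \<Rightarrow> 'u) \<Rightarrow> 'u set \<Rightarrow> bool" where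
  "solid W \<phi> C \<longleftrightarrow> (\<exists>a \<in> C. stabilizer W \<phi> a = {\<one>\<^bsub>W\<^esub>})"

definition walled :: "('g, 'x) monoid_scheme \<Rightarrow> 'g set \<Rightarrow> ('g \<Rightarrow> 'u \<Rightarrow> 'u) \<Rightarrow> 'u set \<Rightarrow> bool" where
  "walled W S \<phi> C \<longleftrightarrow> (\<forall>s \<in> S. \<exists>a \<in> C. stabilizer W \<phi> a = {\<one>\<^bsub>W\<^esub>, s})"

definition chamber :: "('g \<Rightarrow> 'u \<Rightarrow> 'u) \<Rightarrow> 'u set \<Rightarrow> 'g \<Rightarrow> 'u set" where
  "chamber \<phi> C w = \<phi> w ` C"

definition chamber_union :: "('g \<Rightarrow> 'u \<Rightarrow> 'u) \<Rightarrow> 'u set \<Rightarrow> 'g set \<Rightarrow> 'u set" where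
  "chamber_union \<phi> C X = (\<Union>x \<in> X. chamber \<phi> C x)"

definition pos_elements ::
  "('g, 'x) monoid_scheme \<Rightarrow> 'g set \<Rightarrow> ('g \<Rightarrow> 'v \<Rightarrow> 'v) \<Rightarrow> ('g \<Rightarrow> 'v) \<Rightarrow> 'v::real_vector \<Rightarrow> 'g set"
  where
  "pos_elements W S \<rho> \<alpha> \<beta> = {x \<in> carrier W. \<rho> (inv\<^bsub>W\<^esub> x) \<beta> \<in> pos_roots W S \<rho> \<alpha>}"

definition half_space ::
  "('g, 'x) monoid_scheme \<Rightarrow> 'g set \<Rightarrow> ('g \<Rightarrow> 'v \<Rightarrow> 'v) \<Rightarrow> ('g \<Rightarrow> 'v) \<Rightarrow>
     ('g \<Rightarrow> 'u \<Rightarrow> 'u) \<Rightarrow> 'u set \<Rightarrow> 'v::real_vector \<Rightarrow> 'u set" where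
  "half_space W S \<rho> \<alpha> \<phi> C \<beta> = chamber_union \<phi> C (pos_elements W S \<rho> \<alpha> \<beta>)"

definition wall ::
  "('g, 'x) monoid_scheme \<Rightarrow> 'g set \<Rightarrow> ('g \<Rightarrow> 'v \<Rightarrow> 'v) \<Rightarrow> ('g \<Rightarrow> 'v) \<Rightarrow>
     ('g \<Rightarrow> 'u \<Rightarrow> 'u) \<Rightarrow> 'u set \<Rightarrow> 'v::real_vector \<Rightarrow> 'u set" where
  "wall W S \<rho> \<alpha> \<phi> C \<beta> = half_space W S \<rho> \<alpha> \<phi> C \<beta> \<inter> half_space W S \<rho> \<alpha> \<phi> C (- \<beta>)"

definition closed_region ::
  "('g, 'x) monoid_scheme \<Rightarrow> 'g set \<Rightarrow> ('g \<Rightarrow> 'v \<Rightarrow> 'v) \<Rightarrow> ('g \<Rightarrow> 'v) \<Rightarrow>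
     ('g \<Rightarrow> 'u \<Rightarrow> 'u) \<Rightarrow> 'u set \<Rightarrow> 'v::real_vector set \<Rightarrow> 'u set \<Rightarrow> bool" where
  "closed_region W S \<rho> \<alpha> \<phi> C \<Gamma> R \<longleftrightarrow> (\<exists>(\<epsilon> :: 'v \<Rightarrow> real) X.
     (\<forall>\<beta> \<in> \<Gamma>. \<epsilon> \<beta> \<in> {1, - 1}) \<and>
     X = {x \<in> carrier W. \<forall>\<beta> \<in> \<Gamma>. x \<in> pos_elements W S \<rho> \<alpha> (\<epsilon> \<beta> *\<^sub>R \<beta>)} \<and>
     X \<noteq> {} \<and> R = chamber_union \<phi> C X)"

text \<open>
  The same notion for an arrangement given as a set of walls. For a walled chambered set the map
  \<open>\<beta> \<mapsto> H\<^sub>\<beta>\<close> is injective on positive roots, so \<open>\<Gamma>\<close> is determined by the arrangement.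
\<close>

definition region_of_arrangement ::
  "('g, 'x) monoid_scheme \<Rightarrow> 'g set \<Rightarrow> ('g \<Rightarrow> 'v \<Rightarrow> 'v) \<Rightarrow> ('g \<Rightarrow> 'v::real_vector) \<Rightarrow>
     ('g \<Rightarrow> 'u \<Rightarrow> 'u) \<Rightarrow> 'u set \<Rightarrow> 'u set set \<Rightarrow> 'u set \<Rightarrow> bool" where
  "region_of_arrangement W S \<rho> \<alpha> \<phi> C \<A> R \<longleftrightarrow> (\<exists>\<Gamma> \<subseteq> pos_roots W S \<rho> \<alpha>.
     \<A> = wall W S \<rho> \<alpha> \<phi> C ` \<Gamma> \<and> closed_region W S \<rho> \<alpha> \<phi> C \<Gamma> R)"

definition shi_arrangement ::
  "('g, 'x) monoid_scheme \<Rightarrow> 'g set \<Rightarrow> ('g \<Rightarrow> 'v \<Rightarrow> 'v) \<Rightarrow> ('g \<Rightarrow> 'v::real_vector) \<Rightarrow>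
     ('g \<Rightarrow> 'u \<Rightarrow> 'u) \<Rightarrow> 'u set \<Rightarrow> nat \<Rightarrow> 'u set set" where
  "shi_arrangement W S \<rho> \<alpha> \<phi> C m = wall W S \<rho> \<alpha> \<phi> C ` small_roots W S \<rho> \<alpha> m"

definition shi_equiv ::
  "('g, 'x) monoid_scheme \<Rightarrow> 'g set \<Rightarrow> ('g \<Rightarrow> 'v \<Rightarrow> 'v) \<Rightarrow> ('g \<Rightarrow> 'v::real_vector) \<Rightarrow>
     ('g \<Rightarrow> 'u \<Rightarrow> 'u) \<Rightarrow> 'u set \<Rightarrow> nat \<Rightarrow> 'g \<Rightarrow> 'g \<Rightarrow> bool" where
  "shi_equiv W S \<rho> \<alpha> \<phi> C m x y \<longleftrightarrow> (\<exists>R. closed_region W S \<rho> \<alpha> \<phi> C (small_roots W S \<rho> \<alpha> m) R \<and>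
     chamber \<phi> C x \<subseteq> R \<and> chamber \<phi> C y \<subseteq> R)"

end

theory Submission
  imports Defs
begin

text \<open>
  Let \<open>u\<close> have minimal length among the elements equivalent to \<open>w\<close>. For a right descent \<open>s\<close> of \<open>u\<close>
  the element \<open>us\<close> lies on the other side of exactly one wall, that of the root \<open>-u(\<alpha>\<^sub>s)\<close>, so this
  root is in \<open>\<Sigma>\<^sub>m\<close> by minimality. That \<open>u\<close> is low therefore follows from the fact that on \<open>\<Phi>\<^sup>1(u)\<close>
  the \<open>\<infinity>\<close>-depth is maximal at some right descent root. Conversely, if \<open>u\<close> is low and equivalent
  to \<open>w\<close>, then \<open>\<Phi>\<^sup>1(u) \<subseteq> \<Phi>(w)\<close>, hence \<open>\<Phi>(u) \<subseteq> \<Phi>(w)\<close> because \<open>\<Phi>(u)\<close> lies in the cone of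
  \<open>\<Phi>\<^sup>1(u)\<close>; this means \<open>u \<le>\<^sub>R w\<close> and gives uniqueness.

  The fact about \<open>\<Phi>\<^sup>1(u)\<close> is reduced to rank two: if \<open>b, \<dots>, d\<close> are the positive roots of a finite
  dihedral reflection subgroup in angular order with \<open>b\<close>, \<open>d\<close> its simple roots, then no root
  strictly between them dominates fewer roots than \<open>b\<close>. Most cases follow by applying a reflection
  in a positive root \<open>k\<close> to a positive root \<open>b\<close> with \<open>B(b, k) \<le> 0\<close>, which does not decrease the
  number of dominated roots. The remaining one, comparing the first two roots when the dihedral
  group contains \<open>-1\<close>, is settled by an injection whose definition needs the possible values of
  the form on the plane, found with an extremal root inverted by \<open>-1\<close>.
\<close>

section \<open>Dominance in an abstract root system\<close>

text \<open>The depth of a short inversion \<open>r\<close> of \<open>u\<close> is hard to follow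
  directly, but it is a property of the root alone, so the group element may be changed. With x =
  u^-1, the root -x^-1(r) stays the same if x is replaced by hx and r by h(r). Raising x in this way
  makes h(r) simple or puts it in a plane with a suitable simple root. Coming back from hx to x only
  exchanges roots inside finite dihedral planes, which is why rank two suffices.

  In a plane with M positive roots, numbered by angle, every reflection of the plane preserves the
  parity of the number if M is even. The first two roots are then not conjugate in the plane, and
  the roots dominated by the first but not by the second have to be moved one by one. Their form
  values with the plane fill a triangle that shrinks with the angle pi/M; how small it is separates
  the cases M = 4, M = 6 and M >= 8.\<close>

fun cheb :: "real \<Rightarrow> nat \<Rightarrow> real" where
  "cheb c 0 = 0"
| "cheb c (Suc 0) = 1"
| "cheb c (Suc (Suc k)) = 2 * c * cheb c (Suc k) - cheb c k"

text \<open>\<open>cheb c k\<close> is the Chebyshev polynomial of the second kind of degree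
  \<open>k - 1\<close>, taken at \<open>c\<close>. For \<open>c = cos t\<close> it is
  \<open>sin (k t) / sin t\<close>, so its sign is known as long as \<open>k t\<close> stays below
  pi; the form without division also covers \<open>sin t = 0\<close>.\<close>

lemma sin_cheb: "sin t * cheb (cos t) k = sin (real k * t)"
proof (induction "cos t" k rule: cheb.induct)
  case (3 k)
  have "sin (real (Suc (Suc k)) * t) + sin (real k * t) = 2 * cos t * sin (real (Suc k) * t)"
    using sin_add[of "real (Suc k) * t" t] sin_diff[of "real (Suc k) * t" t]
    by (simp add: algebra_simps)
  with 3 show ?case by (simp add: algebra_simps)
qed auto

lemma cheb_less_Suc:
  assumes "1 \<le> c"
  shows "0 \<le> cheb c k \<and> cheb c k < cheb c (Suc k)"
proof (induction k)
  case (Suc k)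
  then have "2 * cheb c (Suc k) \<le> 2 * c * cheb c (Suc k)"
    using assms by (intro mult_right_mono) auto
  with Suc have "cheb c (Suc k) < 2 * c * cheb c (Suc k) - cheb c k"
    by linarith
  with Suc show ?case by simp
qed simp

lemma cheb_strict_mono: "1 \<le> c \<Longrightarrow> strict_mono (cheb c)"
  using cheb_less_Suc by (simp add: strict_mono_Suc_iff)

text \<open>Lengths and generators are left out: the dominance arguments use only the form, a
  pointed cone that gives every root a sign, and finiteness of the inversion sets.\<close>

locale root_datum =
  fixes B :: "'v::real_vector \<Rightarrow> 'v \<Rightarrow> real" and R K :: "'v set" and G :: "('v \<Rightarrow> 'v) set"
  assumes bil: "bilinear B"
    and sym: "B u v = B v u"
    and norm_root: "r \<in> R \<Longrightarrow> B r r = 1"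
    and K_add: "u \<in> K \<Longrightarrow> v \<in> K \<Longrightarrow> u + v \<in> K"
    and K_scale: "v \<in> K \<Longrightarrow> 0 \<le> a \<Longrightarrow> a *\<^sub>R v \<in> K"
    and K_pointed: "v \<in> K \<Longrightarrow> - v \<in> K \<Longrightarrow> v = 0"
    and root_sign: "r \<in> R \<Longrightarrow> r \<in> K \<or> - r \<in> K"
    and G_id: "(\<lambda>v. v) \<in> G"
    and G_comp: "f \<in> G \<Longrightarrow> g \<in> G \<Longrightarrow> (\<lambda>v. f (g v)) \<in> G"
    and G_inv: "f \<in> G \<Longrightarrow> \<exists>g\<in>G. \<forall>v. f (g v) = v \<and> g (f v) = v"
    and G_linear: "f \<in> G \<Longrightarrow> linear f"
    and G_root: "f \<in> G \<Longrightarrow> r \<in> R \<Longrightarrow> f r \<in> R"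
    and G_form: "f \<in> G \<Longrightarrow> B (f u) (f v) = B u v"
    and G_reflection: "r \<in> R \<Longrightarrow> reflection B r \<in> G"
    and finite_inversions: "f \<in> G \<Longrightarrow> finite {r \<in> R. r \<in> K \<and> - f r \<in> K}"
begin

lemmas B_simps =
  bilinear_ladd[OF bil] bilinear_radd[OF bil] bilinear_lmul[OF bil] bilinear_rmul[OF bil]
  bilinear_lneg[OF bil] bilinear_rneg[OF bil] bilinear_lsub[OF bil] bilinear_rsub[OF bil]
  bilinear_lzero[OF bil] bilinear_rzero[OF bil]

lemma G_simps:
  assumes "f \<in> G"
  shows "f (u + v) = f u + f v" "f (u - v) = f u - f v" "f (- v) = - f v"
    "f (a *\<^sub>R v) = a *\<^sub>R f v" "f 0 = 0"
  using G_linear[OF assms] by (simp_all add: linear_add linear_diff linear_neg linear_scale linear_0)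

lemma root_nonzero: "r \<in> R \<Longrightarrow> r \<noteq> 0"
  using norm_root B_simps(9) by force

lemma root_not_both: "r \<in> R \<Longrightarrow> r \<in> K \<Longrightarrow> - r \<notin> K"
  using K_pointed root_nonzero by blast

lemma not_pos_root: "r \<in> R \<Longrightarrow> r \<notin> K \<longleftrightarrow> - r \<in> K"
  using root_not_both root_sign by blast

lemma not_neg_root: "r \<in> R \<Longrightarrow> - r \<notin> K \<longleftrightarrow> r \<in> K"
  using root_not_both root_sign by blast

lemma refl_self: "r \<in> R \<Longrightarrow> reflection B r r = - r"
  by (simp add: reflection_def norm_root scaleR_2)

lemma neg_root: "r \<in> R \<Longrightarrow> - r \<in> R"
  using G_root[OF G_reflection] refl_self by metis

lemma refl_root: "r \<in> R \<Longrightarrow> x \<in> R \<Longrightarrow> reflection B r x \<in> R"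
  using G_root G_reflection by blast

lemma refl_refl: "r \<in> R \<Longrightarrow> reflection B r (reflection B r x) = x"
  by (simp add: reflection_def B_simps norm_root algebra_simps)

lemma refl_eq_iff: "r \<in> R \<Longrightarrow> reflection B r x = y \<longleftrightarrow> x = reflection B r y"
  using refl_refl by metis

lemma refl_form: "r \<in> R \<Longrightarrow> B (reflection B r u) (reflection B r v) = B u v"
  using G_form G_reflection by blast

lemma K_zero: "v \<in> K \<Longrightarrow> 0 \<in> K"
  using K_scale[of v 0] by simp

lemma K_comb: "u \<in> K \<Longrightarrow> v \<in> K \<Longrightarrow> 0 \<le> a \<Longrightarrow> 0 \<le> b \<Longrightarrow> a *\<^sub>R u + b *\<^sub>R v \<in> K"
  by (simp add: K_add K_scale)

lemma K_descale: "a *\<^sub>R v \<in> K \<Longrightarrow> 0 < a \<Longrightarrow> v \<in> K"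
  using K_scale[of "a *\<^sub>R v" "1 / a"] by simp

definition dom_le :: "'v \<Rightarrow> 'v \<Rightarrow> bool" where
  "dom_le x y \<longleftrightarrow> (\<forall>w\<in>G. - w y \<in> K \<longrightarrow> - w x \<in> K)"

definition dominated :: "'v \<Rightarrow> 'v set" where
  "dominated y = {x \<in> R. x \<in> K \<and> dom_le x y}"

lemma dom_leD: "dom_le x y \<Longrightarrow> w \<in> G \<Longrightarrow> - w y \<in> K \<Longrightarrow> - w x \<in> K"
  by (simp add: dom_le_def)

lemma dom_le_refl: "dom_le x x"
  by (simp add: dom_le_def)

lemma dom_le_trans: "dom_le x y \<Longrightarrow> dom_le y z \<Longrightarrow> dom_le x z"
  by (simp add: dom_le_def)

lemma dom_le_image: "dom_le x y \<Longrightarrow> g \<in> G \<Longrightarrow> dom_le (g x) (g y)"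
  unfolding dom_le_def using G_comp[of _ g] by fast

lemma dom_le_image_iff: "g \<in> G \<Longrightarrow> dom_le (g x) (g y) \<longleftrightarrow> dom_le x y"
  by (metis G_inv dom_le_image)

lemma dom_le_uminus: "x \<in> R \<Longrightarrow> y \<in> R \<Longrightarrow> dom_le (- x) (- y) \<longleftrightarrow> dom_le y x"
  unfolding dom_le_def using G_root[of _ x] G_root[of _ y] not_neg_root
  by (simp add: G_simps) blast

lemma finite_dominated:
  assumes "y \<in> R" "y \<in> K"
  shows "finite (dominated y)"
proof (rule finite_subset)
  show "dominated y \<subseteq> {r \<in> R. r \<in> K \<and> - reflection B y r \<in> K}"
    using assms dom_leD[OF _ G_reflection, of _ y y] by (auto simp: dominated_def refl_self)
qed (use assms finite_inversions G_reflection in blast)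

text \<open>The roots met by reflecting alternately: with \<open>x\<close> as term -1 and
  \<open>y\<close> as term 0, each further term is minus the reflection of the last but one term in
  the last one. A step from \<open>(x, y)\<close> to \<open>(y, - reflection B y x)\<close>
  preserves the form value, and it preserves dominance between the two.\<close>

definition string :: "'v \<Rightarrow> 'v \<Rightarrow> nat \<Rightarrow> 'v" where
  "string x y k = cheb (B x y) (Suc k) *\<^sub>R y - cheb (B x y) k *\<^sub>R x"

lemma string_0 [simp]: "string x y 0 = y"
  by (simp add: string_def)

lemma string_Suc:
  assumes "y \<in> R"
  shows "string x y (Suc k) = string y (- reflection B y x) k"
proof -
  have "B y (- reflection B y x) = B x y"
    using assms by (simp add: reflection_def B_simps norm_root sym[of y x])
  then show ?thesis
    by (simp add: string_def reflection_def sym[of y x] algebra_simps)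
qed

lemma string_root: "x \<in> R \<Longrightarrow> y \<in> R \<Longrightarrow> string x y k \<in> R"
  by (induction k arbitrary: x y) (simp_all add: string_Suc neg_root refl_root)

lemma dom_le_next:
  assumes "x \<in> R" "y \<in> R" "dom_le x y"
  shows "dom_le y (- reflection B y x)"
proof -
  have "dom_le (- reflection B y y) (- reflection B y x)"
    using assms by (simp add: dom_le_uminus refl_root dom_le_image_iff G_reflection)
  then show ?thesis
    using assms by (simp add: refl_self)
qed

lemma dom_le_prev:
  assumes "x \<in> R" "y \<in> R" "dom_le x y"
  shows "dom_le (- reflection B x y) x"
proof -
  have "dom_le (- reflection B x y) (- reflection B x x)"
    using assms by (simp add: dom_le_uminus refl_root dom_le_image_iff G_reflection)
  then show ?thesis
    using assms by (simp add: refl_self)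
qed

lemma dom_le_string:
  assumes "x \<in> R" "y \<in> R" "dom_le x y"
  shows "dom_le x (string x y k)"
  using assms
proof (induction k arbitrary: x y)
  case (Suc k)
  then have "dom_le y (string y (- reflection B y x) k)"
    using dom_le_next[of x y] neg_root[OF refl_root[of y x]] by simp
  with Suc.prems show ?case
    by (metis string_Suc dom_le_trans[of x y])
qed simp

lemma dom_le_string_prev:
  assumes "x \<in> R" "y \<in> R" "dom_le x y"
  shows "dom_le (string y x k) y"
  using assms
proof (induction k arbitrary: x y)
  case (Suc k)
  then have "dom_le (string x (- reflection B x y) k) x"
    using dom_le_prev[of x y] neg_root[OF refl_root[of x y]] by simp
  with Suc.prems show ?case
    by (metis string_Suc dom_le_trans[of _ x y])
qed simp

text \<open>If \<open>x\<close> is dominated by \<open>y\<close>, it is dominated by every term of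
  their string, so all terms are positive with \<open>x\<close>. A form value below 1 contradicts
  this: the string then turns around in the plane and reaches a negative root after finitely many
  steps.\<close>

lemma pos_dom_le_imp_form_ge_1:
  assumes x: "x \<in> R" "x \<in> K" and y: "y \<in> R" "y \<in> K" and ne: "x \<noteq> y" and dom: "dom_le x y"
  shows "1 \<le> B x y"
proof (rule ccontr)
  assume lt: "\<not> 1 \<le> B x y"
  have pos: "string x y k \<in> K" for k
    using dom_leD[OF dom_le_string[OF x(1) y(1) dom] G_id] x string_root[OF x(1) y(1)]
      not_pos_root by blast
  show False
  proof (cases "B x y \<le> 0")
    case True
    have "- string x y 1 = x + (- 2 * B x y) *\<^sub>R y"
      by (simp add: string_def)
    then have "- string x y 1 \<in> K"
      using True x y K_add[of x "(- 2 * B x y) *\<^sub>R y"] K_scale[of y "- 2 * B x y"] by simp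
    then show False
      using pos root_not_both string_root x y by blast
  next
    case False
    define t where "t = arccos (B x y)"
    have c: "cos t = B x y"
      using False lt by (simp add: t_def)
    have t: "0 < t" "t < pi"
      using False lt arccos_lt_bounded[of "B x y"] by (auto simp: t_def)
    then have s: "0 < sin t"
      by (simp add: sin_gt_zero)
    \<comment> \<open>The first index at which the angle reaches pi. In term \<open>k - 1\<close> of
      the string the coefficient of \<open>y\<close> is then no longer positive, while that of
      \<open>- x\<close> is still nonnegative, so the term is negative.\<close>
    define k where "k = (LEAST k. pi \<le> real k * t)"
    have ex: "\<exists>k. pi \<le> real k * t"
      using reals_Archimedean3[OF t(1)] by (meson less_imp_le)
    have k: "pi \<le> real k * t"
      unfolding k_def using ex by (rule LeastI_ex)
    then obtain j where j: "k = Suc j"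
      using pi_gt_zero by (cases k) auto
    have jt: "real j * t < pi"
      using not_less_Least[of j "\<lambda>k. pi \<le> real k * t"] j k_def by auto
    have "sin (real k * t) = - sin (real k * t - pi)"
      by (simp add: sin_diff)
    moreover have "0 \<le> sin (real k * t - pi)"
      using k jt t j by (intro sin_ge_zero) (auto simp: algebra_simps)
    ultimately have "sin t * cheb (B x y) k \<le> 0" "0 \<le> sin t * cheb (B x y) j"
      using sin_ge_zero[of "real j * t"] t jt sin_cheb[of t] by (auto simp: c)
    then have "cheb (B x y) k \<le> 0" "0 \<le> cheb (B x y) j"
      using s by (auto simp: mult_le_0_iff zero_le_mult_iff)
    then have "- string x y j \<in> K"
      using K_add[OF K_scale[OF x(2), of "cheb (B x y) j"] K_scale[OF y(2), of "- cheb (B x y) k"]]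
      by (simp add: string_def j)
    then show False
      using pos root_not_both string_root x y by blast
  qed
qed

lemma dom_le_imp_form_ge_1:
  assumes x: "x \<in> R" and y: "y \<in> R" and ne: "x \<noteq> y" and dom: "dom_le x y"
  shows "1 \<le> B x y"
proof -
  have *: "1 \<le> B x y" if "x \<in> R" "y \<in> R" "x \<noteq> y" "dom_le x y" "x \<in> K" for x y
    using pos_dom_le_imp_form_ge_1 that dom_leD[OF that(4) G_id] not_pos_root by blast
  show ?thesis
  proof (cases "x \<in> K")
    case True
    then show ?thesis using * assms by blast
  next
    case False
    let ?w = "reflection B x"
    have "?w x \<in> K"
      using False x refl_self not_pos_root by simp
    then have "1 \<le> B (?w x) (?w y)"
      using *[of "?w x" "?w y"] assms refl_root[OF x] dom_le_image[OF dom G_reflection[OF x]]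
      by (metis refl_refl)
    then show ?thesis
      using x by (simp add: refl_form)
  qed
qed

lemma string_inj:
  assumes "x \<in> R" "y \<in> R" "1 \<le> B x y" "x \<noteq> y"
  shows "inj (string x y)"
proof -
  have False if "i < j" "string x y i = string x y j" for i j
  proof -
    define a where "a = cheb (B x y) (Suc j) - cheb (B x y) (Suc i)"
    define b where "b = cheb (B x y) j - cheb (B x y) i"
    have ab: "0 < a" "0 < b"
      using that cheb_strict_mono[OF assms(3)] by (auto simp: a_def b_def strict_mono_less)
    have eq: "a *\<^sub>R y = b *\<^sub>R x"
      using that(2) by (simp add: string_def a_def b_def algebra_simps)
    have "B (a *\<^sub>R y) (a *\<^sub>R y) = B (b *\<^sub>R x) (b *\<^sub>R x)"
      by (simp add: eq)
    then have "a\<^sup>2 = b\<^sup>2"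
      using assms by (simp add: B_simps norm_root power2_eq_square)
    then have "a = b"
      using ab by (simp add: power2_eq_iff_nonneg)
    with eq ab assms show False by simp
  qed
  then show ?thesis
    by (metis injI linorder_neqE_nat)
qed

text \<open>If neither dominates the other, two group elements separate \<open>x\<close> and
  \<open>y\<close> in opposite ways. Every term of the string is then positive under
  \<open>v\<close> and negative under \<open>w\<close>; as the terms are distinct, \<open>w\<close>
  composed with the inverse of \<open>v\<close> has infinitely many inversions.\<close>

lemma form_ge_1_imp_dom_le:
  assumes x: "x \<in> R" and y: "y \<in> R" and B: "1 \<le> B x y"
  shows "dom_le x y \<or> dom_le y x"
proof (rule ccontr)
  assume "\<not> ?thesis"
  then obtain w v where w: "w \<in> G" "- w y \<in> K" "- w x \<notin> K" and v: "v \<in> G" "- v x \<in> K" "- v y \<notin> K"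
    by (auto simp: dom_le_def)
  have pos: "w x \<in> K" "v y \<in> K"
    using w v x y G_root not_neg_root by blast+
  obtain u where u: "u \<in> G" "\<And>z. u (v z) = z"
    using G_inv[OF v(1)] by blast
  let ?g = "\<lambda>z. w (u z)"
  let ?A = "{r \<in> R. r \<in> K \<and> - ?g r \<in> K}"
  have ch: "0 \<le> cheb (B x y) k" for k
    using cheb_less_Suc[OF B] by blast
  have mem: "v (string x y k) \<in> ?A" for k
  proof -
    have "v (string x y k) = cheb (B x y) (Suc k) *\<^sub>R v y + cheb (B x y) k *\<^sub>R (- v x)"
      "- w (string x y k) = cheb (B x y) (Suc k) *\<^sub>R (- w y) + cheb (B x y) k *\<^sub>R (w x)"
      using w(1) v(1) by (simp_all add: string_def G_simps)
    then have "v (string x y k) \<in> K" "- w (string x y k) \<in> K"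
      using ch pos w v K_comb by presburger+
    then show ?thesis
      using v string_root[OF x y] G_root by (simp add: u(2))
  qed
  have "x \<noteq> y"
    using v(2,3) by blast
  moreover have "inj v"
    using u(2) by (metis injI)
  ultimately have "inj (\<lambda>k. v (string x y k))"
    using string_inj[OF x y B] by (simp add: inj_def)
  moreover have "finite ?A"
    using finite_inversions[OF G_comp[OF w(1) u(1)]] .
  ultimately show False
    using mem finite_subset[of "range (\<lambda>k. v (string x y k))" ?A] finite_imageD by blast
qed

text \<open>Continued backwards, the string stays below \<open>y\<close> in dominance, and only
  finitely many roots that \<open>y\<close> dominates are positive. A negative term puts
  \<open>a y - b x\<close> into the cone with \<open>a < b\<close>, and adding
  \<open>(b - a) x\<close> gives a multiple of \<open>y - x\<close>.\<close>

lemma dom_le_diff: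
  assumes x: "x \<in> R" and y: "y \<in> R" and dom: "dom_le x y"
  shows "y - x \<in> K"
proof (cases "x = y")
  case True
  then show ?thesis using root_sign[OF x] K_zero by auto
next
  case ne: False
  have *: "y - x \<in> K"
    if x: "x \<in> R" "x \<in> K" and y: "y \<in> R" "y \<in> K" and ne: "x \<noteq> y" and dom: "dom_le x y" for x y
  proof -
    have B: "1 \<le> B y x"
      using dom_le_imp_form_ge_1[of x y] that by (simp add: sym)
    have "\<not> range (string y x) \<subseteq> dominated y"
      using finite_subset[OF _ finite_dominated[OF y]] string_inj[OF y(1) x(1) B] ne
        finite_imageD by blast
    then obtain k where "string y x k \<notin> K"
      using dom_le_string_prev[OF x(1) y(1) dom] string_root[OF y(1) x(1)]
      by (auto simp: dominated_def)
    then have neg: "- string y x k \<in> K"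
      using not_pos_root string_root[OF y(1) x(1)] by blast
    define a b where "a = cheb (B y x) k" and "b = cheb (B y x) (Suc k)"
    have ab: "0 \<le> a" "a < b"
      using cheb_less_Suc[OF B] by (auto simp: a_def b_def)
    have k: "a *\<^sub>R y - b *\<^sub>R x \<in> K"
      using neg by (simp add: string_def a_def b_def)
    have "a \<noteq> 0"
    proof
      assume "a = 0"
      then have "b *\<^sub>R (- x) \<in> K" using k by simp
      then show False using K_descale[of b "- x"] ab root_not_both x by auto
    qed
    moreover have "a *\<^sub>R (y - x) = (a *\<^sub>R y - b *\<^sub>R x) + (b - a) *\<^sub>R x"
      by (simp add: algebra_simps)
    ultimately show ?thesis
      using K_descale[of a "y - x"] K_add[OF k K_scale[OF x(2), of "b - a"]] ab by simp
  qed
  show ?thesis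
  proof (cases "x \<in> K")
    case True
    then have "y \<in> K"
      using dom_leD[OF dom G_id] x y not_pos_root root_not_both by blast
    with True * x y dom ne show ?thesis by blast
  next
    case False
    then have x': "- x \<in> K" using x not_pos_root by blast
    show ?thesis
    proof (cases "y \<in> K")
      case True
      then show ?thesis using K_add[OF True x'] by simp
    next
      case False
      then have "- x - (- y) \<in> K"
        using *[of "- y" "- x"] x y x' not_pos_root neg_root ne dom by (simp add: dom_le_uminus)
      then show ?thesis by simp
    qed
  qed
qed

end

section \<open>Finite dihedral subgroups\<close>

definition circ :: "'v::real_vector \<Rightarrow> 'v \<Rightarrow> real \<Rightarrow> 'v" where
  "circ f g x = cos x *\<^sub>R f + sin x *\<^sub>R g"

lemma circ_0 [simp]: "circ f g 0 = f"
  by (simp add: circ_def)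

lemma circ_minus_pi: "circ f g (x - pi) = - circ f g x"
  by (simp add: circ_def)

lemma circ_add_pi: "circ f g (x + pi) = - circ f g x"
  by (simp add: circ_def)

lemma circ_comb:
  "sin (b - a) *\<^sub>R circ f g x = sin (b - x) *\<^sub>R circ f g a + sin (x - a) *\<^sub>R circ f g b"
proof -
  have 1: "sin (b - a) * cos x = sin (b - x) * cos a + sin (x - a) * cos b"
    and 2: "sin (b - a) * sin x = sin (b - x) * sin a + sin (x - a) * sin b"
    by (simp_all add: sin_diff algebra_simps)
  show ?thesis
    unfolding circ_def by (simp add: scaleR_add_right 1 2 scaleR_add_left)
qed

context root_datum
begin

definition orthonormal :: "'v \<Rightarrow> 'v \<Rightarrow> bool" where
  "orthonormal f g \<longleftrightarrow> B f f = 1 \<and> B g g = 1 \<and> B f g = 0"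

lemma circ_form: "orthonormal f g \<Longrightarrow> B (circ f g x) (circ f g y) = cos (x - y)"
  by (simp add: orthonormal_def circ_def B_simps sym[of g f] cos_diff)

lemma refl_circ:
  assumes "orthonormal f g"
  shows "reflection B (circ f g x) (circ f g y) = - circ f g (2 * x - y)"
proof -
  have 1: "2 * cos (x - y) * cos x = cos (2 * x - y) + cos y"
    using cos_times_cos[of "x - y" x] by (simp add: algebra_simps)
  have 2: "2 * cos (x - y) * sin x = sin (2 * x - y) + sin y"
    using sin_times_cos[of x "x - y"] by (simp add: algebra_simps)
  show ?thesis
    by (simp add: reflection_def circ_form[OF assms])
      (simp add: circ_def scaleR_add_right 1 2 scaleR_add_left)
qed

lemma circ_between_K:
  assumes "circ f g a \<in> K" "circ f g b \<in> K" "a \<le> x" "x \<le> b" "a < b" "b - a < pi"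
  shows "circ f g x \<in> K"
proof -
  have "sin (b - a) *\<^sub>R circ f g x \<in> K"
    unfolding circ_comb[of b a f g x] using assms by (intro K_comb sin_ge_zero) auto
  then show ?thesis
    using K_descale sin_gt_zero[of "b - a"] assms by auto
qed

lemma circ_root_int:
  assumes on: "orthonormal f g" and f: "f \<in> R" and a: "circ f g a \<in> R"
  shows "circ f g (real_of_int j * a) \<in> R"
proof -
  have nat: "circ f g (real n * a) \<in> R \<and> circ f g (real (Suc n) * a) \<in> R" for n
  proof (induction n)
    case (Suc n)
    have "2 * (real (Suc n) * a) - real n * a = real (Suc (Suc n)) * a"
      by (simp add: algebra_simps)
    then have "circ f g (real (Suc (Suc n)) * a)
        = - reflection B (circ f g (real (Suc n) * a)) (circ f g (real n * a))"
      by (simp only: refl_circ[OF on] minus_minus)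
    then show ?case
      using Suc neg_root refl_root by metis
  qed (use f a in simp)
  show ?thesis
  proof (cases j)
    case (nonneg n)
    then show ?thesis using nat by simp
  next
    case (neg n)
    have "reflection B f (circ f g (real (Suc n) * a)) = - circ f g (- (real (Suc n) * a))"
      using refl_circ[OF on, of 0 "real (Suc n) * a"] by simp
    then have "circ f g (- (real (Suc n) * a)) \<in> R"
      using nat[of n] refl_root[OF f] neg_root by (metis minus_minus)
    moreover have "real_of_int j = - real (Suc n)"
      using neg by simp
    ultimately show ?thesis by (simp only: mult_minus_left)
  qed
qed

lemma orthonormal_exists:
  assumes "x \<in> R" "y \<in> R" "- 1 < B x y" "B x y < 1"
  shows "\<exists>g. orthonormal x g \<and> y = circ x g (arccos (B x y))"
proof -
  define c where "c = B x y"
  define s where "s = sqrt (1 - c\<^sup>2)"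
  have c: "- 1 < c" "c < 1" "B x y = c" "B y x = c" "B x x = 1" "B y y = 1"
    using assms norm_root by (simp_all add: c_def sym[of y x])
  then have "c\<^sup>2 < 1"
    by (simp add: power2_less_1_iff abs_less_iff)
  then have s: "s > 0" "s * s = 1 - c\<^sup>2"
    by (simp_all add: s_def)
  have sin: "sin (arccos c) = s"
    using c by (simp add: sin_arccos s_def)
  define g where "g = (1 / s) *\<^sub>R (y - c *\<^sub>R x)"
  have "B g g = (1 / s) * ((1 / s) * (1 - c * c))"
    unfolding g_def B_simps c by simp
  also have "\<dots> = (1 / s) * ((1 / s) * (s * s))"
    by (simp only: s(2) power2_eq_square)
  also have "\<dots> = 1"
    using s(1) by simp
  finally have "B g g = 1" .
  moreover have "B x g = 0"
    by (simp add: g_def B_simps c)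
  ultimately have "orthonormal x g"
    by (simp add: orthonormal_def c)
  moreover have "y = circ x g (arccos c)"
    using s sin c by (simp add: circ_def g_def)
  ultimately show ?thesis
    unfolding c_def by blast
qed

text \<open>The arc of roots from \<open>x\<close> to \<open>y\<close> is finite because all of them
  are inversions of such a \<open>w\<close>. Failure of dominance is used twice: for
  \<open>x\<close> and \<open>y\<close>, and then for the positive roots \<open>- w y\<close> and
  \<open>w x\<close>, whose form value is again strictly between -1 and 1.\<close>

lemma exists_both_negative:
  assumes x: "x \<in> R" "x \<in> K" and y: "y \<in> R" "y \<in> K" and B: "- 1 < B x y" "B x y < 1"
  shows "\<exists>w\<in>G. - w x \<in> K \<and> - w y \<in> K"
proof -
  have "x \<noteq> y" using B x norm_root by auto
  then have "\<not> dom_le x y"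
    using pos_dom_le_imp_form_ge_1[OF x y] B by auto
  then obtain w where w: "w \<in> G" "- w y \<in> K" "w x \<in> K"
    using x not_neg_root G_root by (auto simp: dom_le_def)
  have wR: "w x \<in> R" "- w y \<in> R"
    using w x y G_root neg_root by auto
  have "B (- w y) (w x) = - B x y"
    using w by (simp add: B_simps G_form sym[of y x])
  then have lt: "B (- w y) (w x) < 1" using B by simp
  then have ne: "- w y \<noteq> w x" using norm_root[OF wR(1)] by auto
  have "\<not> dom_le (- w y) (w x)"
    using pos_dom_le_imp_form_ge_1[of "- w y" "w x"] wR w ne lt by fastforce
  then obtain v where v: "v \<in> G" "- v (w x) \<in> K" "- v (- w y) \<notin> K"
    by (auto simp: dom_le_def)
  then have "- v (w y) \<in> K"
    using not_neg_root[of "- v (w y)"] wR w G_root[of v "w y"] G_root[of w y] y neg_root[of "v (w y)"]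
      not_pos_root[of "v (w y)"]
    by (simp add: G_simps)
  then show ?thesis
    using v w G_comp[of v w] by (intro bexI[of _ "\<lambda>z. v (w z)"]) auto
qed

text \<open>The least angle \<open>\<phi>\<close> at which the arc from \<open>x\<close> to \<open>y\<close> meets a root is \<open>\<pi> / n\<close>: otherwise
  reflecting would produce a root at a smaller angle.\<close>

lemma finite_dihedral:
  assumes x: "x \<in> R" "x \<in> K" and y: "y \<in> R" "y \<in> K" and B: "- 1 < B x y" "B x y < 1"
  obtains g and n i :: nat where "orthonormal x g" "0 < i" "i < n" "y = circ x g (real i * (pi / real n))"
    "circ x g (pi / real n) \<in> R"
proof -
  define t where "t = arccos (B x y)"
  obtain g where on: "orthonormal x g" and yt: "y = circ x g t"
    using orthonormal_exists[OF x(1) y(1) B] unfolding t_def by blast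
  have t: "0 < t" "t < pi"
    using arccos_lt_bounded[OF B] by (auto simp: t_def)
  obtain w where w: "w \<in> G" "- w x \<in> K" "- w y \<in> K"
    using exists_both_negative[OF x y B] by blast
  let ?A = "{a. 0 < a \<and> a \<le> t \<and> circ x g a \<in> R}"
  have "circ x g a \<in> {r \<in> R. r \<in> K \<and> - w r \<in> K}" if a: "a \<in> ?A" for a
  proof -
    have "circ x g a \<in> K"
      using circ_between_K[of x g 0 t a] a x y t yt by simp
    moreover have "circ (- w x) (- w g) a \<in> K"
    proof (rule circ_between_K[of _ _ 0 t])
      have "circ (- w x) (- w g) t = - w y"
        using w(1) by (simp add: yt circ_def G_simps)
      then show "circ (- w x) (- w g) t \<in> K" using w by simp
    qed (use w a t in auto)
    moreover have "circ (- w x) (- w g) a = - w (circ x g a)"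
      using w(1) by (simp add: circ_def G_simps)
    ultimately show ?thesis using a by simp
  qed
  then have "circ x g ` ?A \<subseteq> {r \<in> R. r \<in> K \<and> - w r \<in> K}"
    by (rule image_subsetI)
  then have "finite (circ x g ` ?A)"
    by (rule finite_subset[OF _ finite_inversions[OF w(1)]])
  moreover have "inj_on (circ x g) ?A"
  proof (rule inj_onI)
    fix a b assume "a \<in> ?A" "b \<in> ?A" "circ x g a = circ x g b"
    then have "B (circ x g 0) (circ x g a) = B (circ x g 0) (circ x g b)" by simp
    then have "cos a = cos b"
      by (simp only: circ_form[OF on]) simp
    then show "a = b"
      using cos_inj_pi[of a b] t \<open>a \<in> ?A\<close> \<open>b \<in> ?A\<close> by auto
  qed
  ultimately have fin: "finite ?A"
    using finite_imageD by blast
  have tA: "t \<in> ?A"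
    using t y yt by simp
  define a where "a = Min ?A"
  have aA: "a \<in> ?A"
    unfolding a_def using fin tA by (intro Min_in) auto
  have amin: "a \<le> b" if "b \<in> ?A" for b
    unfolding a_def using fin that by simp
  have roots: "circ x g (real_of_int j * a) \<in> R" for j
    using circ_root_int[OF on x(1)] aA by blast
  \<comment> \<open>Applied to pi and to \<open>t\<close>. Shifting \<open>t\<close> by multiples of
    \<open>a\<close> takes two reflections, so only even multiples are available. If the integer
    part \<open>j\<close> is odd, \<open>j + 1\<close> is even, and \<open>(j + 1) a - b\<close> is
    the root angle that is too small.\<close>
  have mult: "\<exists>j::nat. b = real j * a"
    if b: "0 < b" "b \<le> pi"
      and root: "\<And>j. even j \<Longrightarrow> circ x g (b - real_of_int j * a) \<in> R"
        "\<And>j. even j \<Longrightarrow> circ x g (real_of_int j * a - b) \<in> R"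
      and le: "\<And>c. circ x g c \<in> R \<Longrightarrow> 0 < c \<Longrightarrow> a \<le> c" for b
  proof -
    define j where "j = \<lfloor>b / a\<rfloor>"
    have "0 \<le> j" using b aA by (simp add: j_def)
    have "real_of_int j \<le> b / a" "b / a < real_of_int j + 1"
      by (simp_all add: j_def)
    then have j: "real_of_int j * a \<le> b" "b < real_of_int (j + 1) * a"
      using aA by (simp_all add: field_simps)
    have "\<not> real_of_int j * a < b"
    proof
      assume lt: "real_of_int j * a < b"
      show False
      proof (cases "even j")
        case True
        then show False
          using le[OF root(1)[of j]] lt j by (simp add: algebra_simps)
      next
        case False
        then show False
          using le[OF root(2)[of "j + 1"]] lt j by (simp add: algebra_simps)
      qed
    qed
    then show ?thesis
      using j \<open>0 \<le> j\<close> by (intro exI[of _ "nat j"]) auto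
  qed
  have le: "a \<le> c" if "circ x g c \<in> R" "0 < c" for c
    using amin[of c] aA that by (cases "c \<le> t") auto
  have "circ x g (pi - real_of_int j * a) \<in> R" "circ x g (real_of_int j * a - pi) \<in> R" for j
  proof -
    have "pi - real_of_int j * a = real_of_int (- j) * a + pi" by simp
    then show "circ x g (pi - real_of_int j * a) \<in> R"
      using roots[of "- j"] neg_root by (simp only: circ_add_pi)
    show "circ x g (real_of_int j * a - pi) \<in> R"
      using roots[of j] neg_root by (simp only: circ_minus_pi)
  qed
  then obtain n :: nat where n: "pi = real n * a"
    using mult[of pi] le by auto
  have "circ x g (real_of_int (2 * k) * a - t) \<in> R" "circ x g (t - real_of_int (2 * k) * a) \<in> R" for k
  proof -
    have refl: "circ x g (2 * c - b) \<in> R" if "circ x g c \<in> R" "circ x g b \<in> R" for b c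
      using refl_root[OF that] neg_root by (simp only: refl_circ[OF on]) (metis minus_minus)
    have yR: "circ x g t \<in> R" using y yt by simp
    have "circ x g (2 * (real_of_int k * a) - t) \<in> R"
      using refl[OF roots yR] .
    then show "circ x g (real_of_int (2 * k) * a - t) \<in> R"
      by (simp add: mult.assoc)
    note refl_2k = \<open>circ x g (2 * (real_of_int k * a) - t) \<in> R\<close>
    have "circ x g (2 * 0 - (2 * (real_of_int k * a) - t)) \<in> R"
      using refl[OF _ refl_2k, of 0] x by simp
    then show "circ x g (t - real_of_int (2 * k) * a) \<in> R"
      by (simp add: mult.assoc)
  qed
  then have "circ x g (t - real_of_int j * a) \<in> R" "circ x g (real_of_int j * a - t) \<in> R"
    if "even j" for j
    using that by (metis evenE)+
  then obtain i :: nat where i: "t = real i * a"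
    using mult[of t] t le by (meson less_imp_le)
  have "0 < n" "0 < i" using n i t by (auto intro!: gr0I)
  then have a: "a = pi / real n" using n by (simp add: field_simps)
  show ?thesis
  proof (rule that[OF on \<open>0 < i\<close>])
    have "real i * a < real n * a" "0 < a"
      using t i n aA by auto
    then show "i < n"
      by simp
    show "y = circ x g (real i * (pi / real n))"
      using i a yt by simp
    show "circ x g (pi / real n) \<in> R"
      using aA a by simp
  qed
qed

text \<open>Dominated roots whose reflection is positive are reflected, the others are kept. A kept
  root \<open>r\<close> is dominated by the reflected \<open>b\<close>: if \<open>w\<close> makes
  the latter negative and \<open>r\<close> positive, then \<open>w k\<close> is in the cone, and
  \<open>B b k <= 0\<close> makes \<open>w b\<close> negative, against \<open>r\<close> being
  dominated by \<open>b\<close>.\<close>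

lemma card_dominated_refl_mono:
  assumes b: "b \<in> R" "b \<in> K" and k: "k \<in> R" "k \<in> K" and le: "B b k \<le> 0"
  shows "card (dominated b) \<le> card (dominated (reflection B k b))"
proof (rule card_inj_on_le)
  let ?s = "reflection B k"
  let ?f = "\<lambda>r. if - ?s r \<in> K then r else ?s r"
  have sb: "?s b = b + (- 2 * B b k) *\<^sub>R k"
    by (simp add: reflection_def sym[of k b])
  then have sbK: "?s b \<in> K"
    using K_add[OF b(2) K_scale[OF k(2), of "- 2 * B b k"]] le by simp
  then show "finite (dominated (?s b))"
    using finite_dominated refl_root k b by blast
  show "inj_on ?f (dominated b)"
  proof (rule inj_onI)
    fix r r' assume r: "r \<in> dominated b" "r' \<in> dominated b" "?f r = ?f r'"
    have sR: "?s r \<in> R" "?s r' \<in> R" "r \<in> K" "r' \<in> K"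
      using r refl_root k by (auto simp: dominated_def)
    show "r = r'"
      using r(3) sR refl_refl[OF k(1)] root_not_both by (metis not_pos_root)
  qed
  show "?f ` dominated b \<subseteq> dominated (?s b)"
  proof (rule image_subsetI)
    fix r assume "r \<in> dominated b"
    then have r: "r \<in> R" "r \<in> K" "dom_le r b"
      by (auto simp: dominated_def)
    have sr: "?s r \<in> R" "dom_le (?s r) (?s b)"
      using r k refl_root dom_le_image G_reflection by blast+
    show "?f r \<in> dominated (?s b)"
    proof (cases "- ?s r \<in> K")
      case True
      have pos: "0 < B k r"
      proof (rule ccontr)
        assume "\<not> 0 < B k r"
        then have "r + (- 2 * B k r) *\<^sub>R k \<in> K"
          using K_add[OF r(2) K_scale[OF k(2), of "- 2 * B k r"]] by simp
        then have "?s r \<in> K"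
          by (simp add: reflection_def)
        then show False
          using True root_not_both[OF sr(1)] by blast
      qed
      have "dom_le r (?s b)"
        unfolding dom_le_def
      proof (intro ballI impI)
        fix w assume w: "w \<in> G" "- w (?s b) \<in> K"
        show "- w r \<in> K"
        proof (rule ccontr)
          assume "- w r \<notin> K"
          then have wr: "w r \<in> K" using G_root w r not_neg_root by blast
          have "- w (?s r) \<in> K" using dom_leD[OF sr(2)] w by blast
          then have "w r + - w (?s r) \<in> K" using wr K_add by blast
          then have "(2 * B k r) *\<^sub>R w k \<in> K"
            using w by (simp add: reflection_def G_simps)
          then have wk: "w k \<in> K" using K_descale pos by auto
          have "- w b = - w (?s b) + (- 2 * B b k) *\<^sub>R w k"
            using w by (simp add: sb G_simps)
          also have "\<dots> \<in> K"
            using K_add[OF w(2) K_scale[OF wk, of "- 2 * B b k"]] le by simp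
          finally have "- w r \<in> K" using dom_leD r w by blast
          then show False using \<open>- w r \<notin> K\<close> by blast
        qed
      qed
      then show ?thesis using r True by (simp add: dominated_def)
    next
      case False
      then have "?s r \<in> K" using sr(1) not_neg_root by blast
      with False show ?thesis using sr by (simp add: dominated_def)
    qed
  qed
qed

end

section \<open>Form values with a plane inverted by a group element\<close>

definition dihedral_value :: "real \<Rightarrow> bool" where
  "dihedral_value v \<longleftrightarrow> 1 \<le> v \<or> (\<exists>n\<ge>2::nat. v = cos (pi / real n))"

lemma cos_pi_div_mono:
  assumes "1 \<le> m" "m \<le> (n::nat)"
  shows "cos (pi / real m) \<le> cos (pi / real n)"
proof -
  have "pi / real n \<le> pi / real m" "pi / real m \<le> pi / 1"
    using assms by (intro frac_le; simp)+
  then show ?thesis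
    by (intro cos_monotone_0_pi_le) auto
qed

text \<open>Since \<open>cos (3 x) = - cos (2 x)\<close> at \<open>x = pi / 5\<close>, the cosine is
  a root of \<open>4 c^2 - 2 c - 1\<close>. The bound 3/4 is used through its square 9/16: no square
  of a dihedral value lies strictly between 1/2 and 9/16.\<close>

lemma three_quarters_less_cos_pi_5: "3 / 4 < cos (pi / 5)"
proof (rule ccontr)
  define c where "c = cos (pi / 5)"
  assume "\<not> 3 / 4 < cos (pi / 5)"
  then have c: "0 < c" "c \<le> 3 / 4"
    using cos_gt_zero[of "pi / 5"] by (simp_all add: c_def)
  have "cos (3 * (pi / 5)) = - cos (2 * (pi / 5))"
    using cos_pi_minus[of "2 * (pi / 5)"] by (simp add: algebra_simps)
  then have "4 * c ^ 3 - 3 * c = - (2 * c ^ 2 - 1)"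
    by (simp only: cos_treble_cos cos_double_cos c_def)
  then have "(c + 1) * (c * (4 * c - 2) - 1) = 0"
    by (simp add: algebra_simps power2_eq_square power3_eq_cube)
  then have "c * (4 * c - 2) = 1"
    using c by simp
  moreover have "c * (4 * c - 2) \<le> c * 1"
    using c by (intro mult_left_mono) auto
  ultimately show False using c by simp
qed

lemma dihedral_value_cases:
  assumes "dihedral_value v"
  shows "v = 0 \<or> v = 1 / 2 \<or> v = sqrt 2 / 2 \<or> 3 / 4 < v"
  using assms unfolding dihedral_value_def
proof (elim disjE exE conjE)
  fix n :: nat assume n: "2 \<le> n" and v: "v = cos (pi / real n)"
  consider "n = 2" | "n = 3" | "n = 4" | "5 \<le> n" using n by linarith
  then show ?thesis
  proof cases
    case 4
    then show ?thesis
      using v cos_pi_div_mono[of 5 n] three_quarters_less_cos_pi_5 by simp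
  qed (use v in \<open>auto simp: cos_60 cos_45\<close>)
qed auto

text \<open>The element \<open>t\<close> gives control outside the plane: it makes \<open>b\<close>
  negative, hence also every root dominated by \<open>b\<close>, so these roots are among its
  finitely many inversions.\<close>

locale minus_one_plane = root_datum B R K G
  for B :: "'v::real_vector \<Rightarrow> 'v \<Rightarrow> real" and R K :: "'v set" and G :: "('v \<Rightarrow> 'v) set" +
  fixes b d :: 'v and t :: "'v \<Rightarrow> 'v" and c :: real
  assumes b: "b \<in> R" "b \<in> K" and d: "d \<in> R" "d \<in> K" and bd: "B b d = - c" and c: "0 < c" "c < 1"
    and t: "t \<in> G" "t b = - b" "t d = - d"
begin

lemma db: "B d b = - c"
  using bd sym by metis

lemma bb [simp]: "B b b = 1" and dd [simp]: "B d d = 1"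
  using norm_root b d by auto

lemma c_square: "c * c < 1"
  using mult_strict_mono[of c 1 c 1] c by simp

text \<open>Up to the factor \<open>1 - c\<^sup>2\<close>, the value of the form on the projection of \<open>v\<close> to the plane.\<close>

definition plane_form :: "'v \<Rightarrow> real" where
  "plane_form v = B v b * B v b + B v d * B v d + 2 * c * B v b * B v d"

text \<open>For a root \<open>v\<close>, the difference \<open>(1 - c * c) - plane_form v\<close> is
  \<open>1 - c * c\<close> times the norm of the component of \<open>v\<close> orthogonal to the
  plane. Adding vectors of the plane does not change this component, and the factor \<open>k\<close>
  scales its norm by \<open>k * k\<close>.\<close>

lemma plane_form_shift:
  assumes "v = k *\<^sub>R u + y *\<^sub>R b + z *\<^sub>R d" "B u u = 1" "B v v = 1"
  shows "plane_form v - (1 - c * c) = k * k * (plane_form u - (1 - c * c))"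
proof -
  define p x where "p = B u b" and "x = B u d"
  have ub: "B b u = p" "B d u = x" "B u b = p" "B u d = x"
    by (simp_all add: p_def x_def sym[of b u] sym[of d u])
  have v: "B v b = k * p + y - c * z" "B v d = k * x - c * y + z"
    by (simp_all add: assms(1) B_simps ub bd db)
  have "B v v = k * k + y * y + z * z - 2 * c * y * z + 2 * k * y * p + 2 * k * z * x"
    by (simp add: assms(1,2) B_simps ub bd db algebra_simps)
  then have 1: "k * k + y * y + z * z - 2 * c * y * z + 2 * k * y * p + 2 * k * z * x = 1"
    using assms(3) by simp
  have "plane_form v - (1 - c * c) - k * k * (plane_form u - (1 - c * c))
      = (1 - c * c) * (k * k + y * y + z * z - 2 * c * y * z + 2 * k * y * p + 2 * k * z * x - 1)"
    unfolding plane_form_def v ub by (simp add: algebra_simps)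
  then show ?thesis
    unfolding 1 by simp
qed

text \<open>The last condition says that the component orthogonal to the plane has negative norm. By
  \<open>plane_form_shift\<close> this is inherited by other roots with a proportional
  component.\<close>

definition inverted :: "'v set" where
  "inverted = {r \<in> R. r \<in> K \<and> - t r \<in> K \<and> 1 - c * c < plane_form r}"

lemma finite_inverted: "finite inverted"
  by (rule finite_subset[OF _ finite_inversions[OF t(1)]]) (auto simp: inverted_def)

lemma inverted_comb:
  assumes u: "u \<in> inverted" and e: "e \<in> K" "t e = - e" "e = y *\<^sub>R b + z *\<^sub>R d"
    and v: "v = k *\<^sub>R u + e" "0 < k" "v \<in> R"
  shows "v \<in> inverted" "plane_form v - (1 - c * c) = k * k * (plane_form u - (1 - c * c))"
proof -
  have uR: "u \<in> R" "u \<in> K" "- t u \<in> K" "1 - c * c < plane_form u"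
    using u by (auto simp: inverted_def)
  show eq: "plane_form v - (1 - c * c) = k * k * (plane_form u - (1 - c * c))"
    using plane_form_shift[of v k u y z] uR v e norm_root by (simp add: add.assoc)
  have "- t v = k *\<^sub>R (- t u) + e"
    using t e by (simp add: v G_simps)
  moreover have "k *\<^sub>R u + e \<in> K" "k *\<^sub>R (- t u) + e \<in> K"
    by (intro K_add K_scale; use uR e v(2) in simp)+
  ultimately have "v \<in> K" "- t v \<in> K"
    using v(1) by simp_all
  moreover have "0 < k * k * (plane_form u - (1 - c * c))"
    using uR v by simp
  ultimately show "v \<in> inverted"
    using eq v(3) by (simp add: inverted_def)
qed

text \<open>Among the inverted roots with least \<open>plane_form\<close>, take one with the largest
  sum of values on \<open>b\<close> and \<open>d\<close>. A negative value on one of them could be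
  reflected away, which raises the sum because \<open>1 - c > 0\<close>; and a root strictly between
  \<open>u\<close> and \<open>b\<close> or \<open>d\<close> would have smaller
  \<open>plane_form\<close>. Thus \<open>- u\<close> meets \<open>b\<close> and \<open>d\<close> as
  simple roots meet each other.\<close>

lemma minimal_inverted_root:
  assumes r: "r \<in> inverted"
  obtains u where "u \<in> inverted" "plane_form u \<le> plane_form r"
    "dihedral_value (B u b)" "dihedral_value (B u d)"
proof -
  define m where "m = Min (plane_form ` inverted)"
  define N where "N = {v \<in> inverted. plane_form v = m}"
  have m: "m \<le> plane_form v" if "v \<in> inverted" for v
    using that finite_inverted by (simp add: m_def)
  have "m \<in> plane_form ` inverted"
    unfolding m_def using finite_inverted r by (intro Min_in) auto
  then have N: "finite N" "N \<noteq> {}"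
    using finite_inverted by (auto simp: N_def)
  let ?h = "\<lambda>v. B v b + B v d"
  have "Max (?h ` N) \<in> ?h ` N"
    using N by (intro Max_in) auto
  then obtain u where u: "u \<in> N" "?h u = Max (?h ` N)" by auto
  have h: "?h v \<le> ?h u" if "v \<in> N" for v
    using N that by (simp add: u(2))
  have uI: "u \<in> inverted" "plane_form u = m" and uR: "u \<in> R" "u \<in> K" "1 - c * c < plane_form u"
    using u by (auto simp: N_def inverted_def)
  have "dihedral_value (B u e)"
    if e: "e \<in> R" "e \<in> K" "t e = - e" "0 < ?h e" and span: "\<exists>y z. e = y *\<^sub>R b + z *\<^sub>R d" for e
  proof -
    have span': "\<exists>y z. a *\<^sub>R e = y *\<^sub>R b + z *\<^sub>R d" for a
      using span by (metis scaleR_add_right scaleR_scaleR)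
    have te: "t (a *\<^sub>R e) = - (a *\<^sub>R e)" for a
      using t e by (simp add: G_simps)
    have nonneg: "0 \<le> B u e"
    proof (rule ccontr)
      assume neg: "\<not> 0 \<le> B u e"
      define v where "v = 1 *\<^sub>R u + (- 2 * B u e) *\<^sub>R e"
      have v_eq: "v = reflection B e u"
        by (simp add: v_def reflection_def sym[of e u])
      obtain y z where yz: "(- 2 * B u e) *\<^sub>R e = y *\<^sub>R b + z *\<^sub>R d"
        using span' by blast
      have eK: "(- 2 * B u e) *\<^sub>R e \<in> K"
        by (intro K_scale) (use e neg in auto)
      have vR: "v \<in> R" using v_eq refl_root e uR by simp
      have "v \<in> inverted" "plane_form v = m"
        using inverted_comb[OF uI(1) eK te yz v_def _ vR] uI by simp_all
      then have "?h v \<le> ?h u"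
        using h by (simp add: N_def)
      moreover have "?h v = ?h u + (- 2 * B u e) * ?h e"
        by (simp add: v_def B_simps algebra_simps)
      ultimately show False
        using e(4) neg mult_neg_pos[of "B u e" "?h e"] by simp
    qed
    show ?thesis
    proof (cases "1 \<le> B u e")
      case False
      have B: "- 1 < B e u" "B e u < 1"
        using False nonneg sym[of e u] by simp_all
      obtain g and n i :: nat where on: "orthonormal e g" and i: "0 < i" "i < n"
        and ue: "u = circ e g (real i * (pi / real n))" and vR: "circ e g (pi / real n) \<in> R"
        using finite_dihedral[OF e(1,2) uR(1,2) B] by metis
      define x where "x = pi / real n"
      define z where "z = real i * x"
      have u_eq: "u = circ e g z" by (simp add: ue z_def x_def)
      have z: "0 < z" "z < pi" "0 < x" "x \<le> z"
        using i by (simp_all add: z_def x_def field_simps)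
      have "B e u = cos z"
        using circ_form[OF on, of 0 z] by (simp add: u_eq)
      then have cz: "B u e = cos z" by (simp add: sym[of u e])
      then have "z \<le> pi / 2"
        using nonneg z cos_lt_zero_pi[of z] by (cases "z \<le> pi / 2") auto
      have "i = 1"
      proof (rule ccontr)
        assume "i \<noteq> 1"
        then have xz: "x < z" using i z by (simp add: z_def)
        then have s: "0 < sin x" "sin x < sin z" "0 \<le> sin (z - x)"
          using z \<open>z \<le> pi / 2\<close> sin_monotone_2pi[of x z] by (simp_all add: sin_gt_zero sin_ge_zero)
        \<comment> \<open>The sine rule writes the root next to \<open>e\<close> as
          \<open>k u + a e\<close>. Since \<open>k < 1\<close> and \<open>plane_form u\<close>
          exceeds \<open>1 - c * c\<close>, this root has strictly smaller
          \<open>plane_form\<close>.\<close>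
        define k a where "k = sin x / sin z" and "a = sin (z - x) / sin z"
        have k: "0 < k" "k < 1" "0 \<le> a" using s by (simp_all add: k_def a_def)
        have "sin z *\<^sub>R circ e g x = sin x *\<^sub>R u + sin (z - x) *\<^sub>R e"
          using circ_comb[of z 0 e g x] by (simp add: u_eq add.commute)
        then have "(1 / sin z) *\<^sub>R (sin z *\<^sub>R circ e g x) = (1 / sin z) *\<^sub>R (sin x *\<^sub>R u + sin (z - x) *\<^sub>R e)"
          by simp
        then have v: "circ e g x = k *\<^sub>R u + a *\<^sub>R e"
          using s by (simp add: k_def a_def scaleR_add_right)
        obtain y' z' where yz: "a *\<^sub>R e = y' *\<^sub>R b + z' *\<^sub>R d"
          using span' by blast
        note c = inverted_comb[OF uI(1) K_scale[OF e(2) k(3)] te yz v k(1) vR[folded x_def]]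
        have "k * k < 1"
          using k mult_strict_mono[of k 1 k 1] by simp
        then have "k * k * (plane_form u - (1 - c * c)) < 1 * (plane_form u - (1 - c * c))"
          using uR by (intro mult_strict_right_mono) auto
        then show False
          using c m uI by fastforce
      qed
      then show ?thesis
        unfolding dihedral_value_def using cz i by (intro disjI2 exI[of _ n]) (simp add: z_def x_def)
    qed (simp add: dihedral_value_def)
  qed
  from this[of b] this[of d] have "dihedral_value (B u b)" "dihedral_value (B u d)"
    using b d bd db c t by (metis (no_types) add.commute add.right_neutral add.left_neutral bb dd
      diff_gt_0_iff_gt scaleR_one scaleR_zero_left uminus_add_conv_diff)+
  then show ?thesis
    using that uI m[OF r] by simp
qed

text \<open>Apart from \<open>b\<close> itself, these are the roots that an injection into
  \<open>dominated (d + (2 * c) *\<^sub>R b)\<close> cannot leave fixed. The root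
  \<open>d + (2 * c) *\<^sub>R b\<close> is the reflection of \<open>d\<close> in \<open>b\<close>,
  the neighbour of \<open>b\<close> in the plane.\<close>

definition bad :: "'v \<Rightarrow> bool" where
  "bad r \<longleftrightarrow> r \<in> dominated b \<and> r \<noteq> b \<and> \<not> dom_le r (d + (2 * c) *\<^sub>R b)"

lemma next_root: "d + (2 * c) *\<^sub>R b \<in> R" "d + (2 * c) *\<^sub>R b \<in> K"
proof -
  have "reflection B b d = d + (2 * c) *\<^sub>R b"
    by (simp add: reflection_def bd)
  then show "d + (2 * c) *\<^sub>R b \<in> R"
    using refl_root b d by metis
  show "d + (2 * c) *\<^sub>R b \<in> K"
    using K_add K_scale b d c by simp
qed

lemma next_form: "B (d + (2 * c) *\<^sub>R b) b = c"
  by (simp add: B_simps db)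

lemma not_next_dom_le: "\<not> dom_le (d + (2 * c) *\<^sub>R b) b"
  using dom_le_imp_form_ge_1[OF next_root(1) b(1)] next_form c by force

text \<open>A form value of at least 1 forces dominance in one direction, and each direction is
  impossible. Between \<open>r\<close> and \<open>- d\<close>, one contradicts \<open>r\<close>
  being positive and the other fails under \<open>t\<close>. Between \<open>r\<close> and the next
  root, one contradicts badness and the other would put the next root below \<open>b\<close>,
  although their form value is \<open>c < 1\<close>. With \<open>p = B r b\<close> and
  \<open>q = - B r d\<close>, the three bounds describe a triangle.\<close>

lemma bad_root_bounds:
  assumes "bad r"
  shows "1 \<le> B r b" "- B r d < 1" "2 * c * B r b + B r d < 1" "- t r \<in> K"
proof -
  let ?g = "d + (2 * c) *\<^sub>R b"
  have r: "r \<in> R" "r \<in> K" "dom_le r b" "r \<noteq> b" "\<not> dom_le r ?g"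
    using assms by (auto simp: bad_def dominated_def)
  show "1 \<le> B r b"
    using dom_le_imp_form_ge_1 r b by blast
  show tr: "- t r \<in> K"
    using dom_leD[OF r(3) t(1)] t b by simp
  show "- B r d < 1"
  proof (rule ccontr)
    assume "\<not> - B r d < 1"
    then have "dom_le r (- d) \<or> dom_le (- d) r"
      using form_ge_1_imp_dom_le[OF r(1) neg_root[OF d(1)]] by (simp add: B_simps)
    then show False
    proof
      assume "dom_le r (- d)"
      then show False using dom_leD[OF _ G_id] r d root_not_both by fastforce
    next
      assume "dom_le (- d) r"
      then show False using dom_leD[OF _ t(1) tr] t d root_not_both by (fastforce simp: G_simps)
    qed
  qed
  show "2 * c * B r b + B r d < 1"
  proof (rule ccontr)
    assume "\<not> 2 * c * B r b + B r d < 1"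
    then have "dom_le ?g r"
      using form_ge_1_imp_dom_le[OF r(1) next_root(1)] r by (simp add: B_simps)
    then show False
      using dom_le_trans r not_next_dom_le by blast
  qed
qed

text \<open>The form value with \<open>b\<close> keeps the images apart: it is at least 1 on roots
  that stay fixed and below 1 on the images of bad ones. The root \<open>b\<close> goes to the next
  root, which must therefore be avoided by \<open>F\<close>.\<close>

lemma card_dominated_next:
  assumes "\<And>r. bad r \<Longrightarrow> F r \<in> dominated (d + (2 * c) *\<^sub>R b)"
    and "\<And>r. bad r \<Longrightarrow> B (F r) b < 1"
    and "\<And>r. bad r \<Longrightarrow> F r \<noteq> d + (2 * c) *\<^sub>R b"
    and "inj_on F {r. bad r}"
  shows "card (dominated b) \<le> card (dominated (d + (2 * c) *\<^sub>R b))"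
proof (rule card_inj_on_le)
  let ?g = "d + (2 * c) *\<^sub>R b"
  let ?f = "\<lambda>r. if r = b then ?g else if bad r then F r else r"
  show "finite (dominated ?g)"
    using finite_dominated next_root by blast
  show "?f ` dominated b \<subseteq> dominated ?g"
    using assms(1) next_root dom_le_refl by (auto simp: bad_def dominated_def)
  have good: "1 \<le> B r b" "r \<noteq> ?g" if "r \<in> dominated b" "r \<noteq> b" for r
    using that dom_le_imp_form_ge_1[of r b] b not_next_dom_le by (auto simp: dominated_def)
  show "inj_on ?f (dominated b)"
  proof (rule inj_onI)
    fix r r' assume r: "r \<in> dominated b" "r' \<in> dominated b" "?f r = ?f r'"
    show "r = r'"
      using r(3) assms(2)[of r] assms(2)[of r'] assms(3)[of r] assms(3)[of r']
        inj_onD[OF assms(4), of r r'] good[OF r(1)] good[OF r(2)]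
      by (auto split: if_splits)
  qed
qed

end

lemma dihedral_value_square:
  assumes "dihedral_value v"
  shows "v * v \<in> {0, 1 / 4, 1 / 2} \<or> 9 / 16 < v * v"
proof -
  consider "v = 0" | "v = 1 / 2" | "v = sqrt 2 / 2" | "3 / 4 < v"
    using dihedral_value_cases[OF assms] by blast
  then show ?thesis
  proof cases
    case 4
    then show ?thesis
      using mult_strict_mono[of "3 / 4" v "3 / 4" v] by simp
  next
    case 2
    show ?thesis unfolding 2 by simp
  next
    case 3
    show ?thesis unfolding 3 by simp
  qed simp
qed

context minus_one_plane
begin

lemma bad_plane_form:
  "plane_form r = (- B r d - c * B r b) * (- B r d - c * B r b) + (1 - c * c) * (B r b * B r b)"
  by (simp add: plane_form_def algebra_simps)

text \<open>If the projection of \<open>r\<close> to the plane had norm greater than 1, the extremal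
  root \<open>u\<close> would satisfy
  \<open>1 - c^2 < plane_form u < (1 - c^2) / c^2 <= 1/3\<close>. Dihedral values leave only 1/4 in
  this range, and that requires \<open>3/4 < c^2 < 4/5\<close>, which the hypotheses exclude. A
  projection of norm at most 1 together with \<open>p >= 1\<close> forces \<open>p = 1\<close> and
  \<open>q = c\<close>.\<close>

lemma bad_root_small_angle:
  assumes bad: "bad r" and c2: "3 / 4 \<le> c * c" "c * c = 3 / 4 \<or> 4 / 5 < c * c"
  shows "B r b = 1" "B r d = - c"
proof -
  define p q where "p = B r b" and "q = - B r d"
  have pq: "1 \<le> p" "q < 1" "2 * c * p - q < 1"
    using bad_root_bounds[OF bad] by (simp_all add: p_def q_def)
  have form: "plane_form r = (q - c * p) * (q - c * p) + (1 - c * c) * (p * p)"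
    using bad_plane_form by (simp add: p_def q_def)
  have p2: "1 \<le> p * p" "p * p = 1 \<Longrightarrow> p = 1"
    using pq mult_mono[of 1 p 1 p] by (auto simp: square_eq_1_iff)
  have squeeze: "X \<le> 0 \<and> Y \<le> Z" if "P \<le> Z" "Z \<le> Y" "0 \<le> X" "P = X + Y" for P X Y Z :: real
    using that by linarith
  have "plane_form r \<le> 1 - c * c"
  proof (rule ccontr)
    assume "\<not> ?thesis"
    then have "r \<in> inverted"
      using bad bad_root_bounds(4) by (auto simp: inverted_def bad_def dominated_def)
    then obtain u where u: "u \<in> inverted" "plane_form u \<le> plane_form r"
      "dihedral_value (B u b)" "dihedral_value (B u d)"
      using minimal_inverted_root by blast
    have lower: "1 - c * c < plane_form u"
      using u(1) by (simp add: inverted_def)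
    \<comment> \<open>The triangle of possible \<open>(p, q)\<close> in the coordinates in which two of its sides are
      \<open>x = 0\<close> and \<open>y = 0\<close>.\<close>
    define x y where "x = 1 - q" and "y = 1 - 2 * c * p + q"
    have xy: "0 < x" "0 < y" using pq by (simp_all add: x_def y_def)
    have cp: "c * p = (2 - x - y) / 2" by (simp add: x_def y_def)
    have q: "q = 1 - x" by (simp add: x_def)
    have "c * 1 \<le> c * p" using pq c by (intro mult_left_mono) auto
    then have w: "x + y \<le> 2 - 2 * c" by (simp add: cp field_simps)
    have "c * c * plane_form r = c * c * (q * q) - 2 * (c * c) * q * (c * p) + (c * p) * (c * p)"
      by (simp add: form algebra_simps)
    also have "\<dots> = 1 - c * c + ((x + y) * (c * c - 1 + (x + y) / 4) - c * c * (x * y))"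
      unfolding cp q by (simp add: field_simps)
    also have "\<dots> < 1 - c * c"
    proof -
      have "c * c - 1 + (x + y) / 4 \<le> (1 - c) * (- (1 + c) + 1 / 2)"
        using w by (simp add: field_simps)
      also have "\<dots> < 0" using c by (intro mult_pos_neg) auto
      finally have "(x + y) * (c * c - 1 + (x + y) / 4) < 0"
        using xy by (intro mult_pos_neg) auto
      moreover have "0 < c * c * (x * y)" using xy c by simp
      ultimately show ?thesis by linarith
    qed
    finally have "c * c * plane_form r < 1 - c * c" .
    moreover have "c * c * plane_form u \<le> c * c * plane_form r"
      using u(2) by (intro mult_left_mono) auto
    ultimately have upper: "c * c * plane_form u < 1 - c * c" by linarith
    have cc: "4 / 5 < c"
    proof (rule ccontr)
      assume "\<not> 4 / 5 < c"
      then have "c * c \<le> 4 / 5 * (4 / 5)" using c by (intro mult_mono) auto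
      then show False using c2 by simp
    qed
    have pf: "0 \<le> plane_form u" using lower c_square by linarith
    have third: "plane_form u < 1 / 3"
      using upper c2(1) mult_right_mono[OF c2(1) pf] by linarith
    have sq: "v * v < 1 / 3 \<Longrightarrow> v * v = 0 \<or> v * v = 1 / 4" if "dihedral_value v" for v
      using dihedral_value_square[OF that] by auto
    have ge: "v = 0 \<or> 1 / 2 \<le> v" if "dihedral_value v" for v
      using dihedral_value_cases[OF that] by auto
    consider "B u b = 0" | "B u d = 0" | "1 / 2 \<le> B u b" "1 / 2 \<le> B u d"
      using u ge by blast
    then have "plane_form u = 0 \<or> plane_form u = 1 / 4"
    proof cases
      case 1
      then have *: "plane_form u = B u d * B u d" by (simp add: plane_form_def)
      then show ?thesis using sq[OF u(4)] third by auto
    next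
      case 2
      then have *: "plane_form u = B u b * B u b" by (simp add: plane_form_def)
      then show ?thesis using sq[OF u(3)] third by auto
    next
      case 3
      have "1 / 2 * (1 / 2) \<le> B u b * B u b" "1 / 2 * (1 / 2) \<le> B u d * B u d"
        using 3 by (intro mult_mono; simp)+
      moreover have "0 \<le> 2 * c * B u b * B u d" using 3 c by simp
      ultimately show ?thesis using third by (simp add: plane_form_def)
    qed
    then show False
    proof
      assume 4: "plane_form u = 1 / 4"
      have "c * c / 4 < 1 - c * c" "1 - c * c < 1 / 4"
        using upper lower by (simp_all add: 4)
      then show False using c2(2) by linarith
    qed (use lower c_square in simp)
  qed
  moreover have "(1 - c * c) * 1 \<le> (1 - c * c) * (p * p)"
    using p2 c_square by (intro mult_left_mono) auto
  moreover have "0 \<le> (q - c * p) * (q - c * p)" by simp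
  ultimately have "(q - c * p) * (q - c * p) \<le> 0" "(1 - c * c) * (p * p) \<le> (1 - c * c) * 1"
    using form squeeze[of "plane_form r" "1 - c * c" "(1 - c * c) * (p * p)" "(q - c * p) * (q - c * p)"]
    by simp_all
  then have "q = c * p" "p * p = 1"
    using c_square p2(1) by (auto simp: mult_le_0_iff)
  then show "B r b = 1" "B r d = - c"
    using p2(2) by (auto simp: p_def q_def)
qed

text \<open>Here \<open>b\<close> and the reflection \<open>h\<close> of \<open>b\<close> in
  \<open>d\<close> are orthonormal, and the claim is that \<open>r\<close> is orthogonal to
  \<open>h\<close>. If \<open>a = B r h\<close> is not 0, reflecting \<open>h\<close> in
  \<open>r\<close> yields an inverted root whose component orthogonal to the plane is
  \<open>2 |a|\<close> times that of \<open>r\<close>. Its \<open>plane_form\<close> lies between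
  1/2 and 9/16, and no extremal root has such a value or a smaller one above 1/2.\<close>

lemma bad_root_right_angle:
  assumes bad: "bad r" and c2: "c * c = 1 / 2"
  shows "B r d = - c * B r b"
proof (rule ccontr)
  assume neq: "B r d \<noteq> - c * B r b"
  define p q where "p = B r b" and "q = - B r d"
  define a where "a = p - 2 * c * q"
  have pq: "1 \<le> p" "q < 1" "2 * c * p - q < 1"
    using bad_root_bounds[OF bad] by (simp_all add: p_def q_def)
  have ca: "q - c * p = - c * a"
    using c2 by (simp add: a_def algebra_simps)
  have "q \<noteq> c * p"
    using neq by (auto simp: p_def q_def)
  then have a: "a \<noteq> 0" using ca by auto
  have bounds: "p - a < 2 * c" "p + a < 2 * c"
  proof -
    have "2 * c * q < 2 * c * 1" using pq c by (intro mult_strict_left_mono) auto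
    then show "p - a < 2 * c" by (simp add: a_def)
    have "2 * c * (2 * c * p - q) < 2 * c * 1" using pq c by (intro mult_strict_left_mono) auto
    moreover have "2 * c * (2 * c * p - q) = 4 * (c * c) * p - 2 * c * q" by (simp add: algebra_simps)
    ultimately show "p + a < 2 * c" by (simp add: a_def c2)
  qed
  have p2: "1 \<le> p * p" using pq mult_mono[of 1 p 1 p] by auto
  have form: "plane_form r = (a * a + p * p) / 2"
  proof -
    have "plane_form r = (q - c * p) * (q - c * p) + (1 - c * c) * (p * p)"
      using bad_plane_form by (simp add: p_def q_def)
    also have "\<dots> = c * c * (a * a) + (1 - c * c) * (p * p)"
      unfolding ca by (simp add: algebra_simps)
    finally show ?thesis by (simp add: c2 field_simps)
  qed
  have a2: "0 < a * a" using a by (auto simp: zero_less_mult_iff)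
  have r: "r \<in> inverted" "r \<in> R"
    using bad bad_root_bounds(4) form p2 a2 c2 by (auto simp: inverted_def bad_def dominated_def)
  define h where "h = b + (2 * c) *\<^sub>R d"
  have h: "h \<in> R" "h \<in> K" "t h = - h"
  proof -
    have "h = reflection B d b" by (simp add: h_def reflection_def db)
    then show "h \<in> R" using refl_root b d by metis
    show "h \<in> K" using K_add K_scale b d c by (simp add: h_def)
    show "t h = - h" using t by (simp add: h_def G_simps)
  qed
  have rh: "B r h = a"
    by (simp add: h_def B_simps a_def p_def q_def)
  have u_def: "\<bar>a\<bar> < 2 * c - p" using bounds by auto
  have a4: "4 * (a * a) < 1"
  proof -
    have "2 * c < 3 / 2"
    proof (rule ccontr)
      assume "\<not> 2 * c < 3 / 2"
      then have "3 / 4 * (3 / 4) \<le> c * c" by (intro mult_mono) auto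
      then show False using c2 by simp
    qed
    then have "\<bar>a\<bar> < 1 / 2" using u_def pq by linarith
    then have "\<bar>a\<bar> * \<bar>a\<bar> < 1 / 2 * (1 / 2)" by (intro mult_strict_mono) auto
    then show ?thesis by simp
  qed
  have "\<exists>v e. v = (2 * \<bar>a\<bar>) *\<^sub>R r + e \<and> v \<in> R \<and> e \<in> K \<and> t e = - e \<and> (\<exists>x. e = x *\<^sub>R h)"
  proof (cases "a < 0")
    case True
    have "reflection B r h = (2 * \<bar>a\<bar>) *\<^sub>R r + h"
      using True by (simp add: reflection_def rh)
    then show ?thesis
      using h refl_root[OF r(2) h(1)] by (metis scaleR_one)
  next
    case False
    \<comment> \<open>For positive \<open>a\<close> the root \<open>- reflection B r h\<close> is
      \<open>2 a r - h\<close>, with the wrong sign at \<open>h\<close>. The second reflection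
      changes that coefficient to \<open>1 - 4 a^2\<close>, which is positive by
      \<open>a4\<close>.\<close>
    have "reflection B h (- reflection B r h) = (2 * \<bar>a\<bar>) *\<^sub>R r + (1 - 4 * (a * a)) *\<^sub>R h"
      using False h norm_root[OF h(1)]
      by (simp add: reflection_def rh B_simps sym[of h r] algebra_simps scaleR_2)
    moreover have "(1 - 4 * (a * a)) *\<^sub>R h \<in> K"
      using K_scale[OF h(2)] a4 by simp
    moreover have "t ((1 - 4 * (a * a)) *\<^sub>R h) = - ((1 - 4 * (a * a)) *\<^sub>R h)"
      using t h by (simp add: G_simps)
    moreover have "reflection B h (- reflection B r h) \<in> R"
      using r h by (intro refl_root neg_root)
    ultimately show ?thesis by metis
  qed
  then obtain v e x where v: "v = (2 * \<bar>a\<bar>) *\<^sub>R r + e" "v \<in> R" "e \<in> K" "t e = - e" "e = x *\<^sub>R h"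
    by blast
  have "e = x *\<^sub>R b + (x * (2 * c)) *\<^sub>R d"
    by (simp add: v(5) h_def scaleR_add_right)
  note V = inverted_comb[OF r(1) v(3,4) this v(1) _ v(2)]
  have V: "v \<in> inverted" "plane_form v - 1 / 2 = (2 * \<bar>a\<bar>) * (2 * \<bar>a\<bar>) * (plane_form r - 1 / 2)"
    using V a by (simp_all add: c2)
  obtain u where u: "u \<in> inverted" "plane_form u \<le> plane_form v"
      "dihedral_value (B u b)" "dihedral_value (B u d)"
    using minimal_inverted_root[OF V(1)] by blast
  have lower: "1 / 2 < plane_form u"
    using u(1) c2 by (simp add: inverted_def)
  have upper: "plane_form u < 9 / 16"
  proof -
    \<comment> \<open>Since \<open>?x * ?x = 2 * (a * a)\<close>, the bound
      \<open>p < 2 c - |a|\<close> turns into \<open>p^2 + a^2 - 1 < (1 - ?x)^2\<close>. The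
      quantity to be estimated is then less than the square of \<open>?x * (1 - ?x)\<close>, and
      that product is at most 1/4.\<close>
    let ?x = "2 * c * \<bar>a\<bar>"
    have "?x * ?x = 4 * (c * c) * (\<bar>a\<bar> * \<bar>a\<bar>)"
      by (simp add: algebra_simps del: abs_mult_self_eq)
    then have xx: "?x * ?x = 2 * (a * a)"
      using c2 by simp
    have "p * p < (2 * c - \<bar>a\<bar>) * (2 * c - \<bar>a\<bar>)"
      using u_def pq by (intro mult_strict_mono) auto
    also have "\<dots> = 4 * (c * c) - 2 * ?x + \<bar>a\<bar> * \<bar>a\<bar>"
      by (simp add: algebra_simps)
    also have "\<dots> = 2 - 2 * ?x + a * a"
      using c2 by simp
    finally have "p * p + a * a - 1 < 1 - 2 * ?x + 2 * (a * a)"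
      by simp
    also have "\<dots> = (1 - ?x) * (1 - ?x)"
      unfolding xx[symmetric] by (simp add: algebra_simps)
    finally have "?x * ?x * (p * p + a * a - 1) < ?x * ?x * ((1 - ?x) * (1 - ?x))"
      using a c by (intro mult_strict_left_mono) auto
    also have "\<dots> = (?x * (1 - ?x)) * (?x * (1 - ?x))" by simp
    also have "\<dots> \<le> 1 / 4 * (1 / 4)"
    proof -
      have le: "?x * (1 - ?x) \<le> 1 / 4"
        using zero_le_square[of "?x - 1 / 2"] by (simp add: algebra_simps)
      have "\<bar>a\<bar> * \<bar>a\<bar> < 1 / 2 * (1 / 2)" using a4 by simp
      then have "\<bar>a\<bar> < 1 / 2" by (meson abs_ge_zero less_le_not_le mult_mono not_le zero_le_divide_1_iff zero_le_numeral)
      then have "c * \<bar>a\<bar> \<le> 1 * (1 / 2)" using c by (intro mult_mono) auto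
      then have "0 \<le> ?x * (1 - ?x)" using c by simp
      with le show ?thesis by (intro mult_mono) auto
    qed
    finally have "?x * ?x * (p * p + a * a - 1) < 1 / 16" by simp
    moreover have aa: "(2 * \<bar>a\<bar>) * (2 * \<bar>a\<bar>) = 4 * (a * a)"
      by simp
    have "plane_form v - 1 / 2 = ?x * ?x * (p * p + a * a - 1)"
      unfolding V(2) form xx aa by (simp add: field_simps)
    ultimately show ?thesis
      using u(2) by simp
  qed
  have c12: "1 / 2 < c"
  proof (rule ccontr)
    assume "\<not> 1 / 2 < c"
    then have "c * c \<le> 1 / 2 * (1 / 2)" using c by (intro mult_mono) auto
    then show False using c2 by simp
  qed
  have sq: "\<not> (1 / 2 < v * v \<and> v * v < 9 / 16)" if "dihedral_value v" for v
    using dihedral_value_square[OF that] by auto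
  have ge: "v = 0 \<or> 1 / 2 \<le> v" if "dihedral_value v" for v
    using dihedral_value_cases[OF that] by auto
  consider "B u b = 0" | "B u d = 0" | "1 / 2 \<le> B u b" "1 / 2 \<le> B u d"
    using u ge by blast
  then show False
  proof cases
    case 1
    then have *: "plane_form u = B u d * B u d" by (simp add: plane_form_def)
    then show ?thesis using sq[OF u(4)] lower upper by auto
  next
    case 2
    then have *: "plane_form u = B u b * B u b" by (simp add: plane_form_def)
    then show ?thesis using sq[OF u(3)] lower upper by auto
  next
    case 3
    have le: "1 / 2 * (1 / 2) \<le> B u b * B u b" "1 / 2 * (1 / 2) \<le> B u d * B u d"
      "1 / 2 * (1 / 2) \<le> B u b * B u d"
      using 3 by (intro mult_mono; simp)+
    have "1 / 2 * (1 / 4) \<le> c * (B u b * B u d)" using le c12 by (intro mult_mono) auto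
    then show ?thesis using le upper by (simp add: plane_form_def)
  qed
qed

text \<open>A bad root has the same form values with \<open>b\<close> and \<open>d\<close> as
  \<open>b\<close> itself. So the reflection of \<open>d\<close> in \<open>r\<close> imitates the
  reflection of \<open>d\<close> in \<open>b\<close>, and it is dominated by the latter because
  \<open>w b - w r\<close> stays in the cone for every \<open>w\<close>.\<close>

lemma card_dominated_next_small_angle:
  assumes c2: "3 / 4 \<le> c * c" "c * c = 3 / 4 \<or> 4 / 5 < c * c"
  shows "card (dominated b) \<le> card (dominated (d + (2 * c) *\<^sub>R b))"
proof (rule card_dominated_next)
  let ?g = "d + (2 * c) *\<^sub>R b"
  let ?F = "\<lambda>r. d + (2 * c) *\<^sub>R r"
  fix r assume bad: "bad r"
  then have r: "r \<in> R" "r \<in> K" "dom_le r b" "r \<noteq> b"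
    by (auto simp: bad_def dominated_def)
  note form = bad_root_small_angle[OF bad c2]
  have "?F r = reflection B r d"
    by (simp add: reflection_def form)
  then have "?F r \<in> R"
    using refl_root r d by metis
  moreover have "?F r \<in> K"
    using K_add K_scale r d c by simp
  moreover have "dom_le (?F r) ?g"
    unfolding dom_le_def
  proof (intro ballI impI)
    fix w assume w: "w \<in> G" "- w ?g \<in> K"
    have "w b - w r \<in> K"
      using dom_le_diff[of "w r" "w b"] G_root w r b dom_le_image by blast
    then have "- w ?g + (2 * c) *\<^sub>R (w b - w r) \<in> K"
      using K_add[OF w(2)] K_scale c by simp
    then show "- w (?F r) \<in> K"
      using w by (simp add: G_simps algebra_simps)
  qed
  ultimately show "?F r \<in> dominated ?g"
    by (simp add: dominated_def)
  show "B (?F r) b < 1"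
    using c by (simp add: B_simps db form)
  show "?F r \<noteq> ?g"
    using r c by simp
next
  show "inj_on (\<lambda>r. d + (2 * c) *\<^sub>R r) {r. bad r}"
    using c by (auto simp: inj_on_def)
qed

text \<open>With \<open>p = B r b\<close>, which need not be 1, the reflection \<open>?h r\<close>
  of \<open>d\<close> in \<open>r\<close> has value \<open>c (2 p^2 - 1)\<close> with
  \<open>b\<close>. A further reflection in \<open>d\<close>, which fixes the next root, brings this
  value back to \<open>c < 1\<close>. The value with the next root is \<open>p^2\<close>: it makes
  the two comparable, and it recovers \<open>p\<close>, which gives injectivity.\<close>

lemma card_dominated_next_right_angle:
  assumes c2: "c * c = 1 / 2"
  shows "card (dominated b) \<le> card (dominated (d + (2 * c) *\<^sub>R b))"
proof (rule card_dominated_next)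
  let ?g = "d + (2 * c) *\<^sub>R b"
  let ?h = "\<lambda>r. d + (2 * c * B r b) *\<^sub>R r"
  let ?F = "\<lambda>r. reflection B d (?h r)"
  have F: "?F r = (2 * c * B r b) *\<^sub>R r + (2 * (B r b * B r b) - 1) *\<^sub>R d" if bad: "bad r" for r
  proof -
    have "B d (?h r) = 1 - 2 * (c * c) * (B r b * B r b)"
      by (simp add: B_simps sym[of d r] bad_root_right_angle[OF bad c2])
    then have Bd: "B d (?h r) = 1 - B r b * B r b"
      by (simp add: c2)
    show ?thesis
      unfolding reflection_def Bd by (simp add: algebra_simps scaleR_2)
  qed
  have gF: "B (?F r) ?g = B r b * B r b" if bad: "bad r" for r
    unfolding F[OF bad] using c2
    by (simp add: B_simps db bd bad_root_right_angle[OF bad c2]) (simp add: algebra_simps)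
  have sg: "reflection B d ?g = ?g"
    using c2 by (simp add: reflection_def B_simps db)
  {
    fix r assume bad: "bad r"
    then have r: "r \<in> R" "r \<in> K" "dom_le r b" "r \<noteq> b"
      by (auto simp: bad_def dominated_def)
    have p: "1 \<le> B r b" using bad_root_bounds[OF bad] by simp
    then have pp: "1 \<le> B r b * B r b" using mult_mono[of 1 "B r b" 1 "B r b"] by simp
    have "?h r = reflection B r d"
      by (simp add: reflection_def bad_root_right_angle[OF bad c2])
    then have hR: "?h r \<in> R" using refl_root r d by metis
    then have FR: "?F r \<in> R" using refl_root d by blast
    moreover have "?F r \<in> K"
      unfolding F[OF bad] using r d c p pp by (intro K_comb) auto
    \<comment> \<open>The wrong direction would put \<open>p r - b\<close> into the cone. But
      \<open>- reflection B r b\<close>, which precedes \<open>r\<close> in the string of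
      \<open>r\<close> and \<open>b\<close>, is dominated by \<open>b\<close>, and this puts
      \<open>b - p r\<close> there. By pointedness \<open>b = p r\<close>, so
      \<open>b = r\<close>.\<close>
    moreover have "\<not> dom_le ?g (?F r)"
    proof
      assume "dom_le ?g (?F r)"
      then have "dom_le (reflection B d ?g) (reflection B d (?F r))"
        using dom_le_image G_reflection d by blast
      then have "dom_le ?g (?h r)"
        by (simp only: sg refl_refl[OF d(1)])
      then have "?h r - ?g \<in> K"
        using dom_le_diff hR next_root by blast
      then have "(2 * c) *\<^sub>R (B r b *\<^sub>R r - b) \<in> K"
        by (simp add: algebra_simps)
      then have 1: "B r b *\<^sub>R r - b \<in> K"
        using K_descale c by auto
      have "dom_le (- reflection B r b) b"
        using dom_le_trans[OF dom_le_prev[OF r(1) b(1) r(3)] r(3)] .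
      then have "b + reflection B r b \<in> K"
        using dom_le_diff[OF neg_root[OF refl_root[OF r(1) b(1)]] b(1)] by simp
      then have "2 *\<^sub>R (b - B r b *\<^sub>R r) \<in> K"
        by (simp add: reflection_def algebra_simps scaleR_2)
      then have "b - B r b *\<^sub>R r \<in> K"
        using K_descale[of 2] by simp
      then have "B r b *\<^sub>R r - b = 0"
        using K_pointed[OF 1] by simp
      then have br: "b = B r b *\<^sub>R r" by simp
      have "B b b = B r b * B r b"
        by (subst br) (simp add: B_simps norm_root r)
      then have "B r b = 1"
        using p by (simp add: square_eq_1_iff)
      then show False using br r(4) by simp
    qed
    ultimately show "?F r \<in> dominated ?g"
      using form_ge_1_imp_dom_le[OF FR next_root(1)] gF[OF bad] pp by (simp add: dominated_def)
    have "B (?F r) b = c"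
      unfolding F[OF bad] by (simp add: B_simps db algebra_simps)
    then show "B (?F r) b < 1" using c by simp
    show "?F r \<noteq> ?g"
    proof
      assume eq: "?F r = ?g"
      then have "B r b * B r b = 1"
        using gF[OF bad] norm_root[OF next_root(1)] by simp
      then have "B r b = 1" using p by (simp add: square_eq_1_iff)
      then show False using eq[unfolded F[OF bad]] r(4) c by (simp add: add.commute)
    qed
  }
  show "inj_on ?F {r. bad r}"
  proof (rule inj_onI)
    fix r r' assume bad: "r \<in> {r. bad r}" "r' \<in> {r. bad r}" and eq: "?F r = ?F r'"
    then have "B r b * B r b = B r' b * B r' b"
      using gF[of r] gF[of r'] by simp
    moreover have "1 \<le> B r b" "1 \<le> B r' b"
      using bad bad_root_bounds by auto
    ultimately have "B r b = B r' b"
      by (simp add: square_eq_iff)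
    moreover have "?h r = ?h r'"
      using eq refl_refl[OF d(1)] by metis
    ultimately show "r = r'"
      using c \<open>1 \<le> B r b\<close> by simp
  qed
qed

end

section \<open>Comparing the roots of a finite dihedral system\<close>

context root_datum
begin

text \<open>For \<open>a = pi / (2 k)\<close> this is the rotation by pi, so -1 on the plane is
  induced by a group element.\<close>

lemma rotation_exists:
  assumes on: "orthonormal f g" and f: "f \<in> R" and a: "circ f g a \<in> R"
  shows "\<exists>w\<in>G. \<forall>x. w (circ f g x) = circ f g (x + 2 * real k * a)"
proof (induction k)
  case 0
  show ?case using G_id by (intro bexI[of _ "\<lambda>v. v"]) auto
next
  case (Suc k)
  then obtain w where w: "w \<in> G" "\<And>x. w (circ f g x) = circ f g (x + 2 * real k * a)"
    by blast
  let ?r = "\<lambda>v. reflection B (circ f g a) (reflection B (circ f g 0) v)"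
  have rG: "?r \<in> G"
    using G_comp[OF G_reflection[OF a] G_reflection[OF f]] by simp
  have "?r (circ f g x) = circ f g (x + 2 * a)" for x
  proof -
    have "reflection B (circ f g 0) (circ f g x) = - circ f g (- x)"
      using refl_circ[OF on, of 0 x] by simp
    then have "?r (circ f g x) = - reflection B (circ f g a) (circ f g (- x))"
      using G_simps(3)[OF G_reflection[OF a]] by simp
    then show ?thesis
      by (simp add: refl_circ[OF on] add.commute)
  qed
  then have "?r (w (circ f g x)) = circ f g (x + 2 * real (Suc k) * a)" for x
    by (simp add: w algebra_simps)
  then show ?case
    using G_comp[OF rG w(1)] by (intro bexI[of _ "\<lambda>v. ?r (w v)"]) simp_all
qed

text \<open>The hypothesis on \<open>d\<close> places the last root, at angle
  \<open>pi - pi / M\<close>, in the cone. The three cases are those of \<open>c^2\<close>: it is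
  1/2 for \<open>M = 4\<close> and 3/4 for \<open>M = 6\<close>; from \<open>M = 8\<close> on it
  exceeds 4/5, because \<open>cos (pi / 4) > 3/5\<close>.\<close>

lemma card_dominated_even:
  assumes on: "orthonormal f g" and M: "even M" "4 \<le> M"
    and f: "f \<in> R" "f \<in> K" and a: "circ f g (pi / real M) \<in> R"
    and d: "- circ f g (- (pi / real M)) \<in> K"
  shows "card (dominated f) \<le> card (dominated (circ f g (pi / real M)))"
proof -
  define x where "x = pi / real M"
  define c where "c = cos x"
  have M0: "0 < real M" using M by simp
  have "4 * x \<le> real M * x"
    using M by (intro mult_right_mono) (auto simp: x_def)
  then have x: "0 < x" "x \<le> pi / 4"
    using M by (auto simp: x_def)
  have c: "0 < c" "c < 1"
    using x cos_gt_zero[of x] cos_monotone_0_pi[of 0 x] by (simp_all add: c_def)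
  obtain k where k: "M = 2 * k" using M by (auto elim: evenE)
  obtain t where t: "t \<in> G" "\<And>y. t (circ f g y) = circ f g (y + 2 * real k * x)"
    using rotation_exists[OF on f(1) a[folded x_def], of k] by blast
  have "2 * real k * x = pi"
    using M0 by (simp add: x_def k)
  then have tm: "t (circ f g y) = - circ f g y" for y
    by (simp add: t circ_add_pi)
  let ?d = "- circ f g (- x)"
  have dR: "?d \<in> R"
  proof -
    have "reflection B f (circ f g x) = ?d"
      using refl_circ[OF on, of 0 x] by simp
    then show ?thesis using refl_root f a by (metis x_def)
  qed
  interpret minus_one_plane B R K G f ?d t c
  proof
    show "B f ?d = - c"
      using circ_form[OF on, of 0 "- x"] by (simp add: B_simps c_def)
    show "t f = - f" using tm[of 0] by simp
    show "t ?d = - ?d" by (simp only: G_simps(3)[OF t(1)] tm)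
  qed (use f d dR c t x_def in auto)
  have next_eq: "?d + (2 * c) *\<^sub>R f = circ f g x"
    by (simp add: circ_def c_def algebra_simps) (simp add: scaleR_add_left[symmetric])
  consider "M = 4" | "M = 6" | "8 \<le> M" using M k by force
  then show ?thesis
  proof cases
    case 1
    then have "c * c = 1 / 2" by (simp add: c_def x_def cos_45)
    then show ?thesis using card_dominated_next_right_angle next_eq by (simp add: x_def)
  next
    case 2
    then have "c * c = 3 / 4" by (simp add: c_def x_def cos_30)
    then show ?thesis using card_dominated_next_small_angle next_eq by (simp add: x_def)
  next
    case 3
    have "2 * x \<le> pi / 4" using 3 by (auto simp: x_def field_simps)
    then have "cos (pi / 4) \<le> cos (2 * x)"
      using x by (intro cos_monotone_0_pi_le) auto
    moreover have "cos (2 * x) = 2 * (c * c) - 1"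
      by (simp add: cos_double_cos c_def power2_eq_square)
    moreover have "3 / 5 < sqrt 2 / 2"
      using real_less_rsqrt[of "6 / 5" 2] by (simp add: power2_eq_square)
    ultimately have "4 / 5 < c * c" by (simp add: cos_45)
    then show ?thesis using card_dominated_next_small_angle next_eq by (simp add: x_def)
  qed
qed

text \<open>The reflection in the root at angle \<open>(i + j + M) \<pi> / (2 M)\<close> maps the root at angle
  \<open>i \<pi> / M\<close> to the one at angle \<open>j \<pi> / M\<close>; this connects \<open>0\<close> to \<open>a\<close> if \<open>a\<close> and \<open>M\<close> have
  the same parity, and \<open>1\<close> to \<open>a\<close> otherwise.\<close>

lemma dominated_card_rank_2:
  assumes on: "orthonormal f g" and M: "3 \<le> M" and a: "1 \<le> a" "a + 2 \<le> M"
    and f: "f \<in> R" "f \<in> K" and r1: "circ f g (pi / real M) \<in> R"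
    and d: "- circ f g (- (pi / real M)) \<in> K"
  shows "card (dominated f) \<le> card (dominated (circ f g (real a * (pi / real M))))"
proof -
  define x where "x = pi / real M"
  have x: "0 < x" "real M * x = pi" using M by (simp_all add: x_def)
  let ?E = "\<lambda>j::nat. circ f g (real j * x)"
  have R: "?E j \<in> R" for j
    using circ_root_int[OF on f(1) r1, of "int j"] by (simp add: x_def)
  have K: "?E j \<in> K" if "j + 1 \<le> M" for j
  proof (rule circ_between_K[of f g 0 "pi - x"])
    show "circ f g (pi - x) \<in> K"
      using d circ_add_pi[of f g "- x"] by (simp add: x_def algebra_simps)
    have "real (j + 1) * x \<le> real M * x"
      using that x by (intro mult_right_mono) auto
    then show "real j * x \<le> pi - x" using x by (simp add: algebra_simps)
    have "3 * x \<le> real M * x" using M x by (intro mult_right_mono) auto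
    then show "0 < pi - x" using x by simp
  qed (use f x in auto)
  have step: "card (dominated (?E i)) \<le> card (dominated (?E j))"
    if k: "2 * k = i + j + M" "k + 1 \<le> M" "i \<le> j" for i j k
  proof -
    have kx: "real k * x - real i * x = (real (j - i) * x + pi) / 2"
    proof -
      have "real (2 * k) * x = real (i + j + M) * x" using k by simp
      then show ?thesis using k x by (simp add: algebra_simps of_nat_diff)
    qed
    have eq: "reflection B (?E k) (?E i) = ?E j"
    proof -
      have "2 * (real k * x) - real i * x = real j * x + pi"
        using kx k by (simp add: algebra_simps of_nat_diff)
      then show ?thesis by (simp add: refl_circ[OF on] circ_add_pi)
    qed
    \<comment> \<open>By \<open>kx\<close> the angle between the two roots is at least
      \<open>pi / 2\<close>, which is the sign condition of
      \<open>card_dominated_refl_mono\<close>.\<close>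
    have "cos (real i * x - real k * x) \<le> 0"
    proof -
      have "real k * x - real i * x \<le> pi"
      proof -
        have "real k * x \<le> real M * x" using k x by (intro mult_right_mono) auto
        then show ?thesis using x by (simp add: mult_nonneg_nonneg add_increasing2 diff_le_eq)
      qed
      moreover have "pi / 2 \<le> real k * x - real i * x"
        unfolding kx using x by simp
      ultimately have "cos (real k * x - real i * x) \<le> cos (pi / 2)"
        by (intro cos_monotone_0_pi_le) auto
      then show ?thesis
        using cos_minus[of "real k * x - real i * x"] by simp
    qed
    then show ?thesis
      using card_dominated_refl_mono[OF R K R K, of i k] k by (simp add: eq circ_form[OF on])
  qed
  have even: "card (dominated (?E 0)) \<le> card (dominated (?E j))"
    if "even (j + M)" "j + 2 \<le> M" for j
    using step[of "(j + M) div 2" 0 j] that by simp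
  show ?thesis
  proof (cases "even (a + M)")
    case True
    then show ?thesis using even[OF True] a by (simp add: x_def)
  next
    case False
    then have a3: "a + 3 \<le> M" using a by (cases "a + 2 = M") auto
    have "card (dominated (?E 1)) \<le> card (dominated (?E a))"
      using step[of "(a + 1 + M) div 2" 1 a] False a a3 by simp
    moreover have "card (dominated (?E 0)) \<le> card (dominated (?E 1))"
    proof (cases "even M")
      case True
      then have "4 \<le> M" using M by presburger
      then show ?thesis
        using card_dominated_even[OF on True _ f r1 d] by (simp add: x_def)
    next
      case False
      then show ?thesis using even[of 1] M by simp
    qed
    ultimately show ?thesis by (simp add: x_def)
  qed
qed

end

section \<open>Coxeter groups and their roots\<close>

lemma convex_cone_hull_insert_split:
  assumes "v \<in> convex_cone hull (insert b N)"
  shows "\<exists>a m. 0 \<le> a \<and> m \<in> convex_cone hull N \<and> v = a *\<^sub>R b + m"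
proof -
  let ?H = "(\<lambda>a. a *\<^sub>R b) ` {0..}"
  have "a *\<^sub>R b + c *\<^sub>R b \<in> ?H" "a *\<^sub>R c *\<^sub>R b \<in> ?H" if "0 \<le> a" "0 \<le> c" for a c
    using that by (auto intro: image_eqI[of _ _ "a + c"] image_eqI[of _ _ "a * c"] simp: scaleR_add_left)
  moreover have "0 \<in> ?H" "b \<in> ?H"
    by (auto intro: image_eqI[of _ _ 0] image_eqI[of _ _ 1])
  ultimately have "convex_cone hull {b} \<subseteq> ?H"
    by (intro hull_minimal) (auto simp: convex_cone_iff)
  moreover have "v \<in> (\<Union>x\<in>convex_cone hull {b}. \<Union>y\<in>convex_cone hull N. {x + y})"
    using assms convex_cone_hull_Un[of "{b}" N] by simp
  ultimately show ?thesis by blast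
qed

text \<open>All relators have even length. Hence multiplication by a generator never preserves the
  length.\<close>

lemma coxeter_cong_parity:
  "coxeter_cong W S us vs \<Longrightarrow> even (length us) \<longleftrightarrow> even (length vs)"
proof (induction rule: coxeter_cong.induct)
  case (relation s t)
  have "length (concat (replicate n [s, t])) = 2 * n" for n
    by (induction n) auto
  then show ?case by simp
qed auto

context coxeter_system
begin

abbreviation len :: "'g \<Rightarrow> nat" where "len \<equiv> cox_length W S"

lemma S_carrier: "s \<in> S \<Longrightarrow> s \<in> carrier W"
  using S_subset by blast

lemma S_square: "s \<in> S \<Longrightarrow> s \<otimes> s = \<one>"
  using S_order_2[of s] pow_ord_eq_1[OF S_carrier, of s] S_carrier
  by (simp add: numeral_2_eq_2)

lemma S_cancel: "s \<in> S \<Longrightarrow> x \<in> carrier W \<Longrightarrow> x \<otimes> s \<otimes> s = x" "s \<in> S \<Longrightarrow> x \<in> carrier W \<Longrightarrow> s \<otimes> (s \<otimes> x) = x"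
  using S_carrier[of s] S_square[of s] by (simp_all add: m_assoc flip: m_assoc[of s s x])

lemma S_inv: "s \<in> S \<Longrightarrow> inv s = s"
  using S_square S_carrier inv_equality by blast

lemma word_prod_Cons: "word_prod W (x # xs) = x \<otimes> word_prod W xs"
  by (simp add: word_prod_def)

lemma word_prod_Nil: "word_prod W [] = \<one>"
  by (simp add: word_prod_def)

lemma word_prod_closed: "ws \<in> lists S \<Longrightarrow> word_prod W ws \<in> carrier W"
  by (induction ws) (auto simp: word_prod_Cons word_prod_Nil S_carrier)

lemma word_prod_append:
  "us \<in> lists S \<Longrightarrow> vs \<in> lists S \<Longrightarrow> word_prod W (us @ vs) = word_prod W us \<otimes> word_prod W vs"
  by (induction us) (auto simp: word_prod_Cons word_prod_Nil S_carrier word_prod_closed m_assoc)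

lemma word_prod_rev: "us \<in> lists S \<Longrightarrow> word_prod W (rev us) = inv (word_prod W us)"
proof (induction us)
  case (Cons a us)
  then have "rev us \<in> lists S" "[a] \<in> lists S" by auto
  with Cons show ?case
    by (simp add: word_prod_append word_prod_Cons word_prod_Nil word_prod_closed S_carrier S_inv
        inv_mult_group del: in_lists_conv_set)
qed (simp add: word_prod_Nil)

lemma word_exists:
  assumes "w \<in> carrier W"
  shows "\<exists>ws\<in>lists S. word_prod W ws = w"
proof -
  have "w \<in> generate W S" using assms S_generates by simp
  then show ?thesis
  proof (induction rule: generate.induct)
    case one
    then show ?case by (intro bexI[of _ "[]"]) (auto simp: word_prod_Nil)
  next
    case (incl h)
    then show ?case by (intro bexI[of _ "[h]"]) (auto simp: word_prod_Nil word_prod_Cons S_carrier)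
  next
    case (inv h)
    then show ?case
      by (intro bexI[of _ "[h]"]) (auto simp: word_prod_Nil word_prod_Cons S_carrier S_inv)
  next
    case (eng h1 h2)
    then obtain us vs where "us \<in> lists S" "word_prod W us = h1" "vs \<in> lists S" "word_prod W vs = h2"
      by blast
    then show ?case by (intro bexI[of _ "us @ vs"]) (auto simp: word_prod_append)
  qed
qed

lemma len_le: "ws \<in> lists S \<Longrightarrow> len (word_prod W ws) \<le> length ws"
  unfolding cox_length_def by (rule Least_le) blast

lemma reduced_word:
  assumes "w \<in> carrier W"
  obtains ws where "ws \<in> lists S" "word_prod W ws = w" "length ws = len w"
proof -
  have "\<exists>n. \<exists>ws\<in>lists S. length ws = n \<and> word_prod W ws = w"
    using word_exists[OF assms] by blast
  then have "\<exists>ws\<in>lists S. length ws = len w \<and> word_prod W ws = w"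
    unfolding cox_length_def by (rule LeastI_ex)
  then show thesis using that by blast
qed

lemma len_one [simp]: "len \<one> = 0"
  using len_le[of "[]"] by (simp add: word_prod_Nil)

lemma len_eq_0: "w \<in> carrier W \<Longrightarrow> len w = 0 \<Longrightarrow> w = \<one>"
  by (metis length_0_conv reduced_word word_prod_Nil)

lemma len_mult_le: "x \<in> carrier W \<Longrightarrow> y \<in> carrier W \<Longrightarrow> len (x \<otimes> y) \<le> len x + len y"
  using len_le[of "_ @ _"] reduced_word[of x] reduced_word[of y] word_prod_append
  by (metis append_in_lists_conv length_append)

lemma len_inv: "x \<in> carrier W \<Longrightarrow> len (inv x) = len x"
proof -
  have le: "len (inv x) \<le> len x" if "x \<in> carrier W" for x
    using reduced_word[OF that] word_prod_rev len_le by (metis in_lists_conv_set length_rev set_rev)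
  assume "x \<in> carrier W"
  then show ?thesis
    using le[of x] le[of "inv x"] by simp
qed

lemma len_S_le: "s \<in> S \<Longrightarrow> len s \<le> 1"
  using len_le[of "[s]"] S_carrier by (simp add: word_prod_Nil word_prod_Cons)

lemma len_mult_S_parity:
  assumes "w \<in> carrier W" "s \<in> S"
  shows "even (len (w \<otimes> s)) \<longleftrightarrow> odd (len w)"
proof -
  obtain us where us: "us \<in> lists S" "word_prod W us = w" "length us = len w"
    using reduced_word[OF assms(1)] .
  obtain vs where vs: "vs \<in> lists S" "word_prod W vs = w \<otimes> s" "length vs = len (w \<otimes> s)"
    using reduced_word[of "w \<otimes> s"] assms S_carrier by blast
  have "coxeter_cong W S (us @ [s]) vs"
    using us vs assms S_carrier
    by (intro presentation) (auto simp: word_prod_append word_prod_Cons word_prod_Nil)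
  then show ?thesis
    using coxeter_cong_parity us vs by fastforce
qed

lemma len_mult_S:
  assumes "w \<in> carrier W" "s \<in> S"
  shows "len (w \<otimes> s) = len w + 1 \<or> len w = len (w \<otimes> s) + 1"
proof -
  have "len (w \<otimes> s) \<le> len w + 1" "len (w \<otimes> s \<otimes> s) \<le> len (w \<otimes> s) + 1"
    using len_mult_le[of w s] len_mult_le[of "w \<otimes> s" s] len_S_le[of s] assms S_carrier by force+
  moreover have "a = b + 1 \<or> b = a + 1"
    if "a \<le> b + 1" "b \<le> a + 1" "even a \<longleftrightarrow> odd b" for a b :: nat
    using that by presburger
  ultimately show ?thesis
    using len_mult_S_parity[OF assms] S_cancel(1)[OF assms(2,1)] by simp
qed

lemma exists_right_descent:
  assumes "w \<in> carrier W" "w \<noteq> \<one>"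
  shows "\<exists>s\<in>S. len w = len (w \<otimes> s) + 1"
proof -
  obtain ws where ws: "ws \<in> lists S" "word_prod W ws = w" "length ws = len w"
    using reduced_word[OF assms(1)] .
  then have "ws \<noteq> []" using assms by (auto simp: word_prod_Nil)
  then obtain us s where us: "ws = us @ [s]" by (metis rev_exhaust)
  then have s: "s \<in> S" "us \<in> lists S" using ws by auto
  have "w \<otimes> s = word_prod W us"
    using ws us s S_carrier S_cancel(1)[OF s(1) word_prod_closed[OF s(2)]]
    by (auto simp: word_prod_append word_prod_Cons word_prod_Nil)
  then have "len (w \<otimes> s) < len w"
    using len_le[OF s(2)] ws us by simp
  then show ?thesis
    using len_mult_S[OF assms(1) s(1)] s by (intro bexI[of _ s]) auto
qed

end

context geometric_representation
begin

abbreviation K :: "'v set" where "K \<equiv> convex_cone hull (\<alpha> ` S)"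

lemma act_mult: "x \<in> carrier W \<Longrightarrow> y \<in> carrier W \<Longrightarrow> \<rho> (x \<otimes> y) v = \<rho> x (\<rho> y v)"
  using group_action.composition_rule[OF action] by blast

lemma act_one: "\<rho> \<one> v = v"
  using group_action.id_eq_one[OF action] by (metis UNIV_I restrict_apply')

lemma act_inv: "x \<in> carrier W \<Longrightarrow> \<rho> (inv x) (\<rho> x v) = v" "x \<in> carrier W \<Longrightarrow> \<rho> x (\<rho> (inv x) v) = v"
  using act_mult[of "inv x" x v] act_mult[of x "inv x" v] act_one by simp_all

lemma act_linear:
  assumes "x \<in> carrier W"
  shows "\<rho> x (u + v) = \<rho> x u + \<rho> x v" "\<rho> x (u - v) = \<rho> x u - \<rho> x v" "\<rho> x (- v) = - \<rho> x v"
    "\<rho> x (a *\<^sub>R v) = a *\<^sub>R \<rho> x v"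
  using linear_action[OF assms] by (simp_all add: linear_add linear_diff linear_neg linear_scale)

lemma K_add: "u \<in> K \<Longrightarrow> v \<in> K \<Longrightarrow> u + v \<in> K"
  by (rule convex_cone_hull_add)

lemma K_scale: "v \<in> K \<Longrightarrow> 0 \<le> a \<Longrightarrow> a *\<^sub>R v \<in> K"
  by (rule convex_cone_hull_mul)

lemma simple_K: "s \<in> S \<Longrightarrow> \<alpha> s \<in> K"
  by (simp add: hull_inc)

lemma K_comb: "u \<in> K \<Longrightarrow> v \<in> K \<Longrightarrow> 0 \<le> a \<Longrightarrow> 0 \<le> b \<Longrightarrow> a *\<^sub>R u + b *\<^sub>R v \<in> K"
  by (simp add: K_add K_scale)

lemma K_explicit:
  assumes "v \<in> K"
  shows "\<exists>F c. finite F \<and> F \<subseteq> S \<and> (\<forall>s. 0 \<le> c s) \<and> (\<forall>s. s \<notin> F \<longrightarrow> c s = 0) \<and> v = (\<Sum>s\<in>F. c s *\<^sub>R \<alpha> s)"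
proof -
  define P where "P v \<longleftrightarrow> (\<exists>F c. finite F \<and> F \<subseteq> S \<and> (\<forall>s. 0 \<le> c s) \<and> (\<forall>s. s \<notin> F \<longrightarrow> c s = 0) \<and>
    v = (\<Sum>s\<in>F. c s *\<^sub>R \<alpha> s))" for v
  have add: "P (u + v)" if "P u" "P v" for u v
  proof -
    obtain F c where F: "finite F" "F \<subseteq> S" "\<forall>s. 0 \<le> c s" "\<forall>s. s \<notin> F \<longrightarrow> c s = 0" "u = (\<Sum>s\<in>F. c s *\<^sub>R \<alpha> s)"
      using \<open>P u\<close> unfolding P_def by blast
    obtain F' c' where F': "finite F'" "F' \<subseteq> S" "\<forall>s. 0 \<le> c' s" "\<forall>s. s \<notin> F' \<longrightarrow> c' s = 0" "v = (\<Sum>s\<in>F'. c' s *\<^sub>R \<alpha> s)"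
      using \<open>P v\<close> unfolding P_def by blast
    have "u = (\<Sum>s\<in>F \<union> F'. c s *\<^sub>R \<alpha> s)" "v = (\<Sum>s\<in>F \<union> F'. c' s *\<^sub>R \<alpha> s)"
      unfolding F(5) F'(5) using F F' by (intro sum.mono_neutral_left; auto)+
    then have "u + v = (\<Sum>s\<in>F \<union> F'. (c s + c' s) *\<^sub>R \<alpha> s)"
      by (simp add: sum.distrib scaleR_add_left)
    then show ?thesis
      unfolding P_def using F F' by (intro exI[of _ "F \<union> F'"] exI[of _ "\<lambda>s. c s + c' s"]) auto
  qed
  have scale: "P (a *\<^sub>R v)" if "P v" "0 \<le> a" for a v
  proof -
    obtain F c where F: "finite F" "F \<subseteq> S" "\<forall>s. 0 \<le> c s" "\<forall>s. s \<notin> F \<longrightarrow> c s = 0" "v = (\<Sum>s\<in>F. c s *\<^sub>R \<alpha> s)"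
      using \<open>P v\<close> unfolding P_def by blast
    then show ?thesis
      unfolding P_def using that by (intro exI[of _ F] exI[of _ "\<lambda>s. a * c s"]) (auto simp: scaleR_sum_right)
  qed
  have "P 0"
    unfolding P_def by (intro exI[of _ "{}"] exI[of _ "\<lambda>s. 0"]) auto
  then have "convex_cone {v. P v}"
    unfolding convex_cone_iff using add scale by simp
  moreover have "\<alpha> ` S \<subseteq> {v. P v}"
  proof
    fix v assume "v \<in> \<alpha> ` S"
    then obtain s where "s \<in> S" "v = \<alpha> s" by blast
    then show "v \<in> {v. P v}"
      unfolding P_def by (intro CollectI exI[of _ "{s}"] exI[of _ "\<lambda>t. if t = s then 1 else 0"]) auto
  qed
  ultimately have "K \<subseteq> {v. P v}" by (rule hull_minimal[rotated])
  then show ?thesis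
    using assms unfolding P_def by blast
qed

lemma K_pointed:
  assumes "v \<in> K" "- v \<in> K"
  shows "v = 0"
proof -
  obtain F c where F: "finite F" "F \<subseteq> S" "\<forall>s. 0 \<le> c s" "\<forall>s. s \<notin> F \<longrightarrow> c s = 0" "v = (\<Sum>s\<in>F. c s *\<^sub>R \<alpha> s)"
    using K_explicit[OF assms(1)] by blast
  obtain F' c' where F': "finite F'" "F' \<subseteq> S" "\<forall>s. 0 \<le> c' s" "\<forall>s. s \<notin> F' \<longrightarrow> c' s = 0" "- v = (\<Sum>s\<in>F'. c' s *\<^sub>R \<alpha> s)"
    using K_explicit[OF assms(2)] by blast
  have "v = (\<Sum>s\<in>F \<union> F'. c s *\<^sub>R \<alpha> s)"
    unfolding F(5) using F F' by (intro sum.mono_neutral_left; auto)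
  moreover have "- v = (\<Sum>s\<in>F \<union> F'. c' s *\<^sub>R \<alpha> s)"
    unfolding F'(5) using F F' by (intro sum.mono_neutral_left; auto)
  ultimately have "(\<Sum>s\<in>F \<union> F'. (c s + c' s) *\<^sub>R \<alpha> s) = v + - v"
    by (simp add: sum.distrib scaleR_add_left)
  then have "c s + c' s = 0" if "s \<in> F \<union> F'" for s
    using positively_independent[of "F \<union> F'" "\<lambda>s. c s + c' s" s] F F' that by auto
  then have "c s = 0" if "s \<in> F" for s
    using F F' that by (metis Un_iff add_nonneg_eq_0_iff)
  then show ?thesis by (simp add: F(5))
qed

end

section \<open>Alternating words and positivity of roots\<close>

context coxeter_system
begin

text \<open>The word starts with the second argument: \<open>t\<close>, \<open>t s\<close>,
  \<open>t s t\<close> and so on. Thus \<open>t\<close> is the right descent that is stripped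
  first.\<close>

primrec alternating :: "'g \<Rightarrow> 'g \<Rightarrow> nat \<Rightarrow> 'g" where
  "alternating s t 0 = \<one>"
| "alternating s t (Suc k) = alternating s t k \<otimes> (if even k then t else s)"

lemma alternating_closed: "s \<in> S \<Longrightarrow> t \<in> S \<Longrightarrow> alternating s t k \<in> carrier W"
  by (induction k) (auto simp: S_carrier)

lemma alternating_even:
  assumes "s \<in> S" "t \<in> S"
  shows "alternating s t (2 * j) = (t \<otimes> s) [^] j"
  using assms by (induction j) (auto simp: S_carrier m_assoc)

lemma S_mult_inv: "s \<in> S \<Longrightarrow> t \<in> S \<Longrightarrow> inv (s \<otimes> t) = t \<otimes> s"
  by (simp add: inv_mult_group S_carrier S_inv)

lemma S_mult_ord_not_1:
  assumes "s \<in> S" "t \<in> S" "s \<noteq> t"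
  shows "ord (s \<otimes> t) \<noteq> 1"
proof
  assume "ord (s \<otimes> t) = 1"
  then have "s \<otimes> t = \<one>"
    using ord_eq_1[of "s \<otimes> t"] assms S_carrier by simp
  then have "s = inv t"
    using inv_equality[of s t] assms S_carrier by simp
  then show False using assms S_inv by simp
qed

lemma braid:
  assumes st: "s \<in> S" "t \<in> S" and M: "ord (s \<otimes> t) \<noteq> 0"
  shows "alternating s t (ord (s \<otimes> t)) = alternating t s (ord (s \<otimes> t))"
proof -
  define g where "g = s \<otimes> t"
  define n where "n = ord g"
  have c [simp]: "s \<in> carrier W" "t \<in> carrier W" "g \<in> carrier W" "t \<otimes> s \<in> carrier W"
    using st S_carrier by (auto simp: g_def)
  have inv: "t \<otimes> s = inv g"
    using S_mult_inv st by (simp add: g_def)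
  have g: "g [^] n = \<one>" by (simp add: n_def)
  have flip: "g [^] i = inv g [^] j" if "i + j = n" for i j
  proof -
    have "g [^] i \<otimes> g [^] j = \<one>" using g that by (simp add: nat_pow_mult)
    then have "g [^] i = inv (g [^] j)" by (simp add: inv_equality)
    then show ?thesis by (simp add: nat_pow_inv)
  qed
  show ?thesis
  proof (cases "even n")
    case True
    then obtain j where j: "n = 2 * j" by (auto elim: evenE)
    have "alternating s t (2 * j) = alternating t s (2 * j)"
      unfolding alternating_even[OF st] alternating_even[OF st(2,1)] g_def[symmetric] inv
      using flip[of j j] j by simp
    then show ?thesis using j by (simp add: n_def g_def)
  next
    case False
    then obtain j where j: "n = Suc (2 * j)" by (auto elim: oddE)
    have "alternating s t n \<otimes> s = inv g [^] Suc j"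
      using alternating_even[OF st, of j] by (simp add: j m_assoc inv)
    also have "\<dots> = g [^] j" using flip[of j "Suc j"] j by simp
    also have "\<dots> = alternating t s n \<otimes> s"
      using alternating_even[OF st(2,1), of j] S_cancel(1)[OF st(1)] by (simp add: j g_def)
    finally have "alternating s t n = alternating t s n"
      using alternating_closed st by simp
    then show ?thesis by (simp add: n_def g_def)
  qed
qed

text \<open>Each letter changes the length by one, so \<open>k\<close> letters lower it by at most
  \<open>k\<close>; the term \<open>2 * k\<close> avoids truncated subtraction.\<close>

lemma len_mult_alternating_ge:
  assumes "w \<in> carrier W" "s \<in> S" "t \<in> S"
  shows "len (w \<otimes> alternating s t j) + k \<le> len (w \<otimes> alternating s t (j + k)) + 2 * k"
proof (induction k)
  case (Suc k)
  have c: "alternating s t (j + k) \<in> carrier W" "(if even (j + k) then t else s) \<in> S"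
    using assms alternating_closed by auto
  then show ?case
    using Suc len_mult_S[of "w \<otimes> alternating s t (j + k)" "if even (j + k) then t else s"] assms S_carrier
    by (auto simp: m_assoc)
qed simp

end

lemma cheb_cos_nonneg:
  assumes "2 \<le> n" "j \<le> n"
  shows "0 \<le> cheb (cos (pi / real n)) j"
proof -
  have "0 < pi / real n" "pi / real n < pi"
    using assms by (simp_all add: field_simps)
  then have "0 < sin (pi / real n)" by (simp add: sin_gt_zero)
  moreover have "real j * (pi / real n) \<le> real n * (pi / real n)"
    using assms by (intro mult_right_mono) auto
  then have "0 \<le> sin (real j * (pi / real n))"
    using assms by (intro sin_ge_zero) auto
  ultimately show ?thesis
    using sin_cheb[of "pi / real n" j] by (metis zero_le_mult_iff not_less)
qed

context geometric_representation
begin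

lemmas B_simps =
  bilinear_ladd[OF bilinear_form] bilinear_radd[OF bilinear_form] bilinear_lmul[OF bilinear_form]
  bilinear_rmul[OF bilinear_form] bilinear_lneg[OF bilinear_form] bilinear_rneg[OF bilinear_form]
  bilinear_lsub[OF bilinear_form] bilinear_rsub[OF bilinear_form]
  bilinear_lzero[OF bilinear_form] bilinear_rzero[OF bilinear_form]

lemma simple_form_cases:
  assumes "s \<in> S" "t \<in> S" "s \<noteq> t"
  shows "2 \<le> ord (s \<otimes> t) \<and> B (\<alpha> s) (\<alpha> t) = - cos (pi / real (ord (s \<otimes> t))) \<or>
    ord (s \<otimes> t) = 0 \<and> B (\<alpha> s) (\<alpha> t) \<le> - 1"
  using simple_finite[OF assms] simple_infinite[OF assms] S_mult_ord_not_1[OF assms]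
  by (cases "ord (s \<otimes> t) = 0") auto

lemma simple_form_nonpos:
  assumes "s \<in> S" "t \<in> S" "s \<noteq> t"
  shows "B (\<alpha> s) (\<alpha> t) \<le> 0"
proof -
  have "0 \<le> cos (pi / real n)" if "2 \<le> n" for n
  proof -
    have "pi / real n \<le> pi / 2" using that by (intro divide_left_mono) auto
    moreover have "- (pi / 2) \<le> pi / real n" by (rule order_trans[of _ 0]) auto
    ultimately show ?thesis by (intro cos_ge_zero)
  qed
  then show ?thesis using simple_form_cases[OF assms] by fastforce
qed

lemma act_simple: "s \<in> S \<Longrightarrow> \<rho> s v = v - (2 * B (\<alpha> s) v) *\<^sub>R \<alpha> s"
  by (simp add: simple_reflection reflection_def)

lemma act_simple_self: "s \<in> S \<Longrightarrow> \<rho> s (\<alpha> s) = - \<alpha> s"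
  by (simp add: act_simple simple_norm scaleR_2)

text \<open>The coefficients are those of \<open>string\<close>, so the sign of this root is a
  question about \<open>cheb\<close> only.\<close>

lemma act_inv_alternating:
  assumes "s \<in> S" "t \<in> S"
  defines "c \<equiv> - B (\<alpha> s) (\<alpha> t)"
  shows "\<rho> (inv (alternating s t k)) (\<alpha> s)
    = cheb c (Suc k) *\<^sub>R \<alpha> (if even k then s else t) + cheb c k *\<^sub>R \<alpha> (if even k then t else s)"
proof (induction k)
  case (Suc k)
  let ?x = "if even k then t else s" and ?y = "if even k then s else t"
  have x: "?x \<in> S" "?y \<in> S" using assms by auto
  have "B (\<alpha> ?x) (\<alpha> ?y) = - c"
    using symmetric_form by (simp add: c_def)
  then have refl: "\<rho> ?x (\<alpha> ?y) = \<alpha> ?y + (2 * c) *\<^sub>R \<alpha> ?x"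
    using act_simple[OF x(1)] by simp
  have "inv (alternating s t (Suc k)) = ?x \<otimes> inv (alternating s t k)"
    using alternating_closed assms x by (simp add: inv_mult_group S_carrier S_inv)
  then have "\<rho> (inv (alternating s t (Suc k))) (\<alpha> s) = \<rho> ?x (\<rho> (inv (alternating s t k)) (\<alpha> s))"
    using act_mult S_carrier x alternating_closed assms by simp
  also have "\<dots> = cheb c (Suc k) *\<^sub>R (\<alpha> ?y + (2 * c) *\<^sub>R \<alpha> ?x) - cheb c k *\<^sub>R \<alpha> ?x"
    unfolding Suc act_linear[OF S_carrier[OF x(1)]] if_distrib[of \<alpha>, symmetric] refl act_simple_self[OF x(1)]
    by simp
  also have "\<dots> = cheb c (Suc (Suc k)) *\<^sub>R \<alpha> ?x + cheb c (Suc k) *\<^sub>R \<alpha> ?y"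
    by (simp add: algebra_simps)
  finally show ?case by (simp split del: if_split) (auto split: if_splits)
qed (simp add: act_one)

text \<open>Write \<open>w = v d\<close> with \<open>d\<close> in the dihedral group generated by \<open>s\<close> and a right descent \<open>t\<close> of
  \<open>w\<close>, where \<open>v\<close> has neither \<open>s\<close> nor \<open>t\<close> as right descent; then \<open>d \<alpha>\<^sub>s\<close> is a nonnegative
  combination of \<open>\<alpha>\<^sub>s\<close> and \<open>\<alpha>\<^sub>t\<close>, to which the induction hypothesis for \<open>v\<close> applies.\<close>

lemma act_simple_pos:
  assumes "w \<in> carrier W" "s \<in> S" "len (w \<otimes> s) = len w + 1"
  shows "\<rho> w (\<alpha> s) \<in> K"
  using assms
proof (induction "len w" arbitrary: w s rule: less_induct)
  case less
  note w = less.prems(1) and s = less.prems(2) and up = less.prems(3)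
  show ?case
  proof (cases "w = \<one>")
    case True
    then show ?thesis using s by (simp add: act_one simple_K)
  next
    case False
    then obtain t where t: "t \<in> S" "len w = len (w \<otimes> t) + 1"
      using exists_right_descent w by blast
    have st: "s \<noteq> t" using t up by auto
    define c where "c = - B (\<alpha> s) (\<alpha> t)"
    let ?a = "alternating s t"
    let ?l = "\<lambda>k. if even k then t else s"
    have ac: "?a k \<in> carrier W" for k using alternating_closed s t by blast
    have lS: "?l k \<in> S" for k using s t by simp
    let ?P = "\<lambda>k. len (w \<otimes> ?a k) + k = len w"
    define k where "k = (GREATEST k. ?P k)"
    have P1: "?P 1" using t w S_carrier[OF t(1)] by simp
    have bd: "\<And>k. ?P k \<Longrightarrow> k \<le> len w" by simp
    have Pk: "?P k" and k1: "1 \<le> k"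
      unfolding k_def using GreatestI_nat[of ?P, OF P1 bd] Greatest_le_nat[of ?P, OF P1 bd] by blast+
    have notP: "\<not> ?P (Suc k)"
      using Greatest_le_nat[of ?P "Suc k", OF _ bd] by (auto simp: k_def)
    define v where "v = w \<otimes> ?a k"
    have v: "v \<in> carrier W" using w ac by (simp add: v_def)
    have lv: "len v < len w" using Pk k1 by (simp add: v_def)
    have "v \<otimes> ?l k = w \<otimes> ?a (Suc k)"
      using w ac[of k] S_carrier[OF lS[of k]] by (simp add: v_def m_assoc split del: if_split)
    then have "len (v \<otimes> ?l k) = len v + 1"
      using len_mult_S[OF v lS[of k]] notP Pk by (auto simp: v_def)
    moreover have "len (v \<otimes> ?l (k - 1)) = len v + 1"
    proof -
      obtain i where i: "k = Suc i" using k1 by (cases k) auto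
      have "v \<otimes> ?l i = w \<otimes> ?a i"
        using S_cancel(1)[OF lS[of i], of "w \<otimes> ?a i"] w ac S_carrier[OF lS[of i]] by (simp add: v_def i m_assoc split del: if_split)
      moreover have "len w \<le> len (w \<otimes> ?a i) + i"
        using len_mult_alternating_ge[OF w s t(1), of 0 i] w by simp
      ultimately have "len v + 1 \<le> len (v \<otimes> ?l i)"
        using Pk by (simp add: i v_def split del: if_split)
      then show ?thesis using len_mult_S[OF v lS[of i]] i by force
    qed
    ultimately have K: "\<rho> v (\<alpha> (?l k)) \<in> K" "\<rho> v (\<alpha> (?l (k - 1))) \<in> K"
      using less.hyps[OF lv v lS] by blast+
    have cheb: "0 \<le> cheb c (Suc k) \<and> 0 \<le> cheb c k"
    proof (cases "ord (s \<otimes> t) = 0")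
      case True
      then have "1 \<le> c" using simple_form_cases[OF s t(1) st] by (simp add: c_def)
      then show ?thesis using cheb_less_Suc by blast
    next
      case False
      define n where "n = ord (s \<otimes> t)"
      have n: "2 \<le> n" "c = cos (pi / real n)"
        using simple_form_cases[OF s t(1) st] False by (auto simp: c_def n_def)
      \<comment> \<open>By the braid relation the alternating word of length \<open>n\<close> may
        also start with \<open>s\<close>. Its first letter then lengthens \<open>w\<close>, so the
        whole word lowers the length by at most \<open>n - 2\<close>, whereas \<open>n <= k\<close>
        would mean a drop of \<open>n\<close>.\<close>
      have "\<not> n \<le> k"
      proof
        assume "n \<le> k"
        have wc: "w \<otimes> alternating t s 1 = w \<otimes> s" using s S_carrier by simp
        have "len (w \<otimes> s) + (n - 1) \<le> len (w \<otimes> alternating t s n) + 2 * (n - 1)"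
          using len_mult_alternating_ge[OF w t(1) s, of 1 "n - 1"] n unfolding wc by simp
        then have 1: "len w + 2 \<le> len (w \<otimes> ?a n) + n"
          using braid[OF s t(1) False] up n by (simp add: n_def)
        have "len (w \<otimes> ?a n) + (k - n) \<le> len (w \<otimes> ?a k) + 2 * (k - n)"
          using len_mult_alternating_ge[OF w s t(1), of n "k - n"] \<open>n \<le> k\<close> by simp
        then show False using 1 Pk \<open>n \<le> k\<close> by simp
      qed
      then show ?thesis using cheb_cos_nonneg[OF n(1)] n by simp
    qed
    have "w = v \<otimes> inv (?a k)"
      using w ac by (simp add: v_def m_assoc)
    then have "\<rho> w (\<alpha> s) = \<rho> v (\<rho> (inv (?a k)) (\<alpha> s))"
      using act_mult v ac by simp
    also have "\<dots> = cheb c (Suc k) *\<^sub>R \<rho> v (\<alpha> (?l (k - 1))) + cheb c k *\<^sub>R \<rho> v (\<alpha> (?l k))"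
      using act_inv_alternating[OF s t(1), of k] k1 by (simp add: act_linear[OF v] c_def)
    finally show ?thesis
      using K cheb K_comb by metis
  qed
qed

section \<open>Roots, inversion sets and length\<close>

abbreviation R :: "'v set" where "R \<equiv> roots W S \<rho> \<alpha>"

lemma root_cases:
  assumes "r \<in> R"
  obtains w s where "w \<in> carrier W" "s \<in> S" "r = \<rho> w (\<alpha> s)"
  using assms by (auto simp: roots_def)

lemma simple_root: "s \<in> S \<Longrightarrow> \<alpha> s \<in> R"
  unfolding roots_def mem_Collect_eq by (intro exI[of _ \<one>] exI[of _ s]) (simp add: act_one)

lemma act_root:
  assumes "w \<in> carrier W" "r \<in> R"
  shows "\<rho> w r \<in> R"
proof -
  obtain x s where "x \<in> carrier W" "s \<in> S" "r = \<rho> x (\<alpha> s)"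
    using root_cases[OF assms(2)] .
  then show ?thesis
    unfolding roots_def mem_Collect_eq using assms
    by (intro exI[of _ "w \<otimes> x"] exI[of _ s]) (simp add: act_mult)
qed

lemma act_form: "w \<in> carrier W \<Longrightarrow> B (\<rho> w u) (\<rho> w v) = B u v"
proof -
  have S: "B (\<rho> s u) (\<rho> s v) = B u v" if "s \<in> S" for s u v
    using that by (simp add: act_simple B_simps simple_norm symmetric_form[of u "\<alpha> s"] algebra_simps)
  have "B (\<rho> (word_prod W ws) u) (\<rho> (word_prod W ws) v) = B u v" if "ws \<in> lists S" for ws
    using that by (induction ws) (auto simp: word_prod_Nil word_prod_Cons act_one act_mult S_carrier word_prod_closed S)
  moreover assume "w \<in> carrier W"
  ultimately show ?thesis using word_exists by metis
qed

lemma act_neg_of_descent: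
  assumes "w \<in> carrier W" "s \<in> S" "len w = len (w \<otimes> s) + 1"
  shows "- \<rho> w (\<alpha> s) \<in> K"
proof -
  have "\<rho> (w \<otimes> s) (\<alpha> s) \<in> K"
    using assms S_cancel(1)[OF assms(2,1)] S_carrier by (intro act_simple_pos) auto
  then show ?thesis
    using assms S_carrier by (simp add: act_mult act_simple_self act_linear)
qed

lemma root_sign: "r \<in> R \<Longrightarrow> r \<in> K \<or> - r \<in> K"
  by (elim root_cases) (use act_simple_pos act_neg_of_descent len_mult_S in blast)

lemma root_norm: "r \<in> R \<Longrightarrow> B r r = 1"
  by (elim root_cases) (simp add: act_form simple_norm)

lemma root_not_both: "r \<in> R \<Longrightarrow> r \<in> K \<Longrightarrow> - r \<notin> K"
  using K_pointed root_norm B_simps(9) by (metis zero_neq_one)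

lemma act_conj_simple:
  assumes "w \<in> carrier W" "s \<in> S"
  shows "\<rho> (w \<otimes> s \<otimes> inv w) = reflection B (\<rho> w (\<alpha> s))"
proof
  fix v
  have "B (\<alpha> s) (\<rho> (inv w) v) = B (\<rho> w (\<alpha> s)) v"
    using act_form[of w "\<alpha> s" "\<rho> (inv w) v"] assms act_inv by simp
  then show "\<rho> (w \<otimes> s \<otimes> inv w) v = reflection B (\<rho> w (\<alpha> s)) v"
    using assms S_carrier by (simp add: act_mult act_simple act_linear act_inv reflection_def)
qed

lemma convex_cone_form_nonpos: "convex_cone {v. B r v \<le> 0}"
  by (auto simp: convex_cone_iff B_simps mult_nonneg_nonpos)

lemma K_split:
  assumes "v \<in> K" "s \<in> S"
  shows "\<exists>a u. 0 \<le> a \<and> u \<in> K \<and> B (\<alpha> s) u \<le> 0 \<and> v = a *\<^sub>R \<alpha> s + u"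
proof -
  let ?N = "\<alpha> ` (S - {s})"
  have "insert (\<alpha> s) ?N = \<alpha> ` S" using assms by blast
  then obtain a u where au: "0 \<le> a" "u \<in> convex_cone hull ?N" "v = a *\<^sub>R \<alpha> s + u"
    using convex_cone_hull_insert_split[of v "\<alpha> s" ?N] assms by auto
  have "convex_cone hull ?N \<subseteq> {v. B (\<alpha> s) v \<le> 0}"
    using simple_form_nonpos assms by (intro hull_minimal convex_cone_form_nonpos) auto
  moreover have "convex_cone hull ?N \<subseteq> K" by (intro hull_mono) auto
  ultimately show ?thesis using au by blast
qed

text \<open>Coefficients are not unique, so \<alpha>-components are split off by
  \<open>K_split\<close> instead, from \<open>r\<close> and from \<open>- \<rho> s r\<close>. The
  two rests add up to \<open>m *\<^sub>R \<alpha> s\<close>, where \<open>m <= 0\<close> because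
  both have nonpositive form with \<open>\<alpha> s\<close>. Pointedness then makes the rest of
  \<open>r\<close> vanish.\<close>

lemma simple_permutes_pos:
  assumes r: "r \<in> R" "r \<in> K" and s: "s \<in> S" and ne: "r \<noteq> \<alpha> s"
  shows "\<rho> s r \<in> K"
proof (rule ccontr)
  assume "\<rho> s r \<notin> K"
  then have "- \<rho> s r \<in> K" using root_sign act_root S_carrier s r by blast
  then obtain a' u' where 1: "0 \<le> a'" "u' \<in> K" "B (\<alpha> s) u' \<le> 0" "- \<rho> s r = a' *\<^sub>R \<alpha> s + u'"
    using K_split s by blast
  obtain a u where 2: "0 \<le> a" "u \<in> K" "B (\<alpha> s) u \<le> 0" "r = a *\<^sub>R \<alpha> s + u"
    using K_split r s by blast
  define m where "m = 2 * B (\<alpha> s) r - a - a'"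
  have "u = r - a *\<^sub>R \<alpha> s" "u' = - \<rho> s r - a' *\<^sub>R \<alpha> s"
    using 1(4) 2(4) by (metis add_diff_cancel_left')+
  then have sum: "u + u' = m *\<^sub>R \<alpha> s"
    unfolding act_simple[OF s] by (simp only: m_def) (simp add: algebra_simps)
  then have "B (\<alpha> s) (u + u') = m" using s by (simp add: B_simps simple_norm)
  then have "m \<le> 0" using 1 2 by (simp add: B_simps)
  then have "u' + (- m) *\<^sub>R \<alpha> s \<in> K"
    by (intro K_add K_scale simple_K 1 s) auto
  moreover have "- u = u' + (- m) *\<^sub>R \<alpha> s"
    using sum by (simp add: algebra_simps eq_neg_iff_add_eq_0)
  ultimately have "u = 0" using K_pointed 2 by metis
  then have ra: "r = a *\<^sub>R \<alpha> s" using 2 by simp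
  then have "a * a = 1" using root_norm[OF r(1)] s by (simp add: B_simps simple_norm)
  then have "a = 1" using 2(1) by (simp add: square_eq_1_iff)
  then show False using ra ne by simp
qed

abbreviation \<Phi> :: "'g \<Rightarrow> 'v set" where "\<Phi> \<equiv> inversion_set W S \<rho> \<alpha>"

lemma pos_roots_iff: "r \<in> pos_roots W S \<rho> \<alpha> \<longleftrightarrow> r \<in> R \<and> r \<in> K"
  by (simp add: pos_roots_def)

lemma neg_root: "r \<in> R \<Longrightarrow> - r \<in> R"
proof (elim root_cases)
  fix w s assume "w \<in> carrier W" "s \<in> S" "r = \<rho> w (\<alpha> s)"
  then have "- r = \<rho> (w \<otimes> s) (\<alpha> s)"
    by (simp add: act_mult S_carrier act_simple_self act_linear)
  then show "- r \<in> R"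
    using act_root[OF _ simple_root] \<open>w \<in> carrier W\<close> \<open>s \<in> S\<close> S_carrier by simp
qed

lemma not_pos_root: "r \<in> R \<Longrightarrow> r \<notin> K \<longleftrightarrow> - r \<in> K"
  using root_not_both root_sign by blast

lemma inversion_set_iff:
  assumes "w \<in> carrier W"
  shows "r \<in> \<Phi> w \<longleftrightarrow> r \<in> R \<and> r \<in> K \<and> - \<rho> (inv w) r \<in> K"
proof -
  have "r \<in> \<rho> w ` neg_roots W S \<rho> \<alpha> \<longleftrightarrow> \<rho> (inv w) r \<in> neg_roots W S \<rho> \<alpha>"
    using act_inv[OF assms] by (metis image_eqI imageE)
  also have "\<dots> \<longleftrightarrow> - \<rho> (inv w) r \<in> pos_roots W S \<rho> \<alpha>"
    by (auto simp: neg_roots_def intro: image_eqI[of _ _ "- \<rho> (inv w) r"])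
  finally show ?thesis
    using assms act_root[of "inv w" r] neg_root[of "\<rho> (inv w) r"]
    by (auto simp: inversion_set_def pos_roots_iff)
qed

lemma inversion_set_mult_simple:
  assumes w: "w \<in> carrier W" and s: "s \<in> S" and pos: "\<rho> (inv w) (\<alpha> s) \<in> K"
  shows "\<Phi> (s \<otimes> w) = insert (\<alpha> s) (\<rho> s ` \<Phi> w)"
proof (rule Set.set_eqI)
  fix r
  have sw: "s \<otimes> w \<in> carrier W" using w s S_carrier by simp
  have act: "\<rho> (inv (s \<otimes> w)) v = \<rho> (inv w) (\<rho> s v)" for v
    using w s S_carrier by (simp add: inv_mult_group S_inv act_mult)
  have ss: "\<rho> s (\<rho> s v) = v" for v
    using act_inv(1)[OF S_carrier[OF s]] S_inv[OF s] by simp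
  have a: "\<alpha> s \<in> \<Phi> (s \<otimes> w)"
    using pos w s by (simp add: inversion_set_iff[OF sw] act act_simple_self act_linear simple_root simple_K)
  have img: "r \<in> \<rho> s ` \<Phi> w \<longleftrightarrow> \<rho> s r \<in> \<Phi> w"
    using ss by (metis image_eqI imageE)
  have "r \<in> \<Phi> (s \<otimes> w) \<longleftrightarrow> \<rho> s r \<in> \<Phi> w" if "r \<noteq> \<alpha> s"
  proof -
    have R: "r \<in> R \<longleftrightarrow> \<rho> s r \<in> R"
      using act_root[OF S_carrier[OF s]] ss by metis
    have "r \<in> K" if "\<rho> s r \<in> K" "r \<in> R" "\<rho> s r \<noteq> \<alpha> s"
      using simple_permutes_pos[of "\<rho> s r" s] that R s ss by simp
    moreover have "\<rho> s r \<in> K" if "r \<in> K" "r \<in> R"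
      using simple_permutes_pos[of r s] that s \<open>r \<noteq> \<alpha> s\<close> by simp
    moreover have "\<alpha> s \<notin> \<Phi> w"
      using pos root_not_both[OF act_root[OF _ simple_root[OF s]]] w by (auto simp: inversion_set_iff)
    ultimately show ?thesis
      unfolding inversion_set_iff[OF sw] inversion_set_iff[OF w] act
      using R inversion_set_iff[OF w] by metis
  qed
  then show "r \<in> \<Phi> (s \<otimes> w) \<longleftrightarrow> r \<in> insert (\<alpha> s) (\<rho> s ` \<Phi> w)"
    using a img by (cases "r = \<alpha> s") simp_all
qed

lemma left_descent_pos:
  assumes "w \<in> carrier W" "s \<in> S"
  shows "len (s \<otimes> w) = len w + 1 \<Longrightarrow> \<rho> (inv w) (\<alpha> s) \<in> K"
    and "len w = len (s \<otimes> w) + 1 \<Longrightarrow> - \<rho> (inv w) (\<alpha> s) \<in> K"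
    and "len (s \<otimes> w) = len w + 1 \<or> len w = len (s \<otimes> w) + 1"
proof -
  have "inv (s \<otimes> w) = inv w \<otimes> s"
    using assms S_carrier by (simp add: inv_mult_group S_inv)
  then have *: "len (inv w \<otimes> s) = len (s \<otimes> w)"
    using len_inv[of "s \<otimes> w"] assms S_carrier by simp
  show "len (s \<otimes> w) = len w + 1 \<Longrightarrow> \<rho> (inv w) (\<alpha> s) \<in> K"
    "len w = len (s \<otimes> w) + 1 \<Longrightarrow> - \<rho> (inv w) (\<alpha> s) \<in> K"
    "len (s \<otimes> w) = len w + 1 \<or> len w = len (s \<otimes> w) + 1"
    using act_simple_pos[of "inv w" s] act_neg_of_descent[of "inv w" s] len_mult_S[of "inv w" s]
      assms * by (simp_all add: len_inv)
qed

lemma len_simple_mult_pos: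
  assumes "w \<in> carrier W" "s \<in> S" "\<rho> (inv w) (\<alpha> s) \<in> K"
  shows "len (s \<otimes> w) = len w + 1"
  using left_descent_pos[OF assms(1,2)] assms root_not_both[OF act_root[OF _ simple_root]] by blast

lemma len_simple_mult_neg:
  assumes "w \<in> carrier W" "s \<in> S" "- \<rho> (inv w) (\<alpha> s) \<in> K"
  shows "len w = len (s \<otimes> w) + 1"
  using left_descent_pos[OF assms(1,2)] assms root_not_both[OF act_root[OF _ simple_root]] by blast

lemma exists_left_descent:
  assumes "w \<in> carrier W" "w \<noteq> \<one>"
  shows "\<exists>s\<in>S. len w = len (s \<otimes> w) + 1"
proof -
  have "inv w \<noteq> \<one>" using assms by (metis inv_inv inv_one)
  then obtain s where s: "s \<in> S" "len (inv w) = len (inv w \<otimes> s) + 1"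
    using exists_right_descent[of "inv w"] assms by blast
  have "inv (s \<otimes> w) = inv w \<otimes> s"
    using assms s S_carrier by (simp add: inv_mult_group S_inv)
  then show ?thesis
    using s len_inv[of "s \<otimes> w"] len_inv[of w] assms S_carrier by (intro bexI[of _ s]) auto
qed

lemma card_inversion_set:
  assumes "w \<in> carrier W"
  shows "finite (\<Phi> w) \<and> card (\<Phi> w) = len w"
  using assms
proof (induction "len w" arbitrary: w rule: less_induct)
  case less
  show ?case
  proof (cases "w = \<one>")
    case True
    have "\<Phi> \<one> = {}"
      using root_not_both by (auto simp: inversion_set_iff act_one)
    then show ?thesis using True by simp
  next
    case False
    then obtain s where s: "s \<in> S" "len w = len (s \<otimes> w) + 1"
      using exists_left_descent less.prems by blast
    define v where "v = s \<otimes> w"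
    have v: "v \<in> carrier W" "w = s \<otimes> v"
      using less.prems s S_carrier S_cancel(2) by (auto simp: v_def)
    have lv: "len w = len v + 1" using s(2) by (simp only: v_def)
    then have IH: "finite (\<Phi> v) \<and> card (\<Phi> v) = len v"
      using less.hyps[OF _ v(1)] by simp
    have pos: "\<rho> (inv v) (\<alpha> s) \<in> K"
      using left_descent_pos(1)[OF v(1) s(1)] lv v(2) by simp
    have "inj (\<rho> s)"
      using act_inv(1)[OF S_carrier[OF s(1)]] by (metis injI)
    moreover have "\<alpha> s \<notin> \<rho> s ` \<Phi> v"
    proof
      assume "\<alpha> s \<in> \<rho> s ` \<Phi> v"
      then obtain r where r: "r \<in> \<Phi> v" "\<alpha> s = \<rho> s r" by blast
      then have "r = - \<alpha> s"
        using act_inv(1)[OF S_carrier[OF s(1)], of r] S_inv[OF s(1)] act_simple_self[OF s(1)]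
        by metis
      then show False
        using r(1) root_not_both[OF simple_root simple_K] s by (simp add: inversion_set_iff[OF v(1)])
    qed
    ultimately show ?thesis
      using IH lv unfolding v(2) inversion_set_mult_simple[OF v(1) s(1) pos]
      by (simp add: card_image inj_on_subset)
  qed
qed

text \<open>An element that acts trivially has no inversions, so its length is 0. This makes the
  description in \<open>root_reflection\<close> definite.\<close>

lemma faithful:
  assumes "g \<in> carrier W" "h \<in> carrier W" "\<rho> g = \<rho> h"
  shows "g = h"
proof -
  have id: "\<rho> (inv h \<otimes> g) v = v" for v
    using assms by (simp add: act_mult act_inv)
  have "\<rho> (inv (inv h \<otimes> g)) v = v" for v
    using act_inv(1)[of "inv h \<otimes> g" v] id assms by simp
  then have "\<Phi> (inv h \<otimes> g) = {}"
    using assms root_not_both by (auto simp: inversion_set_iff)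
  then have "inv h \<otimes> g = \<one>"
    using card_inversion_set[of "inv h \<otimes> g"] assms len_eq_0 by simp
  then show ?thesis
    using assms by (metis inv_closed inv_equality inv_inv)
qed

abbreviation refl_elt :: "'v \<Rightarrow> 'g" where "refl_elt \<equiv> root_reflection W \<rho> B"

lemma root_reflection:
  assumes "r \<in> R"
  shows "refl_elt r \<in> carrier W" "\<rho> (refl_elt r) = reflection B r"
proof -
  obtain w s where "w \<in> carrier W" "s \<in> S" "r = \<rho> w (\<alpha> s)"
    using root_cases[OF assms] .
  then have "\<exists>g. g \<in> carrier W \<and> \<rho> g = reflection B r"
    using act_conj_simple[of w s] S_carrier by (intro exI[of _ "w \<otimes> s \<otimes> inv w"]) auto
  then have "\<exists>!g. g \<in> carrier W \<and> \<rho> g = reflection B r"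
    using faithful by metis
  then have "refl_elt r \<in> carrier W \<and> \<rho> (refl_elt r) = reflection B r"
    unfolding root_reflection_def by (rule theI')
  then show "refl_elt r \<in> carrier W" "\<rho> (refl_elt r) = reflection B r" by auto
qed

end

sublocale geometric_representation \<subseteq> rd: root_datum B "roots W S \<rho> \<alpha>" "convex_cone hull (\<alpha> ` S)" "\<rho> ` carrier W"
proof
  show "(\<lambda>v. v) \<in> \<rho> ` carrier W"
    using act_one by (metis ext image_eqI one_closed)
  show "(\<lambda>v. f (g v)) \<in> \<rho> ` carrier W" if "f \<in> \<rho> ` carrier W" "g \<in> \<rho> ` carrier W" for f g
  proof -
    obtain x y where "x \<in> carrier W" "y \<in> carrier W" "f = \<rho> x" "g = \<rho> y" using \<open>f \<in> \<rho> ` carrier W\<close> \<open>g \<in> \<rho> ` carrier W\<close> by blast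
    then show ?thesis
      by (intro image_eqI[of _ _ "x \<otimes> y"]) (auto simp: act_mult)
  qed
  show "\<exists>g\<in>\<rho> ` carrier W. \<forall>v. f (g v) = v \<and> g (f v) = v" if f: "f \<in> \<rho> ` carrier W" for f
  proof -
    obtain x where x: "x \<in> carrier W" "f = \<rho> x" using f by blast
    then show ?thesis
      using act_inv[OF x(1)] by (intro bexI[of _ "\<rho> (inv x)"]) auto
  qed
  show "finite {r \<in> roots W S \<rho> \<alpha>. r \<in> convex_cone hull (\<alpha> ` S) \<and> - f r \<in> convex_cone hull (\<alpha> ` S)}"
    if f: "f \<in> \<rho> ` carrier W" for f
  proof -
    obtain x where x: "x \<in> carrier W" "f = \<rho> x" using f by blast
    have "{r \<in> R. r \<in> K \<and> - f r \<in> K} = \<Phi> (inv x)"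
      using x inversion_set_iff[of "inv x"] by auto
    then show ?thesis using card_inversion_set[of "inv x"] x by simp
  qed
  show "reflection B r \<in> \<rho> ` carrier W" if "r \<in> roots W S \<rho> \<alpha>" for r
    using root_reflection[OF that] by (metis image_eqI)
qed (use bilinear_form symmetric_form root_norm K_add K_scale K_pointed root_sign act_linear
      act_root act_form in auto)

context geometric_representation
begin

lemma act_refl_elt: "r \<in> R \<Longrightarrow> \<rho> (refl_elt r) v = reflection B r v"
  by (simp add: root_reflection)

lemma refl_elt_square: "r \<in> R \<Longrightarrow> refl_elt r \<otimes> refl_elt r = \<one>"
  by (intro faithful ext) (simp_all add: root_reflection(1) act_mult act_refl_elt act_one rd.refl_refl)

lemma inv_refl_elt: "r \<in> R \<Longrightarrow> inv (refl_elt r) = refl_elt r"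
  using refl_elt_square root_reflection(1) inv_equality by blast

lemma refl_elt_act:
  assumes "w \<in> carrier W" "r \<in> R"
  shows "refl_elt (\<rho> w r) = w \<otimes> refl_elt r \<otimes> inv w"
proof (intro faithful ext)
  fix v
  have "B r (\<rho> (inv w) v) = B (\<rho> w r) v"
    using act_form[OF assms(1), of r "\<rho> (inv w) v"] act_inv[OF assms(1)] by simp
  then show "\<rho> (refl_elt (\<rho> w r)) v = \<rho> (w \<otimes> refl_elt r \<otimes> inv w) v"
    using assms by (simp add: act_refl_elt act_root act_mult root_reflection(1) reflection_def act_linear act_inv)
qed (use assms act_root root_reflection in auto)

lemma act_inv_refl_mult:
  assumes "w \<in> carrier W" "r \<in> R"
  shows "\<rho> (inv (refl_elt r \<otimes> w)) v = \<rho> (inv w) (reflection B r v)"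
  using assms by (simp add: inv_mult_group root_reflection(1) inv_refl_elt act_mult act_refl_elt)

section \<open>Inversions and multiplication by reflections\<close>

context
  fixes w b assumes w: "w \<in> carrier W" and b: "b \<in> \<Phi> w"
begin

private lemma bR: "b \<in> R" "b \<in> K" "- \<rho> (inv w) b \<in> K"
  using b inversion_set_iff[OF w] by auto

text \<open>This injects the inversions of the product with the reflection in \<open>b\<close> into
  those of \<open>w\<close> other than \<open>b\<close>. The roots missed are the \<open>k\<close>
  for which \<open>- reflection B b k\<close> is an inversion of \<open>w\<close> too, and their
  number measures how much the length drops beyond one.\<close>

private definition fold_map :: "'v \<Rightarrow> 'v" where
  "fold_map k = (if reflection B b k \<in> K then reflection B b k else k)"

private lemma rw: "refl_elt b \<otimes> w \<in> carrier W"
  using w bR root_reflection by simp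

private lemma mem: "k \<in> \<Phi> (refl_elt b \<otimes> w) \<longleftrightarrow> k \<in> R \<and> k \<in> K \<and> - \<rho> (inv w) (reflection B b k) \<in> K"
  using inversion_set_iff[OF rw] act_inv_refl_mult[OF w bR(1)] by simp

private lemma fold_map_inj: "inj_on fold_map (\<Phi> (refl_elt b \<otimes> w))"
proof (rule inj_onI)
  fix k k' assume k: "k \<in> \<Phi> (refl_elt b \<otimes> w)" "k' \<in> \<Phi> (refl_elt b \<otimes> w)" "fold_map k = fold_map k'"
  then have "k \<in> R" "k \<in> K" "k' \<in> R" "k' \<in> K" using mem by auto
  then show "k = k'"
    using k(3) rd.refl_refl[OF bR(1)] unfolding fold_map_def by (metis)
qed

private lemma fold_map_image: "fold_map ` \<Phi> (refl_elt b \<otimes> w) \<subseteq> \<Phi> w - {b}"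
proof (rule image_subsetI)
  fix k assume "k \<in> \<Phi> (refl_elt b \<otimes> w)"
  then have k: "k \<in> R" "k \<in> K" "- \<rho> (inv w) (reflection B b k) \<in> K" using mem by auto
  have sk: "reflection B b k \<in> R" using rd.refl_root bR k by blast
  show "fold_map k \<in> \<Phi> w - {b}"
  proof (cases "reflection B b k \<in> K")
    case True
    have "reflection B b k \<noteq> b"
    proof
      assume "reflection B b k = b"
      then have "k = - b" using rd.refl_eq_iff[OF bR(1)] rd.refl_self[OF bR(1)] by metis
      then show False using k bR root_not_both by blast
    qed
    then show ?thesis using True k sk by (simp add: fold_map_def inversion_set_iff[OF w])
  next
    case False
    then have neg: "- reflection B b k \<in> K" using not_pos_root sk by blast
    have "0 < B b k"
    proof (rule ccontr)
      assume "\<not> 0 < B b k"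
      then have "k + (- 2 * B b k) *\<^sub>R b \<in> K"
        by (intro K_add K_scale k bR) auto
      then show False using False by (simp add: reflection_def)
    qed
    then have "- \<rho> (inv w) (reflection B b k) + (2 * B b k) *\<^sub>R (- \<rho> (inv w) b) \<in> K"
      by (intro K_add K_scale k bR) auto
    then have "- \<rho> (inv w) k \<in> K"
      using w by (simp add: reflection_def act_linear)
    moreover have "k \<noteq> b"
    proof
      assume "k = b"
      then have "\<rho> (inv w) b \<in> K"
        using k(3) w bR by (simp add: rd.refl_self act_linear)
      then show False
        using bR root_not_both act_root w by blast
    qed
    ultimately show ?thesis using False k by (simp add: fold_map_def inversion_set_iff[OF w])
  qed
qed

lemma len_refl_mult_less: "len (refl_elt b \<otimes> w) < len w"
proof -
  have "card (fold_map ` \<Phi> (refl_elt b \<otimes> w)) \<le> card (\<Phi> w - {b})"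
    using fold_map_image card_inversion_set[OF w] by (intro card_mono) auto
  then have "len (refl_elt b \<otimes> w) \<le> card (\<Phi> w - {b})"
    using card_image[OF fold_map_inj] card_inversion_set[OF rw] by simp
  also have "\<dots> < len w"
    using card_inversion_set[OF w] b by (metis card_Diff1_less)
  finally show ?thesis .
qed

text \<open>The length drops by exactly one if and only if \<open>fold_map\<close> is onto
  \<open>\<Phi> w - {b}\<close>. Since \<open>k\<close> and \<open>- reflection B b k\<close> add up
  to a multiple of \<open>b\<close>, the criterion is a statement about planes; it is used in this
  form for the end of an arc of inversions and for the cone spanned by inversions.\<close>

lemma len_refl_mult_iff:
  "len (refl_elt b \<otimes> w) + 1 = len w \<longleftrightarrow> (\<forall>k\<in>\<Phi> w. k \<noteq> b \<longrightarrow> - reflection B b k \<notin> \<Phi> w)"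
proof -
  have card: "card (\<Phi> w - {b}) + 1 = len w"
    using card_inversion_set[OF w] b by (metis Suc_eq_plus1 card.remove)
  have "len (refl_elt b \<otimes> w) = card (fold_map ` \<Phi> (refl_elt b \<otimes> w))"
    using card_image[OF fold_map_inj] card_inversion_set[OF rw] by simp
  then have "len (refl_elt b \<otimes> w) + 1 = len w \<longleftrightarrow> fold_map ` \<Phi> (refl_elt b \<otimes> w) = \<Phi> w - {b}"
    using card fold_map_image card_inversion_set[OF w]
    by (metis add_right_cancel card_subset_eq finite_Diff)
  also have "\<dots> \<longleftrightarrow> (\<forall>k\<in>\<Phi> w. k \<noteq> b \<longrightarrow> - reflection B b k \<notin> \<Phi> w)"
  proof
    assume eq: "fold_map ` \<Phi> (refl_elt b \<otimes> w) = \<Phi> w - {b}"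
    show "\<forall>k\<in>\<Phi> w. k \<noteq> b \<longrightarrow> - reflection B b k \<notin> \<Phi> w"
    proof (intro ballI impI notI)
      fix k assume k: "k \<in> \<Phi> w" "k \<noteq> b" "- reflection B b k \<in> \<Phi> w"
      then obtain h where h: "h \<in> \<Phi> (refl_elt b \<otimes> w)" "k = fold_map h"
        using eq by blast
      have kk: "- reflection B b k \<in> K" "\<rho> (inv w) (reflection B b k) \<in> K" "k \<in> R"
        using k inversion_set_iff[OF w] w by (simp_all add: act_linear)
      have skR: "reflection B b k \<in> R" using rd.refl_root bR kk by blast
      show False
      proof (cases "reflection B b h \<in> K")
        case True
        then have "reflection B b k = h"
          using h rd.refl_refl[OF bR(1)] by (simp add: fold_map_def)
        then show False using kk skR root_not_both h mem by blast
      next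
        case False
        then have "k = h" using h by (simp add: fold_map_def)
        then have "- \<rho> (inv w) (reflection B b k) \<in> K" using h mem by blast
        then show False using kk root_not_both act_root[OF _ skR] w by blast
      qed
    qed
  next
    assume no: "\<forall>k\<in>\<Phi> w. k \<noteq> b \<longrightarrow> - reflection B b k \<notin> \<Phi> w"
    have "k \<in> fold_map ` \<Phi> (refl_elt b \<otimes> w)" if k: "k \<in> \<Phi> w" "k \<noteq> b" for k
    proof -
      have kk: "k \<in> R" "k \<in> K" "- \<rho> (inv w) k \<in> K"
        using k inversion_set_iff[OF w] by auto
      have skR: "reflection B b k \<in> R" using rd.refl_root bR kk by blast
      show ?thesis
      proof (cases "reflection B b k \<in> K")
        case True
        then have "reflection B b k \<in> \<Phi> (refl_elt b \<otimes> w)"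
          using mem kk skR rd.refl_refl[OF bR(1)] by simp
        moreover have "fold_map (reflection B b k) = k"
          using kk rd.refl_refl[OF bR(1)] by (simp add: fold_map_def)
        ultimately show ?thesis by force
      next
        case False
        then have "- reflection B b k \<in> K" using not_pos_root skR by blast
        then have "\<rho> (inv w) (reflection B b k) \<notin> K"
          using no k inversion_set_iff[OF w] neg_root[OF skR] w by (auto simp: act_linear)
        then have "- \<rho> (inv w) (reflection B b k) \<in> K"
          using not_pos_root act_root[OF _ skR] w by blast
        then have "k \<in> \<Phi> (refl_elt b \<otimes> w)" using mem kk by simp
        moreover have "fold_map k = k" using False by (simp add: fold_map_def)
        ultimately show ?thesis by force
      qed
    qed
    then show "fold_map ` \<Phi> (refl_elt b \<otimes> w) = \<Phi> w - {b}"
      using fold_map_image by blast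
  qed
  finally show ?thesis .
qed

end

abbreviation \<Phi>1 :: "'g \<Rightarrow> 'v set" where "\<Phi>1 \<equiv> short_inversion_set W S \<rho> \<alpha> B"

lemma short_inversion_set_iff:
  assumes "w \<in> carrier W"
  shows "b \<in> \<Phi>1 w \<longleftrightarrow> b \<in> \<Phi> w \<and> len (refl_elt b \<otimes> w) + 1 = len w"
proof -
  have "b \<in> \<Phi> w" if b: "b \<in> R" "b \<in> K" "len (refl_elt b \<otimes> w) + 1 = len w"
  proof (rule ccontr)
    assume "b \<notin> \<Phi> w"
    then have pos: "\<rho> (inv w) b \<in> K"
      using b inversion_set_iff[OF assms] not_pos_root act_root[OF _ b(1)] assms by blast
    let ?v = "refl_elt b \<otimes> w"
    have v: "?v \<in> carrier W" using assms b root_reflection by simp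
    have "b \<in> \<Phi> ?v"
      using pos b assms by (simp add: inversion_set_iff[OF v] act_inv_refl_mult rd.refl_self act_linear)
    then have "len (refl_elt b \<otimes> ?v) < len ?v"
      using len_refl_mult_less[OF v] by blast
    moreover have "refl_elt b \<otimes> ?v = w"
      using assms b root_reflection(1) refl_elt_square by (simp flip: m_assoc)
    ultimately show False using b by simp
  qed
  then show ?thesis
    using inversion_set_iff[OF assms] by (auto simp: short_inversion_set_def pos_roots_iff)
qed

end

section \<open>The depth of short inversions\<close>

lemma circ_reverse:
  "circ f g (a - x) = circ (circ f g a) (circ f g (a - pi / 2)) x"
proof -
  have "cos (a - pi / 2) = sin a" "sin (a - pi / 2) = - cos a"
    by (simp_all add: cos_diff sin_diff)
  then show ?thesis
    by (simp add: circ_def cos_diff sin_diff algebra_simps)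
qed

lemma (in root_datum) orthonormal_circ:
  "orthonormal f g \<Longrightarrow> orthonormal (circ f g a) (circ f g (a - pi / 2))"
  using circ_form[of f g] by (simp add: orthonormal_def)

context geometric_representation
begin

abbreviation dp :: "'v \<Rightarrow> nat" where "dp r \<equiv> card (rd.dominated r)"

lemma act_G: "w \<in> carrier W \<Longrightarrow> \<rho> w \<in> \<rho> ` carrier W"
  by blast

lemma neg_act_root: "w \<in> carrier W \<Longrightarrow> r \<in> R \<Longrightarrow> - \<rho> w r \<in> R"
  by (simp add: act_root neg_root)

lemma neg_act_circ: "w \<in> carrier W \<Longrightarrow> - \<rho> w (circ f g x) = circ (- \<rho> w f) (- \<rho> w g) x"
  by (simp add: circ_def act_linear)

lemma neg_act_orthonormal:
  "w \<in> carrier W \<Longrightarrow> rd.orthonormal f g \<Longrightarrow> rd.orthonormal (- \<rho> w f) (- \<rho> w g)"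
  by (simp add: rd.orthonormal_def B_simps act_form)

lemma neg_act_comb:
  assumes "w \<in> carrier W" "- \<rho> w u \<in> K" "- \<rho> w v \<in> K" "0 \<le> a" "0 \<le> b"
  shows "- \<rho> w (a *\<^sub>R u + b *\<^sub>R v) \<in> K"
  using K_comb[OF assms(2-5)] assms(1) by (simp add: act_linear)

text \<open>If \<open>pq\<close> has finite order \<open>M\<close>, then \<open>j = 0, \<dots>, M - 1\<close> gives the positive roots in the plane
  of \<open>\<alpha>\<^sub>p\<close> and \<open>\<alpha>\<^sub>q\<close>, from \<open>\<alpha>\<^sub>p\<close> to \<open>\<alpha>\<^sub>q\<close>.\<close>

definition pair_root :: "'g \<Rightarrow> 'g \<Rightarrow> nat \<Rightarrow> 'v" where
  "pair_root p q j = cheb (- B (\<alpha> p) (\<alpha> q)) (Suc j) *\<^sub>R \<alpha> p + cheb (- B (\<alpha> p) (\<alpha> q)) j *\<^sub>R \<alpha> q"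

lemma pair_root_0 [simp]: "pair_root p q 0 = \<alpha> p"
  by (simp add: pair_root_def)

lemma pair_root_string: "pair_root p q j = rd.string (- \<alpha> q) (\<alpha> p) j"
  by (simp add: pair_root_def rd.string_def B_simps symmetric_form[of "\<alpha> q" "\<alpha> p"])

lemma pair_root_root: "p \<in> S \<Longrightarrow> q \<in> S \<Longrightarrow> pair_root p q j \<in> R"
  unfolding pair_root_string by (intro rd.string_root neg_root simple_root)

lemma act_pair_root: "p \<in> S \<Longrightarrow> \<rho> p (pair_root p q (Suc j)) = pair_root q p j"
  by (simp add: pair_root_def act_linear[OF S_carrier] act_simple_self)
    (simp add: act_simple symmetric_form[of "\<alpha> q" "\<alpha> p"] algebra_simps)

text \<open>While the roots of the plane, from \<open>\<alpha> p\<close> on, are negative under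
  \<open>inv h\<close>, letters \<open>p\<close> and \<open>q\<close> can be stripped alternately
  from the left of \<open>h\<close>. Each stripping lowers the index of a pair root by one, so the
  one with index \<open>i\<close> becomes simple. The inequality for \<open>h \<otimes> x\<close>
  carries additivity of lengths over to \<open>h'\<close>.\<close>

lemma peel_dihedral:
  assumes "p \<in> S" "q \<in> S" "h \<in> carrier W" "x \<in> carrier W"
    and "\<And>j. j < i \<Longrightarrow> - \<rho> (inv h) (pair_root p q j) \<in> K"
  shows "\<exists>h' r. r \<in> {p, q} \<and> h' \<in> carrier W \<and> len h' + i = len h \<and> len (h \<otimes> x) \<le> len (h' \<otimes> x) + i \<and>
    \<rho> (inv h') (\<alpha> r) = \<rho> (inv h) (pair_root p q i)"
  using assms
proof (induction i arbitrary: p q h)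
  case 0
  then show ?case by (intro exI[of _ h] exI[of _ p]) auto
next
  case (Suc i)
  define g where "g = p \<otimes> h"
  have p: "p \<in> carrier W" using Suc.prems S_carrier by blast
  have g: "g \<in> carrier W" using Suc.prems p by (simp add: g_def)
  have lg: "len h = len g + 1"
    using len_simple_mult_neg[OF Suc.prems(3,1)] Suc.prems(5)[of 0] by (simp add: g_def)
  have act: "\<rho> (inv g) (pair_root q p j) = \<rho> (inv h) (pair_root p q (Suc j))" for j
  proof -
    have "\<rho> (inv g) (pair_root q p j) = \<rho> (inv h) (\<rho> p (pair_root q p j))"
      using Suc.prems p by (simp add: g_def inv_mult_group S_inv act_mult)
    also have "\<rho> p (pair_root q p j) = pair_root p q (Suc j)"
      using act_inv(1)[OF p, of "pair_root p q (Suc j)"] act_pair_root[OF Suc.prems(1)] S_inv[OF Suc.prems(1)]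
      by metis
    finally show ?thesis .
  qed
  have "h \<otimes> x = p \<otimes> (g \<otimes> x)"
    using S_cancel(2)[OF Suc.prems(1), of "h \<otimes> x"] Suc.prems p by (simp add: g_def m_assoc)
  then have lx: "len (h \<otimes> x) \<le> len (g \<otimes> x) + 1"
    using left_descent_pos(3)[of "g \<otimes> x" p] g Suc.prems by auto
  have neg: "- \<rho> (inv g) (pair_root q p j) \<in> K" if "j < i" for j
    using Suc.prems(5)[of "Suc j"] that act by simp
  obtain h' r where "r \<in> {q, p}" "h' \<in> carrier W" "len h' + i = len g" "len (g \<otimes> x) \<le> len (h' \<otimes> x) + i"
    "\<rho> (inv h') (\<alpha> r) = \<rho> (inv g) (pair_root q p i)"
    using Suc.IH[OF Suc.prems(2,1) g Suc.prems(4) neg] by blast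
  then show ?case
    using lg lx act by (intro exI[of _ h'] exI[of _ r]) auto
qed

text \<open>Angles are measured from \<open>\<alpha> q\<close>, the end whose depth is compared
  later, so angle and index run in opposite directions.\<close>

lemma pair_root_circ:
  assumes p: "p \<in> S" and q: "q \<in> S" and pq: "p \<noteq> q" and M: "ord (p \<otimes> q) \<noteq> 0"
  obtains g where "rd.orthonormal (\<alpha> q) g"
    "\<And>j. pair_root p q j = circ (\<alpha> q) g (pi - real (Suc j) * (pi / real (ord (p \<otimes> q))))"
proof -
  define x where "x = pi / real (ord (p \<otimes> q))"
  have M2: "2 \<le> ord (p \<otimes> q)" and B: "B (\<alpha> p) (\<alpha> q) = - cos x"
    using simple_form_cases[OF p q pq] M by (auto simp: x_def)
  have "0 < x" "real (ord (p \<otimes> q)) * x = pi"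
    using M2 by (simp_all add: x_def)
  moreover from this have "2 * x \<le> real (ord (p \<otimes> q)) * x"
    using M2 by (intro mult_right_mono) auto
  ultimately have x: "0 < x" "x \<le> pi / 2"
    by linarith+
  then have xp: "x < pi" using pi_gt_zero by linarith
  have cx: "0 \<le> cos x" "cos x < 1"
    using x cos_ge_zero[of x] cos_monotone_0_pi[of 0 x] by auto
  have Bqp: "B (\<alpha> q) (\<alpha> p) = - cos x" using B symmetric_form by simp
  then obtain g where g: "rd.orthonormal (\<alpha> q) g" "\<alpha> p = circ (\<alpha> q) g (arccos (- cos x))"
    using rd.orthonormal_exists[OF simple_root[OF q] simple_root[OF p]] cx by auto
  have "arccos (- cos x) = pi - x"
    using arccos_cos[of "pi - x"] x xp by simp
  then have ap: "\<alpha> p = circ (\<alpha> q) g (pi - x)" using g by simp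
  have s: "0 < sin x" using x xp by (simp add: sin_gt_zero)
  have "pair_root p q j = circ (\<alpha> q) g (pi - real (Suc j) * x)" for j
  proof -
    let ?y = "pi - real (Suc j) * x"
    have e: "sin (pi - x - 0) *\<^sub>R circ (\<alpha> q) g ?y
      = sin (pi - x - ?y) *\<^sub>R circ (\<alpha> q) g 0 + sin (?y - 0) *\<^sub>R circ (\<alpha> q) g (pi - x)"
      by (rule circ_comb)
    have "pi - x - ?y = real j * x" by (simp add: algebra_simps)
    then have "sin x *\<^sub>R circ (\<alpha> q) g ?y = sin (real j * x) *\<^sub>R \<alpha> q + sin (real (Suc j) * x) *\<^sub>R \<alpha> p"
      using e by (simp only: ap[symmetric] circ_0 diff_zero sin_pi_minus)
    also have "\<dots> = sin x *\<^sub>R pair_root p q j"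
      using sin_cheb[of x j] sin_cheb[of x "Suc j"]
      by (simp add: pair_root_def B scaleR_add_right del: cheb.simps of_nat_Suc)
    finally show ?thesis using s by simp
  qed
  then show thesis using that g x_def by simp
qed

text \<open>For a left descent \<open>p\<close> of \<open>h\<close>, both \<open>\<alpha> p\<close>
  and \<open>\<alpha> q\<close> are inversions of \<open>h \<otimes> x\<close>, so \<open>p\<close>
  and \<open>q\<close> generate a finite group. Let \<open>i\<close> be the first index in their
  plane whose root stays positive under \<open>inv h\<close>. Stripping letters makes this root
  simple for a shorter \<open>h'\<close>. As \<open>\<alpha> q\<close> is an end of the plane, the
  rank two comparison shows that passing to index \<open>i\<close> does not lower \<open>dp\<close>,
  and induction applies.\<close>

lemma dp_le_right_descent_of_simple:
  assumes "h \<in> carrier W" "x \<in> carrier W" "len (h \<otimes> x) = len h + len x" "q \<in> S"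
    and "\<rho> (inv h) (\<alpha> q) \<in> K" "- \<rho> (inv (h \<otimes> x)) (\<alpha> q) \<in> K"
  shows "\<exists>s\<in>S. - \<rho> (inv x) (\<alpha> s) \<in> K \<and> dp (- \<rho> (inv (h \<otimes> x)) (\<alpha> q)) \<le> dp (- \<rho> (inv x) (\<alpha> s))"
  using assms
proof (induction "len h" arbitrary: h q rule: less_induct)
  case less
  note h = less.prems(1) and x = less.prems(2) and red = less.prems(3) and q = less.prems(4)
    and hq = less.prems(5) and yq = less.prems(6)
  define y where "y = h \<otimes> x"
  have y: "y \<in> carrier W" "inv y \<in> carrier W" using h x by (auto simp: y_def)
  have acty: "\<rho> (inv (k \<otimes> x)) v = \<rho> (inv x) (\<rho> (inv k) v)" if "k \<in> carrier W" for k v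
    using that x by (simp add: inv_mult_group act_mult)
  show ?case
  proof (cases "h = \<one>")
    case True
    then show ?thesis using x q yq by auto
  next
    case False
    then obtain p where p: "p \<in> S" "len h = len (p \<otimes> h) + 1"
      using exists_left_descent h by blast
    have hp: "- \<rho> (inv h) (\<alpha> p) \<in> K"
      using left_descent_pos(2)[OF h p(1)] p(2) by blast
    have pq: "p \<noteq> q"
      using hp hq root_not_both[OF act_root[OF _ simple_root[OF q]]] h by blast
    have "p \<otimes> (h \<otimes> x) = (p \<otimes> h) \<otimes> x"
      using p h x S_carrier by (simp add: m_assoc)
    then have "len (p \<otimes> y) < len y"
      using len_mult_le[of "p \<otimes> h" x] p h x red S_carrier by (simp add: y_def)
    then have yp: "- \<rho> (inv y) (\<alpha> p) \<in> K"
      using left_descent_pos(2,3)[OF y(1) p(1)] by fastforce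
    let ?c = "- B (\<alpha> p) (\<alpha> q)"
    let ?E = "pair_root p q"
    have yq': "- \<rho> (inv y) (\<alpha> q) \<in> K" using yq by (simp add: y_def)
    have neg: "- \<rho> (inv y) (?E j) \<in> K" if "0 \<le> cheb ?c (Suc j)" "0 \<le> cheb ?c j" for j
      unfolding pair_root_def using that by (intro neg_act_comb y yp yq')
    have M: "ord (p \<otimes> q) \<noteq> 0"
    proof
      assume "ord (p \<otimes> q) = 0"
      then have c1: "1 \<le> ?c" using simple_form_cases[OF p(1) q pq] by simp
      have "?E j \<in> \<Phi> y" for j
      proof -
        have ch: "0 \<le> cheb ?c (Suc j)" "0 \<le> cheb ?c j" using cheb_less_Suc[OF c1] by blast+
        have "?E j \<in> K" unfolding pair_root_def using ch p q by (intro K_comb simple_K)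
        then show ?thesis
          using pair_root_root[OF p(1) q] neg[OF ch] by (simp add: inversion_set_iff[OF y(1)])
      qed
      moreover have "- \<alpha> q \<noteq> \<alpha> p"
        using root_not_both[OF simple_root simple_K, OF q q] simple_K[OF p(1)] by auto
      then have "inj ?E"
        unfolding pair_root_string[abs_def] using c1 p q symmetric_form[of "\<alpha> q" "\<alpha> p"]
        by (intro rd.string_inj neg_root simple_root) (auto simp: B_simps)
      ultimately show False
        using card_inversion_set[OF y(1)] finite_subset[of "range ?E" "\<Phi> y"] finite_imageD by blast
    qed
    define n where "n = ord (p \<otimes> q)"
    define z where "z = pi / real n"
    have n: "2 \<le> n" "?c = cos z"
      using simple_form_cases[OF p(1) q pq] M by (auto simp: n_def z_def)
    obtain g where g: "rd.orthonormal (\<alpha> q) g" "\<And>j. ?E j = circ (\<alpha> q) g (pi - real (Suc j) * z)"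
      using pair_root_circ[OF p(1) q pq M] unfolding n_def z_def by metis
    have nz: "real n * z = pi" using n by (simp add: z_def)
    have last: "?E (n - 1) = \<alpha> q"
      unfolding g(2) using n nz by simp
    define i where "i = (LEAST i. \<rho> (inv h) (?E i) \<in> K)"
    have ex: "\<rho> (inv h) (?E (n - 1)) \<in> K" using last hq by simp
    have i: "\<rho> (inv h) (?E i) \<in> K" "i \<le> n - 1"
      unfolding i_def using LeastI[of "\<lambda>i. \<rho> (inv h) (?E i) \<in> K", OF ex]
        Least_le[of "\<lambda>i. \<rho> (inv h) (?E i) \<in> K", OF ex] by blast+
    have below: "- \<rho> (inv h) (?E j) \<in> K" if "j < i" for j
      using not_less_Least[of j "\<lambda>i. \<rho> (inv h) (?E i) \<in> K"] that h
        not_pos_root[OF act_root[OF _ pair_root_root[OF p(1) q]]] by (simp add: i_def)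
    have "i \<noteq> 0"
    proof
      assume "i = 0"
      then show False
        using i(1) hp root_not_both[OF act_root[OF _ simple_root[OF p(1)]]] h by auto
    qed
    obtain h' r where h': "r \<in> {p, q}" "h' \<in> carrier W" "len h' + i = len h"
      "len (h \<otimes> x) \<le> len (h' \<otimes> x) + i" "\<rho> (inv h') (\<alpha> r) = \<rho> (inv h) (?E i)"
      using peel_dihedral[OF p(1) q h x below] by blast
    have red': "len (h' \<otimes> x) = len h' + len x"
      using h' red len_mult_le[OF h'(2) x] by simp
    have ch: "0 \<le> cheb ?c (Suc i)" "0 \<le> cheb ?c i"
      using cheb_cos_nonneg[OF n(1)] i(2) n unfolding n(2) z_def by simp_all
    have same: "\<rho> (inv (h' \<otimes> x)) (\<alpha> r) = \<rho> (inv y) (?E i)"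
      using acty h h' by (simp add: y_def)
    obtain s where s: "s \<in> S" "- \<rho> (inv x) (\<alpha> s) \<in> K" "dp (- \<rho> (inv y) (?E i)) \<le> dp (- \<rho> (inv x) (\<alpha> s))"
      using less.hyps[of h' r] h' \<open>i \<noteq> 0\<close> x red' p q i(1) neg[OF ch] same by auto
    have "dp (- \<rho> (inv y) (\<alpha> q)) \<le> dp (- \<rho> (inv y) (?E i))"
    proof (cases "i = n - 1")
      case True
      then show ?thesis using last by simp
    next
      case False
      then have i2: "1 \<le> i" "i + 2 \<le> n" using i \<open>i \<noteq> 0\<close> by auto
      let ?f = "- \<rho> (inv y) (\<alpha> q)" and ?g = "- \<rho> (inv y) g"
      have E: "circ ?f ?g (pi - real (Suc j) * z) = - \<rho> (inv y) (?E j)" for j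
        unfolding g(2) using neg_act_circ[OF y(2)] by simp
      have ang: "real (n - 1 - j) * z = pi - real (Suc j) * z" if "j < n" for j
        using that nz by (simp add: of_nat_diff algebra_simps)
      \<comment> \<open>Counted from \<open>\<alpha> q\<close>, the root with index \<open>i\<close>
        has position \<open>n - 1 - i\<close>; both ends are excluded, as the comparison
        requires.\<close>
      have "dp ?f \<le> dp (circ ?f ?g (real (n - 1 - i) * (pi / real n)))"
      proof (rule rd.dominated_card_rank_2)
        show "rd.orthonormal ?f ?g" using neg_act_orthonormal[OF y(2) g(1)] .
        show "?f \<in> R" "?f \<in> K" using yq' neg_act_root[OF y(2) simple_root[OF q]] by auto
        have "n - 1 - (n - 2) = 1" using i2 by simp
        then have "z = pi - real (Suc (n - 2)) * z"
          using ang[of "n - 2"] i2 by simp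
        then show "circ ?f ?g (pi / real n) \<in> R"
          unfolding z_def[symmetric] using neg_act_root[OF y(2) pair_root_root[OF p(1) q, of "n - 2"]]
          by (metis E)
        have "- circ ?f ?g (- (pi / real n)) = circ ?f ?g (pi - real (Suc 0) * z)"
          using circ_add_pi[of ?f ?g "- z"] by (simp add: z_def)
        also have "\<dots> = - \<rho> (inv y) (\<alpha> p)"
          unfolding E by simp
        finally show "- circ ?f ?g (- (pi / real n)) \<in> K" using yp by simp
      qed (use i2 in auto)
      moreover have "real (n - 1 - i) * (pi / real n) = pi - real (Suc i) * z"
        using ang[of i] i2 by (simp add: z_def)
      ultimately show ?thesis using E[of i] by simp
    qed
    then show ?thesis using s unfolding y_def by (intro bexI[of _ s]) auto
  qed
qed

text \<open>If the form value is at least 1, then \<open>\<alpha> p\<close> is dominated by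
  \<open>z\<close>, since \<open>p\<close> makes no other positive root negative; the sign change
  reverses dominance. Otherwise the plane is finite dihedral. Shortness of \<open>z\<close> means
  that the inversions of \<open>y\<close> starting at \<open>\<alpha> p\<close> stop at
  \<open>z\<close>, so \<open>z\<close> becomes an end of the transformed system and
  \<open>\<alpha> p\<close> an inner root: the positive form value keeps the angle below
  \<open>pi / 2\<close>.\<close>

lemma dp_le_of_short_inversion:
  assumes y: "y \<in> carrier W" and z: "z \<in> \<Phi>1 y" and p: "p \<in> S" and yp: "- \<rho> (inv y) (\<alpha> p) \<in> K"
    and pos: "0 < B z (\<alpha> p)" and ne: "z \<noteq> \<alpha> p"
  shows "dp (- \<rho> (inv y) z) \<le> dp (- \<rho> (inv y) (\<alpha> p))"
proof -
  have zi: "z \<in> \<Phi> y" "len (refl_elt z \<otimes> y) + 1 = len y"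
    using z short_inversion_set_iff[OF y] by auto
  then have zz: "z \<in> R" "z \<in> K" "- \<rho> (inv y) z \<in> K" using inversion_set_iff[OF y] by auto
  have yi: "inv y \<in> carrier W" using y by simp
  have ap: "\<alpha> p \<in> R" "\<alpha> p \<in> K" using simple_root simple_K p by auto
  show ?thesis
  proof (cases "1 \<le> B z (\<alpha> p)")
    case True
    have "\<not> rd.dom_le z (\<alpha> p)"
    proof
      assume d: "rd.dom_le z (\<alpha> p)"
      have "- \<rho> p (\<alpha> p) \<in> K" using ap act_simple_self[OF p] by simp
      then have "- \<rho> p z \<in> K"
        using rd.dom_leD[OF d act_G[OF S_carrier[OF p]]] by blast
      then show False
        using simple_permutes_pos[OF zz(1,2) p ne] root_not_both act_root S_carrier p zz by blast
    qed
    then have "rd.dom_le (\<alpha> p) z"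
      using rd.form_ge_1_imp_dom_le[OF zz(1) ap(1) True] by blast
    then have "rd.dom_le (\<rho> (inv y) (- z)) (\<rho> (inv y) (- \<alpha> p))"
      using rd.dom_le_image[OF _ act_G[OF yi]] rd.dom_le_uminus[OF zz(1) ap(1)] by blast
    then have "rd.dom_le (- \<rho> (inv y) z) (- \<rho> (inv y) (\<alpha> p))"
      using y by (simp add: act_linear)
    then have "rd.dominated (- \<rho> (inv y) z) \<subseteq> rd.dominated (- \<rho> (inv y) (\<alpha> p))"
      using rd.dom_le_trans by (auto simp: rd.dominated_def)
    then show ?thesis
      using rd.finite_dominated[OF neg_act_root[OF yi ap(1)] yp] card_mono by blast
  next
    case False
    have "- 1 < B (\<alpha> p) z" "B (\<alpha> p) z < 1"
      using False pos symmetric_form[of z "\<alpha> p"] by auto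
    then obtain g and n i :: nat where on: "rd.orthonormal (\<alpha> p) g" and i: "0 < i" "i < n"
      and zc: "z = circ (\<alpha> p) g (real i * (pi / real n))" and r1: "circ (\<alpha> p) g (pi / real n) \<in> R"
      using rd.finite_dihedral[OF ap zz(1,2)] by metis
    define x where "x = pi / real n"
    have x: "0 < x" "real n * x = pi" using i by (simp_all add: x_def)
    let ?e = "\<lambda>j::nat. circ (\<alpha> p) g (real j * x)"
    have zi_eq: "z = ?e i" using zc by (simp add: x_def)
    have R: "?e j \<in> R" for j
      using rd.circ_root_int[OF on ap(1) r1, of "int j"] by (simp add: x_def)
    have ix: "real i * x < pi" using i x by (metis mult_strict_right_mono of_nat_less_iff)
    have "B (\<alpha> p) z = cos (real i * x)"
      using rd.circ_form[OF on, of 0 "real i * x"] by (simp add: zi_eq)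
    then have "0 < cos (real i * x)" using pos symmetric_form[of z "\<alpha> p"] by simp
    then have "real i * x < pi / 2"
      using cos_monotone_0_pi_le[of "pi / 2" "real i * x"] ix by (cases "real i * x < pi / 2") auto
    then have "real (2 * i) * x < real n * x" using x by simp
    then have in2: "2 * i < n" using x(1) by (metis mult_less_cancel_right_pos of_nat_less_iff)
    then have n3: "3 \<le> n" "i + 2 \<le> n" using i by auto
    have cx: "cos x < 1"
      using cos_monotone_0_pi[of 0 x] x n3 ix i by (simp add: x_def field_simps)
    have eK: "?e j \<in> K" if "j \<le> i" for j
      using rd.circ_between_K[of "\<alpha> p" g 0 "real i * x" "real j * x"] ap zz ix x i that
      by (simp add: zi_eq)
    \<comment> \<open>As \<open>p\<close> permutes the positive roots other than
      \<open>\<alpha> p\<close>, this simple root is an end of the positive roots in the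
      plane.\<close>
    have low: "- circ (\<alpha> p) g (- x) \<in> K"
    proof -
      have "?e 1 \<noteq> \<alpha> p"
      proof
        assume "?e 1 = \<alpha> p"
        then have "B (\<alpha> p) (\<alpha> p) = cos x"
          using rd.circ_form[OF on, of 0 x] by simp
        then show False using cx simple_norm[OF p] by simp
      qed
      then have "\<rho> p (?e 1) \<in> K"
        using i by (intro simple_permutes_pos[OF R eK p]) auto
      moreover have "\<rho> p (?e 1) = - circ (\<alpha> p) g (- x)"
        using rd.refl_circ[OF on, of 0 x] simple_reflection[OF p] by simp
      ultimately show ?thesis by simp
    qed
    let ?L = "\<lambda>v. - \<rho> (inv y) v"
    have LK: "?L (?e j) \<in> K" if "j \<le> i" for j
    proof -
      have "circ (?L (\<alpha> p)) (?L g) (real j * x) \<in> K"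
      proof (rule rd.circ_between_K[of _ _ 0 "real i * x"])
        show "circ (?L (\<alpha> p)) (?L g) (real i * x) \<in> K"
          using zz(3) neg_act_circ[OF yi] by (simp add: zi_eq)
      qed (use yp ix x i that in auto)
      then show ?thesis using neg_act_circ[OF yi] by simp
    qed
    \<comment> \<open>Minus the reflection in \<open>z\<close> exchanges the two neighbours of
      \<open>z\<close>. The lower one is an inversion of \<open>y\<close>, so by the criterion for
      short inversions the upper one is not.\<close>
    have next_K: "- ?L (?e (i + 1)) \<in> K"
    proof -
      have rf: "- reflection B z (?e (i - 1)) = ?e (i + 1)"
      proof -
        have "2 * (real i * x) - real (i - 1) * x = real (i + 1) * x"
          using i by (simp add: of_nat_diff algebra_simps)
        then show ?thesis unfolding zi_eq by (simp add: rd.refl_circ[OF on])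
      qed
      have "?e (i - 1) \<in> \<Phi> y"
        using R eK LK by (simp add: inversion_set_iff[OF y])
      moreover have "?e (i - 1) \<noteq> z"
      proof
        assume "?e (i - 1) = z"
        then have "B z z = cos (real i * x - real (i - 1) * x)"
          using rd.circ_form[OF on, of "real i * x" "real (i - 1) * x"] by (simp add: zi_eq)
        also have "real i * x - real (i - 1) * x = x" using i by (simp add: of_nat_diff algebra_simps)
        finally show False using cx root_norm[OF zz(1)] by simp
      qed
      ultimately have notin: "?e (i + 1) \<notin> \<Phi> y"
        using len_refl_mult_iff[OF y zi(1)] zi(2) rf by metis
      have "?e (i + 1) \<in> K"
      proof (rule rd.circ_between_K[of _ _ 0 "pi - x"])
        show "circ (\<alpha> p) g (pi - x) \<in> K"
          using low circ_add_pi[of "\<alpha> p" g "- x"] by (simp add: algebra_simps)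
        have "real (i + 2) * x \<le> real n * x" using n3 x by (intro mult_right_mono) auto
        then show "real (i + 1) * x \<le> pi - x" using x by (simp add: algebra_simps)
        then show "0 < pi - x" using x i by (smt (verit) mult_nonneg_nonneg of_nat_0_le_iff mult_pos_pos of_nat_0_less_iff zero_less_Suc Suc_eq_plus1)
      qed (use ap x in auto)
      then have "?L (?e (i + 1)) \<notin> K"
        using notin R[of "i + 1"] inversion_set_iff[OF y] by blast
      then show ?thesis
        using not_pos_root[OF neg_act_root[OF yi R[of "i + 1"]]] by blast
    qed
    define f' g' where "f' = ?L (?e i)" and "g' = ?L (circ (\<alpha> p) g (real i * x - pi / 2))"
    have rev: "circ f' g' a = ?L (circ (\<alpha> p) g (real i * x - a))" for a
      unfolding f'_def g'_def circ_reverse[of "\<alpha> p" g "real i * x" a]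
    by (rule neg_act_circ[OF yi, symmetric])
    have "dp f' \<le> dp (circ f' g' (real i * (pi / real n)))"
    proof (rule rd.dominated_card_rank_2)
      show "rd.orthonormal f' g'"
        unfolding f'_def g'_def by (intro neg_act_orthonormal yi rd.orthonormal_circ on)
      show "f' \<in> R" "f' \<in> K"
        unfolding f'_def using neg_act_root[OF yi R] LK by auto
      have "real i * x - x = real (i - 1) * x" using i by (simp add: of_nat_diff algebra_simps)
      then show "circ f' g' (pi / real n) \<in> R"
        unfolding rev x_def[symmetric] using neg_act_root[OF yi R] by simp
      have "real i * x - - x = real (i + 1) * x" by (simp add: algebra_simps)
      then show "- circ f' g' (- (pi / real n)) \<in> K"
        unfolding rev x_def[symmetric] using next_K by simp
    qed (use i n3 in auto)
    moreover have "circ f' g' (real i * (pi / real n)) = ?L (\<alpha> p)"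
      unfolding rev by (simp add: x_def)
    ultimately show ?thesis by (simp add: f'_def zi_eq)
  qed
qed

lemma exists_simple_form_pos:
  assumes "r \<in> R" "r \<in> K"
  shows "\<exists>p\<in>S. 0 < B r (\<alpha> p)"
proof (rule ccontr)
  assume "\<not> ?thesis"
  then have "K \<subseteq> {v. B r v \<le> 0}"
    by (intro hull_minimal convex_cone_form_nonpos) force
  then have "B r r \<le> 0" using assms by blast
  then show False using root_norm[OF assms(1)] by simp
qed

lemma reflect_simple_neg:
  assumes r: "r \<in> R" "r \<in> K" and p: "p \<in> S" and pos: "0 < B r (\<alpha> p)" and ne: "r \<noteq> \<alpha> p"
  shows "- reflection B r (\<alpha> p) \<in> K"
proof (rule ccontr)
  let ?k = "reflection B r (\<alpha> p)"
  assume "- ?k \<notin> K"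
  have kR: "?k \<in> R" using rd.refl_root r simple_root p by blast
  then have kK: "?k \<in> K" using \<open>- ?k \<notin> K\<close> not_pos_root by blast
  have "?k \<noteq> \<alpha> p"
    using pos rd.root_nonzero[OF r(1)] by (simp add: reflection_def)
  then have "\<rho> p ?k \<in> K" using simple_permutes_pos[OF kR kK p] by blast
  moreover have "\<rho> p r \<in> K" using simple_permutes_pos[OF r p ne] .
  ultimately have "\<rho> p ?k + (2 * B r (\<alpha> p)) *\<^sub>R \<rho> p r \<in> K"
    using pos by (intro K_add K_scale) auto
  moreover have "\<rho> p ?k + (2 * B r (\<alpha> p)) *\<^sub>R \<rho> p r = \<rho> p (\<alpha> p)"
    unfolding reflection_def act_linear[OF S_carrier[OF p]] by simp
  ultimately show False
    using act_simple_self[OF p] root_not_both[OF simple_root simple_K] p by simp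
qed

text \<open>The length of the reflection takes the place of the depth of the root. Here
  \<open>p\<close> is a descent of the reflection on both sides, and the two descents do not
  coincide because \<open>r\<close> is not \<open>\<alpha> p\<close>.\<close>

lemma len_refl_elt_conj_less:
  assumes r: "r \<in> R" "r \<in> K" and p: "p \<in> S" and pos: "0 < B r (\<alpha> p)" and ne: "r \<noteq> \<alpha> p"
  shows "len (refl_elt (\<rho> p r)) < len (refl_elt r)"
proof -
  let ?t = "refl_elt r"
  have c: "?t \<in> carrier W" "p \<in> carrier W" using r root_reflection S_carrier p by auto
  have neg: "- reflection B r (\<alpha> p) \<in> K" using reflect_simple_neg[OF assms] .
  have kR: "- reflection B r (\<alpha> p) \<in> R"
    using rd.refl_root r simple_root p neg_root by blast
  have "- \<rho> (inv ?t) (\<alpha> p) \<in> K"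
    using neg r by (simp add: inv_refl_elt act_refl_elt)
  then have 1: "len ?t = len (p \<otimes> ?t) + 1"
    using len_simple_mult_neg[OF c(1) p] by blast
  have "- reflection B r (\<alpha> p) \<noteq> \<alpha> p"
  proof
    assume "- reflection B r (\<alpha> p) = \<alpha> p"
    then have "2 *\<^sub>R \<alpha> p = (2 * B r (\<alpha> p)) *\<^sub>R r"
      by (simp add: reflection_def scaleR_2 algebra_simps)
    then have "(1 / 2) *\<^sub>R 2 *\<^sub>R \<alpha> p = (1 / 2) *\<^sub>R (2 * B r (\<alpha> p)) *\<^sub>R r"
      by (simp only:)
    then have eq: "\<alpha> p = B r (\<alpha> p) *\<^sub>R r" by simp
    have "B (\<alpha> p) (\<alpha> p) = B r (\<alpha> p) * B r (\<alpha> p)"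
      by (subst (2) eq) (simp add: B_simps symmetric_form[of "\<alpha> p" r])
    then have "B r (\<alpha> p) * B r (\<alpha> p) = 1" using simple_norm[OF p] by simp
    then have "B r (\<alpha> p) = 1" using pos by (simp add: square_eq_1_iff)
    then show False using eq ne by simp
  qed
  then have "\<rho> p (- reflection B r (\<alpha> p)) \<in> K"
    using simple_permutes_pos[OF kR neg p] by blast
  then have "- \<rho> (p \<otimes> ?t) (\<alpha> p) \<in> K"
    using c r by (simp add: act_mult act_refl_elt act_linear)
  then have "\<rho> (p \<otimes> ?t) (\<alpha> p) \<notin> K"
    using root_not_both act_root[OF _ simple_root[OF p]] c by blast
  then have "len (p \<otimes> ?t) = len (p \<otimes> ?t \<otimes> p) + 1"
    using act_simple_pos[of "p \<otimes> ?t" p] len_mult_S[of "p \<otimes> ?t" p] c p by auto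
  moreover have "refl_elt (\<rho> p r) = p \<otimes> ?t \<otimes> p"
    using refl_elt_act[OF c(2) r(1)] S_inv[OF p] by simp
  ultimately show ?thesis using 1 by simp
qed

text \<open>Multiplying by simple reflections that lower the depth of \<open>r\<close> while raising the length of
  \<open>x\<close>, one reaches either a simple root or the situation of \<open>dp_le_of_short_inversion\<close>.\<close>

lemma raise_short_inversion:
  assumes "x \<in> carrier W" "r \<in> \<Phi>1 x"
  shows "\<exists>h\<in>carrier W. len (h \<otimes> x) = len h + len x \<and> \<rho> h r \<in> \<Phi>1 (h \<otimes> x) \<and>
    ((\<exists>q\<in>S. \<rho> h r = \<alpha> q) \<or>
     (\<exists>p\<in>S. - \<rho> (inv (h \<otimes> x)) (\<alpha> p) \<in> K \<and> 0 < B (\<rho> h r) (\<alpha> p) \<and> \<rho> h r \<noteq> \<alpha> p \<and>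
        \<rho> (inv h) (\<alpha> p) \<in> K))"
  using assms
proof (induction "len (refl_elt r)" arbitrary: x r rule: less_induct)
  case less
  note x = less.prems(1) and r1 = less.prems(2)
  have r: "r \<in> R" "r \<in> K" "- \<rho> (inv x) r \<in> K" and short: "len (refl_elt r \<otimes> x) + 1 = len x"
    using r1 short_inversion_set_iff[OF x] inversion_set_iff[OF x] by auto
  obtain p where p: "p \<in> S" "0 < B r (\<alpha> p)"
    using exists_simple_form_pos r by blast
  have pc: "p \<in> carrier W" using p S_carrier by blast
  consider "r = \<alpha> p" | "r \<noteq> \<alpha> p" "- \<rho> (inv x) (\<alpha> p) \<in> K" | "r \<noteq> \<alpha> p" "\<rho> (inv x) (\<alpha> p) \<in> K"
    using root_sign[OF act_root[OF _ simple_root[OF p(1)]], of "inv x"] x by blast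
  then show ?case
  proof cases
    case 1
    then show ?thesis
      using x r1 p by (intro bexI[of _ \<one>]) (auto simp: act_one)
  next
    case 2
    then show ?thesis
      using x r1 p simple_K by (intro bexI[of _ \<one>]) (auto simp: act_one)
  next
    case 3
    have px: "p \<otimes> x \<in> carrier W" using pc x by simp
    have lpx: "len (p \<otimes> x) = len x + 1" using len_simple_mult_pos[OF x p(1) 3(2)] .
    let ?r = "\<rho> p r"
    have pr: "?r \<in> R" "?r \<in> K"
      using act_root pc r simple_permutes_pos[OF r(1,2) p(1) 3(1)] by auto
    let ?z = "refl_elt r \<otimes> x"
    have z: "?z \<in> carrier W" using root_reflection r x by simp
    \<comment> \<open>Both summands are in the cone, so \<open>p\<close> lengthens \<open>?z\<close>
      as it lengthens \<open>x\<close>, and the length difference of one survives.\<close>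
    have "\<rho> (inv ?z) (\<alpha> p) = \<rho> (inv x) (\<alpha> p) + (2 * B r (\<alpha> p)) *\<^sub>R (- \<rho> (inv x) r)"
      using act_inv_refl_mult[OF x r(1)] x by (simp add: reflection_def act_linear)
    then have "\<rho> (inv ?z) (\<alpha> p) \<in> K"
      using 3 r p by (simp only:) (intro K_add K_scale; simp)
    then have "len (p \<otimes> ?z) = len ?z + 1" using len_simple_mult_pos[OF z p(1)] by blast
    moreover have "refl_elt ?r \<otimes> (p \<otimes> x) = p \<otimes> ?z"
      using refl_elt_act[OF pc r(1)] root_reflection(1)[OF r(1)] pc x S_cancel(2)[OF p(1)] S_inv[OF p(1)]
      by (simp add: m_assoc)
    ultimately have r1': "?r \<in> \<Phi>1 (p \<otimes> x)"
      using short lpx pr by (simp add: short_inversion_set_def pos_roots_iff)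
    obtain h where h: "h \<in> carrier W" "len (h \<otimes> (p \<otimes> x)) = len h + len (p \<otimes> x)"
      "\<rho> h ?r \<in> \<Phi>1 (h \<otimes> (p \<otimes> x))"
      and fin: "(\<exists>q\<in>S. \<rho> h ?r = \<alpha> q) \<or>
       (\<exists>q\<in>S. - \<rho> (inv (h \<otimes> (p \<otimes> x))) (\<alpha> q) \<in> K \<and> 0 < B (\<rho> h ?r) (\<alpha> q) \<and> \<rho> h ?r \<noteq> \<alpha> q \<and>
          \<rho> (inv h) (\<alpha> q) \<in> K)"
      using less.hyps[OF len_refl_elt_conj_less[OF r(1,2) p 3(1)] px r1'] by blast
    let ?h = "h \<otimes> p"
    have hc: "?h \<in> carrier W" using h pc by simp
    have hx: "?h \<otimes> x = h \<otimes> (p \<otimes> x)" using h pc x by (simp add: m_assoc)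
    have hr: "\<rho> ?h r = \<rho> h ?r" using act_mult h pc by simp
    have "len ?h \<le> len h + 1" using len_mult_S[OF h(1) p(1)] by auto
    then have red: "len (?h \<otimes> x) = len ?h + len x"
      using len_mult_le[OF hc x] h(2) lpx unfolding hx by simp
    have "\<rho> (inv ?h) (\<alpha> q) \<in> K"
      if q: "q \<in> S" "0 < B (\<rho> h ?r) (\<alpha> q)" "\<rho> (inv h) (\<alpha> q) \<in> K" for q
    proof -
      \<comment> \<open>\<open>\<alpha> p\<close> is the only positive root that \<open>p\<close>
        makes negative, and it is excluded by the sign of the form with
        \<open>\<rho> h ?r\<close>.\<close>
      have "\<rho> (inv h) (\<alpha> q) \<noteq> \<alpha> p"
      proof
        assume eq: "\<rho> (inv h) (\<alpha> q) = \<alpha> p"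
        have "B (\<rho> h ?r) (\<alpha> q) = B ?r (\<alpha> p)"
          using act_form[of "inv h" "\<rho> h ?r" "\<alpha> q"] h act_inv by (simp add: eq)
        also have "\<dots> = - B r (\<alpha> p)"
          using act_form[OF pc, of ?r "\<alpha> p"] act_inv(1)[OF pc, of r] S_inv[OF p(1)] act_simple_self[OF p(1)]
          by (simp add: B_simps)
        finally show False using q p by simp
      qed
      then have "\<rho> p (\<rho> (inv h) (\<alpha> q)) \<in> K"
        using simple_permutes_pos[OF _ q(3) p(1)] act_root simple_root q h by blast
      then show ?thesis
        using h pc S_inv[OF p(1)] by (simp add: inv_mult_group act_mult)
    qed
    then show ?thesis
      using hc red h(3) fin unfolding hx[symmetric] hr[symmetric] by blast
  qed
qed

lemma dp_short_inversion_le_descent: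
  assumes x: "x \<in> carrier W" and r: "r \<in> \<Phi>1 x"
  shows "\<exists>s\<in>S. - \<rho> (inv x) (\<alpha> s) \<in> K \<and> dp (- \<rho> (inv x) r) \<le> dp (- \<rho> (inv x) (\<alpha> s))"
proof -
  obtain h where h: "h \<in> carrier W" "len (h \<otimes> x) = len h + len x" "\<rho> h r \<in> \<Phi>1 (h \<otimes> x)"
    and fin: "(\<exists>q\<in>S. \<rho> h r = \<alpha> q) \<or>
     (\<exists>p\<in>S. - \<rho> (inv (h \<otimes> x)) (\<alpha> p) \<in> K \<and> 0 < B (\<rho> h r) (\<alpha> p) \<and> \<rho> h r \<noteq> \<alpha> p \<and>
        \<rho> (inv h) (\<alpha> p) \<in> K)"
    using raise_short_inversion[OF x r] by blast
  have hx: "h \<otimes> x \<in> carrier W" using h x by simp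
  have pull_back: "\<rho> (inv (h \<otimes> x)) (\<rho> h r) = \<rho> (inv x) r"
    using h x by (simp add: inv_mult_group act_mult act_inv)
  have rr: "r \<in> K" "- \<rho> (inv x) r \<in> K"
    using r short_inversion_set_iff[OF x] inversion_set_iff[OF x] by auto
  from fin show ?thesis
  proof
    assume "\<exists>q\<in>S. \<rho> h r = \<alpha> q"
    then obtain q where q: "q \<in> S" "\<rho> h r = \<alpha> q" by blast
    have "\<rho> (inv h) (\<alpha> q) = r"
      using act_inv(1)[OF h(1), of r] q by simp
    then show ?thesis
      using dp_le_right_descent_of_simple[OF h(1) x h(2) q(1)] pull_back q rr by simp
  next
    assume "\<exists>p\<in>S. - \<rho> (inv (h \<otimes> x)) (\<alpha> p) \<in> K \<and> 0 < B (\<rho> h r) (\<alpha> p) \<and> \<rho> h r \<noteq> \<alpha> p \<and>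
        \<rho> (inv h) (\<alpha> p) \<in> K"
    then obtain p where p: "p \<in> S" "- \<rho> (inv (h \<otimes> x)) (\<alpha> p) \<in> K" "0 < B (\<rho> h r) (\<alpha> p)"
      "\<rho> h r \<noteq> \<alpha> p" "\<rho> (inv h) (\<alpha> p) \<in> K" by blast
    have "dp (- \<rho> (inv x) r) \<le> dp (- \<rho> (inv (h \<otimes> x)) (\<alpha> p))"
      using dp_le_of_short_inversion[OF hx h(3) p(1-4)] pull_back by simp
    then show ?thesis
      using dp_le_right_descent_of_simple[OF h(1) x h(2) p(1,5,2)] by (meson order_trans)
  qed
qed

text \<open>Passes from left to right: the comparison just proved concerns the roots
  \<open>- \<rho> (inv x) r\<close>, and for \<open>x = inv u\<close> these become the short
  inversions of \<open>u\<close> themselves.\<close>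

lemma short_inversion_inv:
  assumes u: "u \<in> carrier W" and r: "r \<in> \<Phi>1 u"
  shows "- \<rho> (inv u) r \<in> \<Phi>1 (inv u)"
proof -
  have rr: "r \<in> R" "- \<rho> (inv u) r \<in> K" "len (refl_elt r \<otimes> u) + 1 = len u"
    using r short_inversion_set_iff[OF u] inversion_set_iff[OF u] by auto
  have iu: "inv u \<in> carrier W" using u by simp
  let ?q = "- \<rho> (inv u) r"
  have qR: "?q \<in> R" using neg_act_root[OF iu rr(1)] .
  have rf: "refl_elt ?q = refl_elt (\<rho> (inv u) r)"
    using root_reflection[OF qR] root_reflection[OF act_root[OF iu rr(1)]]
    by (intro faithful) (auto simp: reflection_def B_simps)
  have "refl_elt ?q \<otimes> inv u = inv (refl_elt r \<otimes> u)"
    unfolding rf refl_elt_act[OF iu rr(1)] using u root_reflection(1)[OF rr(1)]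
    by (simp add: m_assoc inv_mult_group inv_refl_elt[OF rr(1)])
  then have "len (refl_elt ?q \<otimes> inv u) + 1 = len (inv u)"
    using rr(3) len_inv[of "refl_elt r \<otimes> u"] len_inv[OF u] u root_reflection(1)[OF rr(1)] by simp
  then show ?thesis
    using qR rr(2) by (simp add: short_inversion_set_def pos_roots_iff)
qed

lemma dp_short_inversion_le_right_descent:
  assumes u: "u \<in> carrier W" and r: "r \<in> \<Phi>1 u"
  shows "\<exists>s\<in>S. - \<rho> u (\<alpha> s) \<in> K \<and> dp r \<le> dp (- \<rho> u (\<alpha> s))"
proof -
  have "- \<rho> u (- \<rho> (inv u) r) = r" using u by (simp add: act_linear act_inv)
  then show ?thesis
    using dp_short_inversion_le_descent[OF _ short_inversion_inv[OF u r]] u by simp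
qed

text \<open>A minimal subset of \<open>\<Phi>(u)\<close> with the same convex cone consists of elements of \<open>\<Phi>\<^sup>1(u)\<close>.\<close>

lemma inversion_set_subset_hull:
  assumes u: "u \<in> carrier W"
  shows "\<Phi> u \<subseteq> convex_cone hull (\<Phi>1 u)"
proof -
  define P where "P M \<longleftrightarrow> M \<subseteq> \<Phi> u \<and> \<Phi> u \<subseteq> convex_cone hull M" for M
  have fin: "finite (\<Phi> u)" using card_inversion_set[OF u] by blast
  have "P (\<Phi> u)" by (simp add: P_def hull_subset)
  then obtain M where M: "P M" "\<And>N. P N \<Longrightarrow> card M \<le> card N"
    using ex_has_least_nat[of P "\<Phi> u" card] by blast
  have MK: "M \<subseteq> K" using M(1) inversion_set_iff[OF u] by (auto simp: P_def)
  have "b \<in> \<Phi>1 u" if b: "b \<in> M" for b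
  proof (rule ccontr)
    assume nb: "b \<notin> \<Phi>1 u"
    have bu: "b \<in> \<Phi> u" using b M by (auto simp: P_def)
    then have bR: "b \<in> R" "b \<in> K" using inversion_set_iff[OF u] by auto
    obtain k where k: "k \<in> \<Phi> u" "k \<noteq> b" "- reflection B b k \<in> \<Phi> u"
      using nb bu short_inversion_set_iff[OF u] len_refl_mult_iff[OF u bu] by auto
    let ?N = "M - {b}" and ?H = "convex_cone hull (M - {b})"
    have HK: "?H \<subseteq> K"
      using MK by (intro hull_minimal) (auto simp: convex_cone_convex_cone_hull)
    have dec: "\<exists>a m. 0 \<le> a \<and> m \<in> ?H \<and> v = a *\<^sub>R b + m" if "v \<in> convex_cone hull M" for v
      using convex_cone_hull_insert_split[of v b ?N] that b by (simp add: insert_absorb)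
    have kH: "k \<in> convex_cone hull M" "- reflection B b k \<in> convex_cone hull M"
      using k M by (auto simp: P_def)
    obtain a m where am: "0 \<le> a" "m \<in> ?H" "k = a *\<^sub>R b + m" using dec[OF kH(1)] by blast
    obtain a' m' where am': "0 \<le> a'" "m' \<in> ?H" "- reflection B b k = a' *\<^sub>R b + m'"
      using dec[OF kH(2)] by blast
    define c where "c = 2 * B b k - a - a'"
    have "m = k - a *\<^sub>R b" "m' = - reflection B b k - a' *\<^sub>R b"
      using am(3) am'(3) by (metis add_diff_cancel_left')+
    then have sum: "m + m' = c *\<^sub>R b"
      by (simp only: c_def reflection_def) (simp add: algebra_simps)
    show False
    proof (cases "0 < c")
      case True
      have "(1 / c) *\<^sub>R (m + m') \<in> ?H"
        using True am am' by (intro convex_cone_hull_mul convex_cone_hull_add) auto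
      then have "b \<in> ?H" using True by (simp add: sum)
      then have "M \<subseteq> ?H" using hull_subset[of ?N convex_cone] by blast
      then have "convex_cone hull M \<subseteq> ?H"
        by (intro hull_minimal) (auto simp: convex_cone_convex_cone_hull)
      then have "P ?N" using M(1) by (auto simp: P_def)
      then have "card M \<le> card ?N" using M(2) by blast
      moreover have "finite M" using M(1) fin finite_subset by (auto simp: P_def)
      ultimately show False using b by (metis card_Diff1_less not_le)
    next
      case False
      have "m' + (- c) *\<^sub>R b \<in> K"
        using False am' HK bR by (intro K_add K_scale) auto
      moreover have "- m = m' + (- c) *\<^sub>R b"
        using sum by (simp add: algebra_simps eq_neg_iff_add_eq_0)
      ultimately have "m = 0" using K_pointed am HK by (metis subsetD)
      then have ka: "k = a *\<^sub>R b" using am by simp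
      have "k \<in> R" using k inversion_set_iff[OF u] by blast
      then have "a * a = 1"
        using ka root_norm[of k] root_norm[OF bR(1)] by (simp add: B_simps)
      then have "a = 1" using am(1) by (simp add: square_eq_1_iff)
      then show False using ka k by simp
    qed
  qed
  then have "M \<subseteq> \<Phi>1 u" by blast
  then show ?thesis
    using M(1) hull_mono[of M "\<Phi>1 u" convex_cone] by (auto simp: P_def)
qed

lemma inversion_set_subset_of_short:
  assumes u: "u \<in> carrier W" and w: "w \<in> carrier W" and sub: "\<Phi>1 u \<subseteq> \<Phi> w"
  shows "\<Phi> u \<subseteq> \<Phi> w"
proof -
  have "convex_cone {v. - \<rho> (inv w) v \<in> K}"
  proof (rule convex_cone_iff[THEN iffD2], intro conjI ballI allI impI)
    show "0 \<in> {v. - \<rho> (inv w) v \<in> K}"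
      using act_linear(4)[of "inv w" 0 0] w convex_cone_hull_contains_0 by simp
  next
    fix x y assume "x \<in> {v. - \<rho> (inv w) v \<in> K}" "y \<in> {v. - \<rho> (inv w) v \<in> K}"
    then show "x + y \<in> {v. - \<rho> (inv w) v \<in> K}"
      using neg_act_comb[of "inv w" x y 1 1] w by simp
  next
    fix x and c :: real assume "x \<in> {v. - \<rho> (inv w) v \<in> K}" "0 \<le> c"
    then show "c *\<^sub>R x \<in> {v. - \<rho> (inv w) v \<in> K}"
      using neg_act_comb[of "inv w" x x c 0] w by simp
  qed
  moreover have "\<Phi>1 u \<subseteq> {v. - \<rho> (inv w) v \<in> K}"
    using sub inversion_set_iff[OF w] by auto
  ultimately have "convex_cone hull (\<Phi>1 u) \<subseteq> {v. - \<rho> (inv w) v \<in> K}"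
    by (rule hull_minimal[rotated])
  then show ?thesis
    using inversion_set_subset_hull[OF u] inversion_set_iff[OF u] inversion_set_iff[OF w] by blast
qed

text \<open>\<open>\<rho> u\<close> embeds the inversions of \<open>inv u \<otimes> w\<close> into
  \<open>\<Phi> w - \<Phi> u\<close>, which bounds the length of this element from above;
  subadditivity of the length is the other half.\<close>

lemma right_weak_le_of_subset:
  assumes u: "u \<in> carrier W" and w: "w \<in> carrier W" and sub: "\<Phi> u \<subseteq> \<Phi> w"
  shows "right_weak_le W S u w"
proof -
  let ?v = "inv u \<otimes> w"
  have v: "?v \<in> carrier W" using u w by simp
  have act: "\<rho> (inv ?v) r = \<rho> (inv w) (\<rho> u r)" for r
    using u w by (simp add: inv_mult_group act_mult)
  have "\<rho> u ` \<Phi> ?v \<subseteq> \<Phi> w - \<Phi> u"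
  proof (rule image_subsetI)
    fix r assume "r \<in> \<Phi> ?v"
    then have r: "r \<in> R" "r \<in> K" "- \<rho> (inv w) (\<rho> u r) \<in> K"
      using inversion_set_iff[OF v] act by auto
    have urR: "\<rho> u r \<in> R" using act_root u r by blast
    have "\<rho> u r \<in> K"
    proof (rule ccontr)
      assume "\<rho> u r \<notin> K"
      then have "- \<rho> u r \<in> K" using not_pos_root urR by blast
      then have "- \<rho> u r \<in> \<Phi> u"
        using neg_root[OF urR] r u by (simp add: inversion_set_iff act_linear act_inv)
      then have "\<rho> (inv w) (\<rho> u r) \<in> K"
        using sub inversion_set_iff[OF w] w by (auto simp: act_linear)
      then show False using r root_not_both act_root[OF _ urR] w by blast
    qed
    moreover have "\<rho> u r \<notin> \<Phi> u"
      using r root_not_both u by (auto simp: inversion_set_iff act_inv)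
    ultimately show "\<rho> u r \<in> \<Phi> w - \<Phi> u"
      using urR r inversion_set_iff[OF w] by simp
  qed
  moreover have "inj_on (\<rho> u) (\<Phi> ?v)"
    using act_inv(1)[OF u] by (metis inj_onI)
  ultimately have "card (\<Phi> ?v) \<le> card (\<Phi> w - \<Phi> u)"
    using card_inversion_set[OF w] by (intro card_inj_on_le) auto
  then have "len ?v \<le> len w - len u"
    using card_inversion_set[OF v] card_inversion_set[OF w] card_inversion_set[OF u] sub
    by (simp add: card_Diff_subset)
  moreover have "len u \<le> len w"
    using card_mono[OF _ sub] card_inversion_set[OF w] card_inversion_set[OF u] by simp
  moreover have "len w \<le> len u + len ?v"
    using len_mult_le[OF u v] u w by (simp flip: m_assoc)
  ultimately show ?thesis by (simp add: right_weak_le_def)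
qed

section \<open>Low elements and the regions of the Shi arrangement\<close>

lemma dominance_le_iff:
  assumes "b \<in> R" "b \<in> K" "c \<in> R" "c \<in> K"
  shows "dominance_le W S \<rho> \<alpha> c b \<longleftrightarrow> rd.dom_le c b"
proof -
  have "dominance_le W S \<rho> \<alpha> c b \<longleftrightarrow> (\<forall>x\<in>carrier W. - \<rho> (inv x) b \<in> K \<longrightarrow> - \<rho> (inv x) c \<in> K)"
    using assms by (simp add: dominance_le_def inversion_set_iff)
  also have "\<dots> \<longleftrightarrow> (\<forall>x\<in>carrier W. - \<rho> x b \<in> K \<longrightarrow> - \<rho> x c \<in> K)"
    by (metis inv_closed inv_inv)
  finally show ?thesis by (simp add: rd.dom_le_def)
qed

text \<open>The difference of one comes from \<open>b\<close>, which \<open>rd.dominated b\<close>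
  contains and the \<infinity>-depth leaves out.\<close>

lemma dp_eq_inf_depth:
  assumes "b \<in> R" "b \<in> K"
  shows "dp b = inf_depth W S \<rho> \<alpha> b + 1"
proof -
  have "{c \<in> pos_roots W S \<rho> \<alpha> - {b}. dominance_le W S \<rho> \<alpha> c b} = rd.dominated b - {b}"
    using dominance_le_iff[OF assms] by (auto simp: pos_roots_iff rd.dominated_def)
  then have "inf_depth W S \<rho> \<alpha> b = card (rd.dominated b - {b})"
    unfolding inf_depth_def by (rule arg_cong)
  moreover have "b \<in> rd.dominated b"
    using assms rd.dom_le_refl unfolding rd.dominated_def by blast
  ultimately show ?thesis
    using card.remove[OF rd.finite_dominated[OF assms], of b] by linarith
qed

abbreviation \<Sigma> :: "nat \<Rightarrow> 'v set" where "\<Sigma> \<equiv> small_roots W S \<rho> \<alpha>"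
abbreviation low :: "nat \<Rightarrow> 'g set" where "low \<equiv> low_elements W S \<rho> \<alpha> B"

lemma small_roots_iff: "b \<in> \<Sigma> m \<longleftrightarrow> b \<in> R \<and> b \<in> K \<and> dp b \<le> m + 1"
  using dp_eq_inf_depth by (auto simp: small_roots_def pos_roots_iff)

definition same_side :: "'v set \<Rightarrow> 'g \<Rightarrow> 'g \<Rightarrow> bool" where
  "same_side D x y \<longleftrightarrow> (\<forall>b\<in>D. \<rho> (inv x) b \<in> K \<longleftrightarrow> \<rho> (inv y) b \<in> K)"

lemma same_side_sym: "same_side D x y \<Longrightarrow> same_side D y x"
  by (simp add: same_side_def)

lemma same_side_trans: "same_side D x y \<Longrightarrow> same_side D y z \<Longrightarrow> same_side D x z"
  by (simp add: same_side_def)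

lemma low_if_minimal_length:
  assumes u: "u \<in> carrier W" and min: "\<And>x. x \<in> carrier W \<Longrightarrow> same_side (\<Sigma> m) x u \<Longrightarrow> len u \<le> len x"
  shows "u \<in> low m"
proof -
  have desc: "- \<rho> u (\<alpha> s) \<in> \<Sigma> m" if s: "s \<in> S" "- \<rho> u (\<alpha> s) \<in> K" for s
  proof (rule ccontr)
    let ?b = "- \<rho> u (\<alpha> s)"
    assume nb: "?b \<notin> \<Sigma> m"
    have sc: "s \<in> carrier W" using s S_carrier by blast
    have us: "u \<otimes> s \<in> carrier W" using u sc by simp
    have "\<rho> u (\<alpha> s) \<notin> K"
      using s root_not_both[OF act_root[OF u simple_root]] by blast
    then have "len (u \<otimes> s) < len u"
      using act_simple_pos[OF u s(1)] len_mult_S[OF u s(1)] by auto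
    moreover have "same_side (\<Sigma> m) (u \<otimes> s) u"
      unfolding same_side_def
    proof
      fix c assume c: "c \<in> \<Sigma> m"
      then have cR: "c \<in> R" "c \<in> K" using small_roots_iff by auto
      let ?d = "\<rho> (inv u) c"
      have iu: "inv u \<in> carrier W" using u by simp
      have dR: "?d \<in> R" using act_root[OF iu] cR by blast
      have act: "\<rho> (inv (u \<otimes> s)) c = \<rho> s ?d"
        using u sc S_inv[OF s(1)] by (simp add: inv_mult_group act_mult)
      have cd: "c = \<rho> u ?d" using act_inv(2)[OF u] by simp
      have "?d \<noteq> \<alpha> s"
      proof
        assume "?d = \<alpha> s"
        then show False using cd cR \<open>\<rho> u (\<alpha> s) \<notin> K\<close> by metis
      qed
      then have 1: "?d \<in> K \<Longrightarrow> \<rho> s ?d \<in> K"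
        using simple_permutes_pos[OF dR _ s(1)] by blast
      have "- ?d \<noteq> \<alpha> s"
      proof
        assume "- ?d = \<alpha> s"
        then have "?b = - \<rho> u (- ?d)" by simp
        also have "\<dots> = c" using act_linear(3)[OF u] act_inv(2)[OF u] by simp
        finally show False using nb c by simp
      qed
      then have "- ?d \<in> K \<Longrightarrow> \<rho> s (- ?d) \<in> K"
        using simple_permutes_pos[OF neg_root[OF dR] _ s(1)] by blast
      then have "- ?d \<in> K \<Longrightarrow> - \<rho> s ?d \<in> K"
        using act_linear(3)[OF sc] by simp
      then have "?d \<notin> K \<Longrightarrow> \<rho> s ?d \<notin> K"
        using not_pos_root[OF dR] root_not_both[OF act_root[OF sc dR]] by blast
      with 1 show "\<rho> (inv (u \<otimes> s)) c \<in> K \<longleftrightarrow> ?d \<in> K"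
        unfolding act by blast
    qed
    ultimately show False using min[OF us] by simp
  qed
  have "r \<in> \<Sigma> m" if r: "r \<in> \<Phi>1 u" for r
  proof -
    obtain s where s: "s \<in> S" "- \<rho> u (\<alpha> s) \<in> K" "dp r \<le> dp (- \<rho> u (\<alpha> s))"
      using dp_short_inversion_le_right_descent[OF u r] by blast
    then show ?thesis
      using desc[OF s(1,2)] r short_inversion_set_iff[OF u] inversion_set_iff[OF u]
      by (auto simp: small_roots_iff)
  qed
  then show ?thesis using u by (auto simp: low_elements_def)
qed

lemma low_inversion_set_subset:
  assumes u: "u \<in> low m" and w: "w \<in> carrier W" and uw: "same_side (\<Sigma> m) u w"
  shows "\<Phi> u \<subseteq> \<Phi> w"
proof (rule inversion_set_subset_of_short)
  show uc: "u \<in> carrier W" using u by (simp add: low_elements_def)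
  show "\<Phi>1 u \<subseteq> \<Phi> w"
  proof
    fix r assume r: "r \<in> \<Phi>1 u"
    then have rS: "r \<in> \<Sigma> m" using u by (auto simp: low_elements_def)
    have rr: "r \<in> R" "r \<in> K" "- \<rho> (inv u) r \<in> K"
      using r short_inversion_set_iff[OF uc] inversion_set_iff[OF uc] by auto
    then have "\<rho> (inv u) r \<notin> K" using root_not_both act_root[OF _ rr(1)] uc by blast
    then have "\<rho> (inv w) r \<notin> K" using uw rS by (simp add: same_side_def)
    then show "r \<in> \<Phi> w"
      using rr not_pos_root act_root[OF _ rr(1)] w inversion_set_iff[OF w] by blast
  qed
qed (rule w)

lemma low_right_weak_le:
  assumes "u \<in> low m" "w \<in> carrier W" "same_side (\<Sigma> m) u w"
  shows "right_weak_le W S u w"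
  using right_weak_le_of_subset low_inversion_set_subset[OF assms] assms by (simp add: low_elements_def)

lemma right_weak_le_antisym_len:
  assumes "u \<in> carrier W" "w \<in> carrier W" "right_weak_le W S u w" "len w \<le> len u"
  shows "u = w"
proof -
  have "len (inv u \<otimes> w) = 0" using assms by (simp add: right_weak_le_def)
  then have "inv u \<otimes> w = \<one>" using len_eq_0 assms by simp
  then show ?thesis using assms by (metis inv_closed inv_equality inv_inv)
qed

lemma low_unique:
  assumes "u \<in> low m" "v \<in> low m" "same_side (\<Sigma> m) u v"
  shows "u = v"
proof -
  have c: "u \<in> carrier W" "v \<in> carrier W" using assms by (auto simp: low_elements_def)
  have "right_weak_le W S u v" "right_weak_le W S v u"
    using low_right_weak_le assms c same_side_sym by blast+
  then show ?thesis
    using right_weak_le_antisym_len[OF c] by (simp add: right_weak_le_def)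
qed

lemma low_exists:
  assumes w: "w \<in> carrier W"
  shows "\<exists>u\<in>low m. same_side (\<Sigma> m) u w"
proof -
  let ?P = "\<lambda>x. x \<in> carrier W \<and> same_side (\<Sigma> m) x w"
  have "?P w" using w by (simp add: same_side_def)
  then obtain u where u: "?P u" "\<And>x. ?P x \<Longrightarrow> len u \<le> len x"
    using ex_has_least_nat[of ?P w len] by blast
  then have "u \<in> low m"
    using same_side_trans by (intro low_if_minimal_length) blast+
  then show ?thesis using u by blast
qed

text \<open>On \<open>D\<close> the signs of a region can be read off from any element in it, so a
  representative replaces the sign function.\<close>

lemma closed_region_iff:
  assumes D: "D \<subseteq> pos_roots W S \<rho> \<alpha>"
  shows "closed_region W S \<rho> \<alpha> \<phi> C D Q \<longleftrightarrow>
    (\<exists>w\<in>carrier W. Q = chamber_union \<phi> C {x \<in> carrier W. same_side D x w})"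
proof -
  have sgn: "x \<in> pos_elements W S \<rho> \<alpha> (e *\<^sub>R b) \<longleftrightarrow> (\<rho> (inv x) b \<in> K \<longleftrightarrow> e = 1)"
    if "x \<in> carrier W" "b \<in> D" "e \<in> {1, - 1}" for x b and e :: real
  proof -
    have bR: "b \<in> R" using D that by (auto simp: pos_roots_iff)
    have ix: "inv x \<in> carrier W" using that by simp
    have "e = 1 \<or> e = - 1" using that by blast
    then consider "e = 1" | "e = - 1" by blast
    then show ?thesis
      using that act_root[OF ix bR] neg_act_root[OF ix bR] not_pos_root[OF act_root[OF ix bR]] ix
      by cases (auto simp: pos_elements_def pos_roots_iff act_linear)
  qed
  show ?thesis
  proof
    assume "closed_region W S \<rho> \<alpha> \<phi> C D Q"
    then obtain e X where e: "\<forall>b\<in>D. e b \<in> {1, - 1 :: real}"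
      and X: "X = {x \<in> carrier W. \<forall>b\<in>D. x \<in> pos_elements W S \<rho> \<alpha> (e b *\<^sub>R b)}" "X \<noteq> {}"
        "Q = chamber_union \<phi> C X"
      unfolding closed_region_def by blast
    then have XX: "X = {x \<in> carrier W. \<forall>b\<in>D. \<rho> (inv x) b \<in> K \<longleftrightarrow> e b = 1}"
      using sgn by auto
    obtain w where w: "w \<in> X" using X by blast
    then have "X = {x \<in> carrier W. same_side D x w}"
      unfolding XX same_side_def by blast
    then show "\<exists>w\<in>carrier W. Q = chamber_union \<phi> C {x \<in> carrier W. same_side D x w}"
      using X w XX by blast
  next
    assume "\<exists>w\<in>carrier W. Q = chamber_union \<phi> C {x \<in> carrier W. same_side D x w}"
    then obtain w where w: "w \<in> carrier W" "Q = chamber_union \<phi> C {x \<in> carrier W. same_side D x w}"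
      by blast
    let ?e = "\<lambda>b. if \<rho> (inv w) b \<in> K then 1 else - 1 :: real"
    have eq: "{x \<in> carrier W. same_side D x w} = {x \<in> carrier W. \<forall>b\<in>D. x \<in> pos_elements W S \<rho> \<alpha> (?e b *\<^sub>R b)}"
    proof -
      have "x \<in> pos_elements W S \<rho> \<alpha> (?e b *\<^sub>R b) \<longleftrightarrow> (\<rho> (inv x) b \<in> K \<longleftrightarrow> \<rho> (inv w) b \<in> K)"
        if "x \<in> carrier W" "b \<in> D" for x b
        using sgn[OF that, of "?e b"] by (cases "\<rho> (inv w) b \<in> K") auto
      then show ?thesis unfolding same_side_def by blast
    qed
    have "w \<in> {x \<in> carrier W. same_side D x w}" using w by (simp add: same_side_def)
    then have ne: "{x \<in> carrier W. same_side D x w} \<noteq> {}" by blast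
    have e: "\<forall>b\<in>D. ?e b \<in> {1, - 1}" by simp
    show "closed_region W S \<rho> \<alpha> \<phi> C D Q"
      unfolding closed_region_def by (rule exI, rule exI, rule conjI[OF e conjI[OF eq conjI[OF ne w(2)]]])
  qed
qed

end

section \<open>Chambers and walls of a chambered set\<close>

context chambered_set
begin

lemma chamber_point_eq:
  assumes "a \<in> C" "a' \<in> C" "x \<in> carrier W" "x' \<in> carrier W" "\<phi> x a = \<phi> x' a'"
  shows "a' = a" "inv x' \<otimes> x \<in> stabilizer W \<phi> a"
proof -
  have aU: "a \<in> U" "a' \<in> U" using C_subset assms by auto
  have "\<phi> (inv x' \<otimes> x) a = \<phi> (inv x') (\<phi> x' a')"
    using composition_rule[OF aU(1), of "inv x'" x] assms by simp
  also have "\<dots> = a'"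
    using orbit_sym_aux[OF assms(4) aU(2) HOL.refl] .
  finally have eq: "\<phi> (inv x' \<otimes> x) a = a'" .
  have "orbit W \<phi> a \<in> orbits W U \<phi>" using aU by (auto simp: orbits_def)
  moreover have "a' \<in> orbit W \<phi> a" "a \<in> orbit W \<phi> a"
    using eq assms orbit_refl[OF aU(1)] by (auto simp: orbit_def)
  ultimately show "a' = a"
    using orbit_representatives assms by blast
  then show "inv x' \<otimes> x \<in> stabilizer W \<phi> a"
    using eq assms by (simp add: stabilizer_def)
qed

text \<open>A translate of a point with trivial stabilizer lies in only one chamber, so it
  identifies that chamber inside a union.\<close>

lemma chamber_subset_iff:
  assumes solid: "solid W \<phi> C" and x: "x \<in> carrier W" and X: "X \<subseteq> carrier W"
  shows "chamber \<phi> C x \<subseteq> chamber_union \<phi> C X \<longleftrightarrow> x \<in> X"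
proof
  assume sub: "chamber \<phi> C x \<subseteq> chamber_union \<phi> C X"
  obtain a where a: "a \<in> C" "stabilizer W \<phi> a = {\<one>}" using solid by (auto simp: solid_def)
  have "\<phi> x a \<in> chamber_union \<phi> C X" using sub a by (auto simp: chamber_def)
  then obtain x' a' where x': "x' \<in> X" "a' \<in> C" "\<phi> x a = \<phi> x' a'"
    by (auto simp: chamber_union_def chamber_def)
  then have "inv x' \<otimes> x = \<one>"
    using chamber_point_eq(2)[OF a(1) x'(2) x _ x'(3)] X a by auto
  then have "x = x'"
    using x x' X by (metis inv_equality inv_closed inv_inv subsetD)
  then show "x \<in> X" using x' by simp
qed (auto simp: chamber_union_def)

end

context geometric_representation
begin

text \<open>The point \<open>\<phi> w a\<close> lies in exactly the chambers of \<open>w\<close> and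
  \<open>w \<otimes> s\<close>, which gives the two alternatives.\<close>

lemma mem_half_space_iff:
  assumes "chambered_set W S U \<phi> C" and a: "a \<in> C" "stabilizer W \<phi> a = {\<one>, s}" and s: "s \<in> S"
    and w: "w \<in> carrier W" and b: "b \<in> R"
  shows "\<phi> w a \<in> half_space W S \<rho> \<alpha> \<phi> C b \<longleftrightarrow> \<rho> (inv w) b \<in> K \<or> \<rho> s (\<rho> (inv w) b) \<in> K"
proof -
  interpret cs: chambered_set W S U \<phi> C by fact
  have sc: "s \<in> carrier W" using S_carrier s by blast
  have pos: "x \<in> pos_elements W S \<rho> \<alpha> b \<longleftrightarrow> x \<in> carrier W \<and> \<rho> (inv x) b \<in> K" for x
    using act_root[OF _ b] by (auto simp: pos_elements_def pos_roots_iff)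
  have ws: "\<rho> (inv (w \<otimes> s)) b = \<rho> s (\<rho> (inv w) b)"
    using w sc S_inv[OF s] by (simp add: inv_mult_group act_mult)
  have "\<phi> s a = a" using a by (auto simp: stabilizer_def)
  then have wsa: "\<phi> (w \<otimes> s) a = \<phi> w a"
    using cs.composition_rule[of a w s] w sc a cs.C_subset by auto
  show ?thesis
  proof
    assume "\<phi> w a \<in> half_space W S \<rho> \<alpha> \<phi> C b"
    then obtain x a' where x: "x \<in> carrier W" "\<rho> (inv x) b \<in> K" "a' \<in> C" "\<phi> w a = \<phi> x a'"
      by (auto simp: half_space_def chamber_union_def chamber_def pos)
    have "inv x \<otimes> w \<in> {\<one>, s}"
      using cs.chamber_point_eq(2)[OF a(1) x(3) w x(1,4)] a by simp
    then have "w = x \<or> w = x \<otimes> s"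
      using x w sc by (metis inv_solve_left insertE r_one singletonD one_closed)
    then show "\<rho> (inv w) b \<in> K \<or> \<rho> s (\<rho> (inv w) b) \<in> K"
    proof
      assume "w = x \<otimes> s"
      then have "x = w \<otimes> s" using S_cancel(1)[OF s x(1)] by simp
      then show ?thesis using x(2) ws by simp
    qed (use x in simp)
  next
    assume "\<rho> (inv w) b \<in> K \<or> \<rho> s (\<rho> (inv w) b) \<in> K"
    then have "w \<in> pos_elements W S \<rho> \<alpha> b \<or> w \<otimes> s \<in> pos_elements W S \<rho> \<alpha> b"
      using pos w sc ws by auto
    then show "\<phi> w a \<in> half_space W S \<rho> \<alpha> \<phi> C b"
      using a wsa unfolding half_space_def chamber_union_def chamber_def by (metis UN_I image_eqI)
  qed
qed

lemma mem_wall_iff: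
  assumes "chambered_set W S U \<phi> C" and a: "a \<in> C" "stabilizer W \<phi> a = {\<one>, s}" and s: "s \<in> S"
    and w: "w \<in> carrier W" and b: "b \<in> R"
  shows "\<phi> w a \<in> wall W S \<rho> \<alpha> \<phi> C b \<longleftrightarrow> \<rho> (inv w) b = \<alpha> s \<or> \<rho> (inv w) b = - \<alpha> s"
proof -
  let ?d = "\<rho> (inv w) b"
  have sc: "s \<in> carrier W" using S_carrier s by blast
  have dR: "?d \<in> R" using act_root[OF _ b] w by simp
  have neg: "\<rho> (inv w) (- b) = - ?d" "\<rho> s (- ?d) = - \<rho> s ?d"
    using act_linear(3) w sc by simp_all
  have sK: "\<alpha> s \<in> K" using simple_K s by blast
  have "\<phi> w a \<in> wall W S \<rho> \<alpha> \<phi> C b \<longleftrightarrow> (?d \<in> K \<or> \<rho> s ?d \<in> K) \<and> (- ?d \<in> K \<or> - \<rho> s ?d \<in> K)"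
    unfolding wall_def using mem_half_space_iff[OF assms(1-4) w b] mem_half_space_iff[OF assms(1-4) w neg_root[OF b]]
    by (simp add: neg)
  also have "\<dots> \<longleftrightarrow> ?d = \<alpha> s \<or> ?d = - \<alpha> s"
  proof
    assume "(?d \<in> K \<or> \<rho> s ?d \<in> K) \<and> (- ?d \<in> K \<or> - \<rho> s ?d \<in> K)"
    then consider "?d \<in> K" "- \<rho> s ?d \<in> K" | "\<rho> s ?d \<in> K" "- ?d \<in> K"
      using root_not_both[OF dR] root_not_both[OF act_root[OF sc dR]] by blast
    then show "?d = \<alpha> s \<or> ?d = - \<alpha> s"
    proof cases
      case 1
      then show ?thesis
        using simple_permutes_pos[OF dR _ s] root_not_both[OF act_root[OF sc dR]] by blast
    next
      case 2
      then have "- ?d = \<alpha> s"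
        using simple_permutes_pos[OF neg_root[OF dR] _ s] root_not_both[OF act_root[OF sc dR]] neg(2)
        by metis
      then show ?thesis by (metis minus_minus)
    qed
  next
    assume "?d = \<alpha> s \<or> ?d = - \<alpha> s"
    then show "(?d \<in> K \<or> \<rho> s ?d \<in> K) \<and> (- ?d \<in> K \<or> - \<rho> s ?d \<in> K)"
      using sK act_simple_self[OF s] act_linear(3)[OF sc] by auto
  qed
  finally show ?thesis .
qed

text \<open>By \<open>mem_wall_iff\<close>, a suitable point on the wall of \<open>b\<close> lies on
  no wall of a root other than \<open>b\<close> and \<open>- b\<close>. This recovers
  \<open>small_roots\<close> from the arrangement, which is given only as a set of walls.\<close>

lemma wall_inj:
  assumes cs: "chambered_set W S U \<phi> C" and walled: "walled W S \<phi> C"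
  shows "inj_on (wall W S \<rho> \<alpha> \<phi> C) (pos_roots W S \<rho> \<alpha>)"
proof (rule inj_onI)
  fix b c assume b: "b \<in> pos_roots W S \<rho> \<alpha>" and c: "c \<in> pos_roots W S \<rho> \<alpha>"
    and eq: "wall W S \<rho> \<alpha> \<phi> C b = wall W S \<rho> \<alpha> \<phi> C c"
  have R: "b \<in> R" "b \<in> K" "c \<in> R" "c \<in> K" using b c pos_roots_iff by auto
  obtain w s where w: "w \<in> carrier W" "s \<in> S" "b = \<rho> w (\<alpha> s)" using root_cases[OF R(1)] .
  obtain a where a: "a \<in> C" "stabilizer W \<phi> a = {\<one>, s}" using walled w by (auto simp: walled_def)
  have "\<rho> (inv w) b = \<alpha> s" using act_inv(1)[OF w(1)] w by simp
  then have "\<phi> w a \<in> wall W S \<rho> \<alpha> \<phi> C c"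
    using mem_wall_iff[OF cs a w(2,1) R(1)] eq by simp
  then have "\<rho> (inv w) c = \<alpha> s \<or> \<rho> (inv w) c = - \<alpha> s"
    using mem_wall_iff[OF cs a w(2,1) R(3)] by simp
  moreover have "c = \<rho> w (\<rho> (inv w) c)" using act_inv(2)[OF w(1)] by simp
  ultimately have "c = b \<or> c = - b"
    using w act_linear(3)[OF w(1)] by metis
  then show "b = c" using R root_not_both by blast
qed

theorem shi_regions_low_elements:
  assumes cs: "chambered_set W S U \<phi> C" and solid: "solid W \<phi> C" and walled: "walled W S \<phi> C"
  shows "w \<in> carrier W \<Longrightarrow> \<exists>!u. u \<in> low m \<and> shi_equiv W S \<rho> \<alpha> \<phi> C m u w"
    and "w \<in> carrier W \<Longrightarrow> u \<in> low m \<Longrightarrow> shi_equiv W S \<rho> \<alpha> \<phi> C m u w \<Longrightarrow> right_weak_le W S u w"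
    and "region_of_arrangement W S \<rho> \<alpha> \<phi> C (shi_arrangement W S \<rho> \<alpha> \<phi> C m) Q \<Longrightarrow>
      \<exists>!u. is_arg_min len (\<lambda>x. x \<in> carrier W \<and> chamber \<phi> C x \<subseteq> Q) u"
    and "region_of_arrangement W S \<rho> \<alpha> \<phi> C (shi_arrangement W S \<rho> \<alpha> \<phi> C m) Q \<Longrightarrow>
      is_arg_min len (\<lambda>x. x \<in> carrier W \<and> chamber \<phi> C x \<subseteq> Q) u \<Longrightarrow> u \<in> low m"
proof -
  interpret cs: chambered_set W S U \<phi> C by fact
  have sub: "\<Sigma> m \<subseteq> pos_roots W S \<rho> \<alpha>" by (auto simp: small_roots_def)
  let ?X = "\<lambda>w. {x \<in> carrier W. same_side (\<Sigma> m) x w}"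
  have ch: "chamber \<phi> C x \<subseteq> chamber_union \<phi> C (?X v) \<longleftrightarrow> same_side (\<Sigma> m) x v"
    if "x \<in> carrier W" for x v
    using cs.chamber_subset_iff[OF solid that, of "?X v"] that by auto
  have equiv: "shi_equiv W S \<rho> \<alpha> \<phi> C m x y \<longleftrightarrow> same_side (\<Sigma> m) x y"
    if x: "x \<in> carrier W" and y: "y \<in> carrier W" for x y
  proof
    assume "shi_equiv W S \<rho> \<alpha> \<phi> C m x y"
    then obtain v where "v \<in> carrier W" "chamber \<phi> C x \<subseteq> chamber_union \<phi> C (?X v)"
      "chamber \<phi> C y \<subseteq> chamber_union \<phi> C (?X v)"
      unfolding shi_equiv_def closed_region_iff[OF sub] by blast
    then have "same_side (\<Sigma> m) x v" "same_side (\<Sigma> m) y v"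
      using ch x y by simp_all
    then show "same_side (\<Sigma> m) x y"
      by (rule same_side_trans[OF _ same_side_sym])
  next
    assume "same_side (\<Sigma> m) x y"
    then have "chamber \<phi> C x \<subseteq> chamber_union \<phi> C (?X y)" "chamber \<phi> C y \<subseteq> chamber_union \<phi> C (?X y)"
      using ch x y by (simp_all add: same_side_def)
    then show "shi_equiv W S \<rho> \<alpha> \<phi> C m x y"
      unfolding shi_equiv_def closed_region_iff[OF sub] using y by blast
  qed
  have low_carrier: "u \<in> carrier W" if "u \<in> low m" for u using that by (simp add: low_elements_def)
  show "\<exists>!u. u \<in> low m \<and> shi_equiv W S \<rho> \<alpha> \<phi> C m u w" if w: "w \<in> carrier W"
  proof -
    obtain u where u: "u \<in> low m" "same_side (\<Sigma> m) u w" using low_exists[OF w] by blast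
    show ?thesis
    proof (rule ex1I)
      show "u \<in> low m \<and> shi_equiv W S \<rho> \<alpha> \<phi> C m u w" using u equiv low_carrier w by simp
      fix v assume "v \<in> low m \<and> shi_equiv W S \<rho> \<alpha> \<phi> C m v w"
      then have v: "v \<in> low m" "same_side (\<Sigma> m) v w" using equiv low_carrier w by auto
      then show "v = u"
        using low_unique[OF v(1) u(1)] same_side_trans[OF v(2) same_side_sym[OF u(2)]] by blast
    qed
  qed
  show "right_weak_le W S u w"
    if "w \<in> carrier W" "u \<in> low m" "shi_equiv W S \<rho> \<alpha> \<phi> C m u w"
    by (rule low_right_weak_le[OF that(2,1) iffD1[OF equiv[OF low_carrier[OF that(2)] that(1)] that(3)]])
  let ?region = "region_of_arrangement W S \<rho> \<alpha> \<phi> C (shi_arrangement W S \<rho> \<alpha> \<phi> C m) Q"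
  let ?min = "is_arg_min len (\<lambda>x. x \<in> carrier W \<and> chamber \<phi> C x \<subseteq> Q)"
  have region: "\<exists>w\<in>carrier W. \<forall>x\<in>carrier W. chamber \<phi> C x \<subseteq> Q \<longleftrightarrow> same_side (\<Sigma> m) x w"
    if reg: ?region
  proof -
    obtain D where D: "D \<subseteq> pos_roots W S \<rho> \<alpha>"
      "wall W S \<rho> \<alpha> \<phi> C ` \<Sigma> m = wall W S \<rho> \<alpha> \<phi> C ` D" "closed_region W S \<rho> \<alpha> \<phi> C D Q"
      using reg unfolding region_of_arrangement_def shi_arrangement_def
      by (elim exE conjE) (rule that)
    have "D = \<Sigma> m"
      using inj_on_image_eq_iff[OF wall_inj[OF cs walled] sub D(1)] D(2) by simp
    then have "closed_region W S \<rho> \<alpha> \<phi> C (\<Sigma> m) Q" using D(3) by simp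
    then obtain v where v: "v \<in> carrier W" "Q = chamber_union \<phi> C (?X v)"
      unfolding closed_region_iff[OF sub] by (elim bexE) (rule that)
    show ?thesis
      unfolding v(2) using ch v(1) by (intro bexI[of _ v] ballI) auto
  qed
  show low_min: "u \<in> low m" if reg: ?region and min: "?min u" for u
  proof -
    obtain w where w: "w \<in> carrier W" "\<And>x. x \<in> carrier W \<Longrightarrow> chamber \<phi> C x \<subseteq> Q \<longleftrightarrow> same_side (\<Sigma> m) x w"
      using region[OF reg] by (elim bexE) (metis that)
    have u: "u \<in> carrier W" "same_side (\<Sigma> m) u w"
      using min w by (auto simp: is_arg_min_def)
    show ?thesis
    proof (rule low_if_minimal_length[OF u(1)])
      fix x assume "x \<in> carrier W" "same_side (\<Sigma> m) x u"
      then have "x \<in> carrier W \<and> chamber \<phi> C x \<subseteq> Q"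
        using w(2) same_side_trans[OF _ u(2)] by simp
      then show "len u \<le> len x"
        using min by (auto simp: is_arg_min_linorder)
    qed
  qed
  show "\<exists>!u. ?min u" if reg: ?region
  proof -
    obtain w where w: "w \<in> carrier W" "\<And>x. x \<in> carrier W \<Longrightarrow> chamber \<phi> C x \<subseteq> Q \<longleftrightarrow> same_side (\<Sigma> m) x w"
      using region[OF reg] by (elim bexE) (metis that)
    have "w \<in> carrier W \<and> chamber \<phi> C w \<subseteq> Q"
      using w by (simp add: same_side_def)
    then have "\<exists>u. ?min u"
      unfolding is_arg_min_linorder
      by (rule ex_has_least_nat[of "\<lambda>x. x \<in> carrier W \<and> chamber \<phi> C x \<subseteq> Q" w len])
    then obtain u where u: "?min u" by blast
    \<comment> \<open>Both are low and lie in the same region, so uniqueness of the low element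
      already gives uniqueness of the minimum.\<close>
    have "v = u" if v: "?min v" for v
    proof -
      have "v \<in> carrier W \<and> chamber \<phi> C v \<subseteq> Q" "u \<in> carrier W \<and> chamber \<phi> C u \<subseteq> Q"
        using u v by (simp_all add: is_arg_min_def)
      then have "same_side (\<Sigma> m) v w" "same_side (\<Sigma> m) u w"
        using w(2)[of v] w(2)[of u] by auto
      then have "same_side (\<Sigma> m) v u"
        by (rule same_side_trans[OF _ same_side_sym])
      then show ?thesis
        by (rule low_unique[OF low_min[OF reg v] low_min[OF reg u]])
    qed
    then show ?thesis using u by blast
  qed
qed

end

theorem theorem6p4:
  fixes W :: "('g, 'x) monoid_scheme" and S :: "'g set"
    and \<rho> :: "'g \<Rightarrow> 'v::real_vector \<Rightarrow> 'v" and \<alpha> :: "'g \<Rightarrow> 'v" and B :: "'v \<Rightarrow> 'v \<Rightarrow> real"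
    and U :: "'u set" and \<phi> :: "'g \<Rightarrow> 'u \<Rightarrow> 'u" and C :: "'u set"
    and m :: nat
  assumes "geometric_representation W S \<rho> \<alpha> B"
    and "chambered_set W S U \<phi> C"
    and "solid W \<phi> C"
    and "walled W S \<phi> C"
  shows "(\<forall>w \<in> carrier W.
            (\<exists>!u. u \<in> low_elements W S \<rho> \<alpha> B m \<and> shi_equiv W S \<rho> \<alpha> \<phi> C m u w) \<and>
            (\<forall>u. u \<in> low_elements W S \<rho> \<alpha> B m \<and> shi_equiv W S \<rho> \<alpha> \<phi> C m u w \<longrightarrow>
                 right_weak_le W S u w)) \<and>
         (\<forall>R. region_of_arrangement W S \<rho> \<alpha> \<phi> C (shi_arrangement W S \<rho> \<alpha> \<phi> C m) R \<longrightarrow>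
            (\<exists>!u. is_arg_min (cox_length W S) (\<lambda>x. x \<in> carrier W \<and> chamber \<phi> C x \<subseteq> R) u) \<and>
            (\<forall>u. is_arg_min (cox_length W S) (\<lambda>x. x \<in> carrier W \<and> chamber \<phi> C x \<subseteq> R) u \<longrightarrow>
                 u \<in> low_elements W S \<rho> \<alpha> B m))"
proof -
  interpret geometric_representation W S \<rho> \<alpha> B by fact
  note main = shi_regions_low_elements[OF assms(2-4)]
  show ?thesis
    by (intro conjI allI ballI impI main(1) main(3); (elim conjE)?)
      (assumption | rule main(2) main(4))+
qed

end
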